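(* Let $X$ be a classical Hopf surface. The nowhere-vanishing $L_b$-twisted trace-free Higgs bundles of the form $(\mathcal{O}_X\oplus H,\phi)$ with $H\in\mathrm{Pic}(X)$, $\deg(H)\le 0$, up to conjugation by an automorphism of $\mathcal{O}_X\oplus H$, are as follows: (1) $H\simeq\mathcal{O}_X$ and $$\phi=\begin{pmatrix} tx & sx+uy\\ y & -tx\end{pmatrix},$$ where $s,t,u\in\mathbb{C}$ and $s^2-4t^2u\neq 0$, up to changing $t$ to $-t$. This Higgs field always has irreducible spectral curve. (2) $H\simeq L_b^{-1}$ and $$\phi=\begin{pmatrix}0&\beta\\1&0\end{pmatrix}$$ with $\beta\in H^0(X,(L_b)^2)$. This Higgs field has irreducible spectral curve when $\beta$ is not a square. When $\beta=t^2$ for some $t\in H^0(X,L_b)$, the $\phi$-invariant sub-line bundles are $L_b^{-1}$ under the inclusions $(\pm t,1)$. (3) $H\simeq(L_b)^{-k}$ for some $k\ge 0$ and $$\phi=\begin{pmatrix}ux+vy & (\overline{v}x-\overline{u}y)^{1+k}\\0&-ux-vy\end{pmatrix}$$ for $u,v\in\mathbb{C}$ which are not both zero. The $\phi$-invariant sub-line bundles are the first direct summand $\mathcal{O}_X$ and $(L_b)^{-1-k}$ under the inclusion $((\overline{v}x-\overline{u}y)^{1+k},-2ux-2vy)$.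
   Context: A classical Hopf surface is $X=(\mathbb{C}^2\setminus\{0\})/\langle F\rangle$ with $F(x,y)=(bx,by)$, $0<|b|<1$. For $\tau\in\mathbb{C}^*$, $L_\tau$ is the line bundle on $X$ obtained from $(\mathbb{C}^2\setminus\{0\})\times\mathbb{C}$ by identifying $(p,v)\sim(F(p),\tau v)$; every line bundle is isomorphic to a unique $L_\tau$. Sections of $L_\tau$ are identified with holomorphic functions $s$ on $\mathbb{C}^2\setminus\{0\}$ with $s\circ F=\tau s$. The degree is $\deg(L_\tau)=\log|\tau|/\log|b|$. A $\lambda$-twisted trace-free Higgs bundle is a pair $(E,\phi)$ with $E$ a rank-2 bundle and $\phi\in H^0(X,\mathcal{E}nd_0(E)\otimes\lambda)$, where $\mathcal{E}nd_0(E)$ denotes trace-free endomorphisms. For $E=\mathcal{O}_X\oplus H$, $\phi$ is written as a matrix $\begin{pmatrix}p&q\\ w&-p\end{pmatrix}$ acting on column vectors, with $p\in H^0(X,\lambda)$, $q\in H^0(X,\lambda\otimes H^{-1})$, $w\in H^0(X,\lambda\otimes H)$. An inclusion $(f,g)$ of a line bundle $M$ means the map $M\to\mathcal{O}_X\oplus H$ with components $f\in H^0(X,M^{-1})$, $g\in H^0(X,M^{-1}\otimes H)$. A sub-line bundle $M$ (taken with torsion-free quotient) is $\phi$-invariant if $\phi(M)\subseteq M\otimes\lambda$. The spectral curve is the zero locus of the characteristic polynomial of $\phi$ in the total space of $\lambda$. Listed Higgs fields are determined by their parameters up to conjugation by automorphisms of $E$ unless otherwise indicated. *)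

theory Defs
  imports "HOL-Analysis.Analysis"
begin

text \<open>
  A line bundle on the Hopf surface \<open>X = (\<complex>\<^sup>2 - {0}) / \<langle>F\<rangle>\<close> is given by its multiplier
  \<open>\<tau> \<noteq> 0\<close>, which is a complete isomorphism invariant: tensor products and duals of bundles become
  products and inverses of multipliers.  Sections are equivariant functions on \<open>\<complex>\<^sup>2 - {0}\<close>,
  represented by total functions whose value at the origin is irrelevant.
\<close>

definition punctured_plane :: "(complex \<times> complex) set" where
  "punctured_plane = UNIV - {(0, 0)}"

definition hopf_map :: "complex \<Rightarrow> complex \<times> complex \<Rightarrow> complex \<times> complex" where
  "hopf_map b = (\<lambda>(x, y). (b * x, b * y))"

text \<open>Holomorphy in several variables (on open sets): a complex linear Frechet derivative exists.\<close>

definition holomorphic2_on :: "(complex \<times> complex \<Rightarrow> complex) \<Rightarrow> (complex \<times> complex) set \<Rightarrow> bool"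
    (infixl "holomorphic2'_on" 50) where
  "f holomorphic2_on U \<longleftrightarrow>
     (\<forall>p\<in>U. \<exists>c1 c2. (f has_derivative (\<lambda>(h1, h2). c1 * h1 + c2 * h2)) (at p))"

definition holomorphic3_on ::
    "((complex \<times> complex) \<times> complex \<Rightarrow> complex) \<Rightarrow> ((complex \<times> complex) \<times> complex) set \<Rightarrow> bool"
    (infixl "holomorphic3'_on" 50) where
  "f holomorphic3_on U \<longleftrightarrow>
     (\<forall>p\<in>U. \<exists>c1 c2 c3.
        (f has_derivative (\<lambda>((h1, h2), h3). c1 * h1 + c2 * h2 + c3 * h3)) (at p))"

definition sections :: "complex \<Rightarrow> complex \<Rightarrow> (complex \<times> complex \<Rightarrow> complex) set" where
  "sections b \<tau> = {s. s holomorphic2_on punctured_plane \<and>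
     (\<forall>p\<in>punctured_plane. s (hopf_map b p) = \<tau> * s p)}"

definition line_degree :: "complex \<Rightarrow> complex \<Rightarrow> real" where
  "line_degree b \<tau> = ln (cmod \<tau>) / ln (cmod b)"


subsection \<open>Higgs fields on \<open>\<O> \<oplus> L\<^sub>\<tau>\<close>\<close>

definition multipliers :: "complex \<Rightarrow> complex ^ 2" where
  "multipliers \<tau> = vector [1, \<tau>]"

text \<open>
  Sections of \<open>End(\<O> \<oplus> L\<^sub>\<tau>) \<otimes> L\<^sub>\<nu>\<close>: the entry in row \<open>i\<close> and column \<open>j\<close> maps the
  \<open>j\<close>-th summand to the \<open>i\<close>-th one twisted by \<open>L\<^sub>\<nu>\<close>.
\<close>

definition end_sections :: "complex \<Rightarrow> complex \<Rightarrow> complex \<Rightarrow> (complex \<times> complex \<Rightarrow> complex ^ 2 ^ 2) set" where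
  "end_sections b \<nu> \<tau> =
     {A. \<forall>i j. (\<lambda>p. A p $ i $ j) \<in> sections b (\<nu> * multipliers \<tau> $ i / multipliers \<tau> $ j)}"

definition higgs_fields :: "complex \<Rightarrow> complex \<Rightarrow> complex \<Rightarrow> (complex \<times> complex \<Rightarrow> complex ^ 2 ^ 2) set" where
  "higgs_fields b \<nu> \<tau> =
     {\<phi> \<in> end_sections b \<nu> \<tau>. \<forall>p\<in>punctured_plane. trace (\<phi> p) = 0}"

definition nowhere_vanishing :: "(complex \<times> complex \<Rightarrow> complex ^ 2 ^ 2) \<Rightarrow> bool" where
  "nowhere_vanishing \<phi> \<longleftrightarrow> (\<forall>p\<in>punctured_plane. \<phi> p \<noteq> 0)"

definition automorphisms :: "complex \<Rightarrow> complex \<Rightarrow> (complex \<times> complex \<Rightarrow> complex ^ 2 ^ 2) set" where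
  "automorphisms b \<tau> = {g \<in> end_sections b 1 \<tau>. \<forall>p\<in>punctured_plane. invertible (g p)}"

definition conjugate_higgs ::
    "complex \<Rightarrow> complex \<Rightarrow> (complex \<times> complex \<Rightarrow> complex ^ 2 ^ 2)
      \<Rightarrow> (complex \<times> complex \<Rightarrow> complex ^ 2 ^ 2) \<Rightarrow> bool" where
  "conjugate_higgs b \<tau> \<phi> \<psi> \<longleftrightarrow>
     (\<exists>g\<in>automorphisms b \<tau>. \<forall>p\<in>punctured_plane. \<psi> p = g p ** \<phi> p ** matrix_inv (g p))"


subsection \<open>Sub-line bundles\<close>

text \<open>
  The quotient of \<open>\<O> \<oplus> L\<^sub>\<tau>\<close> by the image of \<open>\<sigma>\<close> has torsion-free stalks: if a nonzero germ \<open>a\<close>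
  multiplies the germ \<open>e\<close> into the image, then \<open>e\<close> lies in the image.  On a connected \<open>U\<close>, the germ
  of \<open>a\<close> at \<open>p\<close> is nonzero iff \<open>a\<close> is not identically zero.  Since the covering of \<open>X\<close> is
  a local biholomorphism, the stalks may be computed on \<open>\<complex>\<^sup>2 - {0}\<close>.
\<close>

definition torsion_free_quotient :: "(complex \<times> complex \<Rightarrow> complex ^ 2) \<Rightarrow> bool" where
  "torsion_free_quotient \<sigma> \<longleftrightarrow>
     (\<forall>p U a c e. open U \<and> connected U \<and> p \<in> U \<and> U \<subseteq> punctured_plane \<and>
        a holomorphic2_on U \<and> c holomorphic2_on U \<and> (\<forall>i. (\<lambda>z. e z $ i) holomorphic2_on U) \<and>
        (\<exists>z\<in>U. a z \<noteq> 0) \<and> (\<forall>z\<in>U. a z *s e z = c z *s \<sigma> z)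
      \<longrightarrow> (\<exists>V d. open V \<and> p \<in> V \<and> V \<subseteq> U \<and> d holomorphic2_on V \<and>
             (\<forall>z\<in>V. e z = d z *s \<sigma> z)))"

text \<open>\<open>L\<^sub>\<mu>\<close> is a sub-line bundle of \<open>\<O> \<oplus> L\<^sub>\<tau>\<close> under the inclusion with components \<open>\<sigma>\<close>.\<close>

definition sub_line_bundle :: "complex \<Rightarrow> complex \<Rightarrow> complex \<Rightarrow> (complex \<times> complex \<Rightarrow> complex ^ 2) \<Rightarrow> bool" where
  "sub_line_bundle b \<tau> \<mu> \<sigma> \<longleftrightarrow>
     \<mu> \<noteq> 0 \<and> (\<forall>i. (\<lambda>p. \<sigma> p $ i) \<in> sections b (multipliers \<tau> $ i / \<mu>)) \<and>
     (\<exists>p\<in>punctured_plane. \<sigma> p \<noteq> 0) \<and> torsion_free_quotient \<sigma>"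

text \<open>Invariance: \<open>\<phi>\<close> restricts to a map from \<open>L\<^sub>\<mu>\<close> to \<open>L\<^sub>\<mu> \<otimes> L\<^sub>\<nu>\<close>, i.e. to a section \<open>a\<close> of \<open>L\<^sub>\<nu>\<close>.\<close>

definition invariant_sub_line_bundle ::
    "complex \<Rightarrow> complex \<Rightarrow> complex \<Rightarrow> (complex \<times> complex \<Rightarrow> complex ^ 2 ^ 2)
      \<Rightarrow> complex \<Rightarrow> (complex \<times> complex \<Rightarrow> complex ^ 2) \<Rightarrow> bool" where
  "invariant_sub_line_bundle b \<nu> \<tau> \<phi> \<mu> \<sigma> \<longleftrightarrow>
     sub_line_bundle b \<tau> \<mu> \<sigma> \<and>
     (\<exists>a\<in>sections b \<nu>. \<forall>p\<in>punctured_plane. \<phi> p *v \<sigma> p = a p *s \<sigma> p)"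

text \<open>Inclusions of \<open>L\<^sub>\<mu>\<close> with the same image differ by an automorphism of \<open>L\<^sub>\<mu>\<close>, a nonzero constant.\<close>

definition same_image :: "(complex \<times> complex \<Rightarrow> complex ^ 2) \<Rightarrow> (complex \<times> complex \<Rightarrow> complex ^ 2) \<Rightarrow> bool" where
  "same_image \<sigma> \<sigma>' \<longleftrightarrow> (\<exists>c. c \<noteq> 0 \<and> (\<forall>p\<in>punctured_plane. \<sigma> p = c *s \<sigma>' p))"


subsection \<open>The spectral curve\<close>

text \<open>The total space of \<open>L\<^sub>\<tau>\<close>: the quotient by the group generated by \<open>(p, v) \<mapsto> (F p, \<tau> v)\<close>.\<close>

definition total_rel ::
    "complex \<Rightarrow> complex \<Rightarrow> (((complex \<times> complex) \<times> complex) \<times> ((complex \<times> complex) \<times> complex)) set" where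
  "total_rel b \<tau> = {((p, v), (p', v')). p \<in> punctured_plane \<and>
     (\<exists>n::int. p' = hopf_map (b powi n) p \<and> v' = \<tau> powi n * v)}"

definition total_space :: "complex \<Rightarrow> complex \<Rightarrow> ((complex \<times> complex) \<times> complex) set set" where
  "total_space b \<tau> = (punctured_plane \<times> UNIV) // total_rel b \<tau>"

definition analytic_subset :: "((complex \<times> complex) \<times> complex) set \<Rightarrow> ((complex \<times> complex) \<times> complex) set \<Rightarrow> bool" where
  "analytic_subset W A \<longleftrightarrow> A \<subseteq> W \<and>
     (\<forall>p\<in>W. \<exists>U G. open U \<and> p \<in> U \<and> U \<subseteq> W \<and> finite G \<and> (\<forall>g\<in>G. g holomorphic3_on U) \<and>
        A \<inter> U = {z \<in> U. \<forall>g\<in>G. g z = 0})"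

text \<open>\<open>\<Union>Z\<close> is the preimage of \<open>Z\<close> under the covering of the total space.\<close>

definition analytic_in_total_space :: "complex \<Rightarrow> complex \<Rightarrow> ((complex \<times> complex) \<times> complex) set set \<Rightarrow> bool" where
  "analytic_in_total_space b \<tau> Z \<longleftrightarrow>
     Z \<subseteq> total_space b \<tau> \<and> analytic_subset (punctured_plane \<times> UNIV) (\<Union>Z)"

definition irreducible_in_total_space :: "complex \<Rightarrow> complex \<Rightarrow> ((complex \<times> complex) \<times> complex) set set \<Rightarrow> bool" where
  "irreducible_in_total_space b \<tau> Z \<longleftrightarrow>
     analytic_in_total_space b \<tau> Z \<and> Z \<noteq> {} \<and>
     (\<forall>Z1 Z2. analytic_in_total_space b \<tau> Z1 \<and> analytic_in_total_space b \<tau> Z2 \<and> Z = Z1 \<union> Z2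
        \<longrightarrow> Z1 = Z \<or> Z2 = Z)"

text \<open>Vanishing of the characteristic polynomial does not depend on the representative \<open>(p, v)\<close>.\<close>

definition spectral_curve ::
    "complex \<Rightarrow> complex \<Rightarrow> (complex \<times> complex \<Rightarrow> complex ^ 2 ^ 2) \<Rightarrow> ((complex \<times> complex) \<times> complex) set set" where
  "spectral_curve b \<nu> \<phi> = {C \<in> total_space b \<nu>. \<forall>(p, v)\<in>C. det (mat v - \<phi> p) = 0}"


subsection \<open>The listed Higgs fields\<close>

definition phi1 :: "complex \<Rightarrow> complex \<Rightarrow> complex \<Rightarrow> complex \<times> complex \<Rightarrow> complex ^ 2 ^ 2" where
  "phi1 s t u = (\<lambda>(x, y). vector [vector [t * x, s * x + u * y],
                                  vector [y, - (t * x)]])"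

definition phi2 :: "(complex \<times> complex \<Rightarrow> complex) \<Rightarrow> complex \<times> complex \<Rightarrow> complex ^ 2 ^ 2" where
  "phi2 \<beta> = (\<lambda>p. vector [vector [0, \<beta> p],
                           vector [1, 0]])"

definition phi3 :: "nat \<Rightarrow> complex \<Rightarrow> complex \<Rightarrow> complex \<times> complex \<Rightarrow> complex ^ 2 ^ 2" where
  "phi3 k u v = (\<lambda>(x, y). vector [vector [u * x + v * y, (cnj v * x - cnj u * y) ^ (1 + k)],
                                  vector [0, - (u * x) - v * y]])"

end

theory Submission
  imports Defs "HOL-Complex_Analysis.Conformal_Mappings"
begin

text \<open>
  A section of \<open>L\<^sub>\<tau>\<close> has polynomial growth, because it is determined by its values on a compact
  fundamental annulus.  By Liouville's theorem it is a polynomial, and equivariance makes it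
  homogeneous of degree \<open>m\<close> when \<open>\<tau> = b ^ m\<close>, and zero when \<open>\<tau>\<close> is not such a power.  A Higgs field
  on \<open>\<O> \<oplus> L\<^sub>\<tau>\<close> with \<open>\<bar>\<tau>\<bar> \<ge> 1\<close> is therefore a matrix of forms, and it vanishes somewhere unless
  \<open>\<tau> = b ^ (- k)\<close>.  For \<open>k = 0\<close> it is a pencil \<open>x A + y B\<close> of constant matrices, and the cases (1) and
  (3) are distinguished by the existence of a common eigenvector of \<open>A\<close> and \<open>B\<close>; for \<open>k = 1\<close> the
  lower left entry is a constant, which gives case (2) if it is nonzero; otherwise the matrix is
  triangular.  The normal forms are told apart by their determinants and, in the triangular case, by
  the eigenvalue on the first summand.

  An invariant line subbundle corresponds to a square root of \<open>- det \<phi>\<close>, and a saturated subsheaf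
  has a generator without zeros, which fixes its multiplier.  The spectral curve
  \<open>v\<^sup>2 = - det \<phi>\<close> with nondegenerate \<open>det \<phi>\<close> is a quadric cone without its vertex, which is the image
  of the punctured plane under \<open>(\<xi>, \<eta>) \<mapsto> (\<xi>\<^sup>2, \<eta>\<^sup>2, \<xi> \<eta>)\<close>; so it is irreducible by the identity theorem.
\<close>

subsection \<open>Holomorphic functions of two variables\<close>

text \<open>The domain omits the origin, so a section is not given as an entire function. Lines with
  \<open>y \<noteq> 0\<close> fixed and lines with \<open>x \<noteq> 0\<close> fixed miss the
  origin, however; restriction to them needs only one-variable theory, and the two families together
  force joint polynomiality. The conjugates in the third family single out one linear form:
  \<open>cnj v * x - cnj u * y\<close> takes the positive value \<open>u * cnj u + v * cnj v\<close>
  at the zero \<open>(v, - u)\<close> of \<open>u * x + v * y\<close>. The two forms are therefore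
  coordinates, and a form of given degree is determined modulo the diagonal entry by its value at
  that one point. Determinants leave the sign of a square root open. In the first family the sign of
  \<open>t\<close> is immaterial; in the third the eigenvalue on the first summand fixes it, because
  the conjugating matrices turn out to be upper triangular. The inclusion of a sub-line bundle is
  not assumed to be nowhere zero: torsion-freeness has to produce this, by forbidding common factors
  with zeros.\<close>

lemma holomorphic2_onI:
  assumes "\<And>p. p \<in> U \<Longrightarrow> (f has_derivative (\<lambda>h. c1 p * fst h + c2 p * snd h)) (at p)"
  shows "f holomorphic2_on U"
  using assms unfolding holomorphic2_on_def case_prod_unfold by blast

lemma holomorphic2_onE:
  assumes "f holomorphic2_on U"
  obtains c1 c2 where
    "\<forall>p\<in>U. (f has_derivative (\<lambda>h. c1 p * fst h + c2 p * snd h)) (at p)"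
  using assms unfolding holomorphic2_on_def case_prod_unfold bchoice_iff by blast

lemma holomorphic3_onI:
  assumes "\<And>p. p \<in> U \<Longrightarrow>
    (f has_derivative (\<lambda>h. c1 p * fst (fst h) + c2 p * snd (fst h) + c3 p * snd h)) (at p)"
  shows "f holomorphic3_on U"
  using assms unfolding holomorphic3_on_def case_prod_unfold by blast

lemma holomorphic3_onE:
  assumes "f holomorphic3_on U"
  obtains c1 c2 c3 where "\<forall>p\<in>U.
    (f has_derivative (\<lambda>h. c1 p * fst (fst h) + c2 p * snd (fst h) + c3 p * snd h)) (at p)"
  using assms unfolding holomorphic3_on_def case_prod_unfold bchoice_iff by blast

lemma holomorphic2_on_const [simp]: "(\<lambda>p. c) holomorphic2_on U"
  by (rule holomorphic2_onI[where ?c1.0 = "\<lambda>_. 0" and ?c2.0 = "\<lambda>_. 0"]) simp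

lemma holomorphic2_on_fst [simp]: "fst holomorphic2_on U"
  by (rule holomorphic2_onI[where ?c1.0 = "\<lambda>_. 1" and ?c2.0 = "\<lambda>_. 0"]) (auto intro!: derivative_eq_intros)

lemma holomorphic2_on_snd [simp]: "snd holomorphic2_on U"
  by (rule holomorphic2_onI[where ?c1.0 = "\<lambda>_. 0" and ?c2.0 = "\<lambda>_. 1"]) (auto intro!: derivative_eq_intros)

lemma holomorphic2_on_add:
  assumes "f holomorphic2_on U" "g holomorphic2_on U"
  shows "(\<lambda>p. f p + g p) holomorphic2_on U"
proof -
  obtain a1 a2 where
    [rule_format, derivative_intros]: "\<forall>p\<in>U. (f has_derivative (\<lambda>h. a1 p * fst h + a2 p * snd h)) (at p)"
    using holomorphic2_onE[OF assms(1)] by blast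
  obtain b1 b2 where
    [rule_format, derivative_intros]: "\<forall>p\<in>U. (g has_derivative (\<lambda>h. b1 p * fst h + b2 p * snd h)) (at p)"
    using holomorphic2_onE[OF assms(2)] by blast
  show ?thesis
    by (rule holomorphic2_onI[where ?c1.0 = "\<lambda>p. a1 p + b1 p" and ?c2.0 = "\<lambda>p. a2 p + b2 p"])
       (auto intro!: derivative_eq_intros simp: algebra_simps)
qed

lemma holomorphic2_on_mult:
  assumes "f holomorphic2_on U" "g holomorphic2_on U"
  shows "(\<lambda>p. f p * g p) holomorphic2_on U"
proof -
  obtain a1 a2 where
    [rule_format, derivative_intros]: "\<forall>p\<in>U. (f has_derivative (\<lambda>h. a1 p * fst h + a2 p * snd h)) (at p)"
    using holomorphic2_onE[OF assms(1)] by blast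
  obtain b1 b2 where
    [rule_format, derivative_intros]: "\<forall>p\<in>U. (g has_derivative (\<lambda>h. b1 p * fst h + b2 p * snd h)) (at p)"
    using holomorphic2_onE[OF assms(2)] by blast
  show ?thesis
    by (rule holomorphic2_onI[where ?c1.0 = "\<lambda>p. a1 p * g p + f p * b1 p" and
                                    ?c2.0 = "\<lambda>p. a2 p * g p + f p * b2 p"])
       (auto intro!: derivative_eq_intros simp: algebra_simps)
qed

lemma holomorphic2_on_cmult: "f holomorphic2_on U \<Longrightarrow> (\<lambda>p. c * f p) holomorphic2_on U"
  by (intro holomorphic2_on_mult) simp_all

lemma holomorphic2_on_minus: "f holomorphic2_on U \<Longrightarrow> (\<lambda>p. - f p) holomorphic2_on U"
  using holomorphic2_on_cmult[of f U "-1"] by simp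

lemma holomorphic2_on_diff:
  "f holomorphic2_on U \<Longrightarrow> g holomorphic2_on U \<Longrightarrow> (\<lambda>p. f p - g p) holomorphic2_on U"
  using holomorphic2_on_add[OF _ holomorphic2_on_minus, of f U g] by simp

lemma holomorphic2_on_power: "f holomorphic2_on U \<Longrightarrow> (\<lambda>p. f p ^ n) holomorphic2_on U"
  by (induction n) (auto intro: holomorphic2_on_mult)

lemma holomorphic2_on_sum:
  "(\<And>i. i \<in> I \<Longrightarrow> f i holomorphic2_on U) \<Longrightarrow> (\<lambda>p. \<Sum>i\<in>I. f i p) holomorphic2_on U"
  by (induction I rule: infinite_finite_induct) (auto intro: holomorphic2_on_add)

lemma holomorphic2_on_inverse:
  assumes "f holomorphic2_on U" "\<And>p. p \<in> U \<Longrightarrow> f p \<noteq> 0"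
  shows "(\<lambda>p. inverse (f p)) holomorphic2_on U"
proof -
  obtain a1 a2 where
    [rule_format, derivative_intros]: "\<forall>p\<in>U. (f has_derivative (\<lambda>h. a1 p * fst h + a2 p * snd h)) (at p)"
    using holomorphic2_onE[OF assms(1)] by blast
  show ?thesis
    using assms(2)
    by (intro holomorphic2_onI[where ?c1.0 = "\<lambda>p. - (inverse (f p) * a1 p * inverse (f p))" and
                                    ?c2.0 = "\<lambda>p. - (inverse (f p) * a2 p * inverse (f p))"])
       (auto intro!: derivative_eq_intros simp: algebra_simps)
qed

lemma holomorphic2_on_divide:
  "f holomorphic2_on U \<Longrightarrow> g holomorphic2_on U \<Longrightarrow> (\<And>p. p \<in> U \<Longrightarrow> g p \<noteq> 0) \<Longrightarrow>
   (\<lambda>p. f p / g p) holomorphic2_on U"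
  unfolding divide_inverse by (intro holomorphic2_on_mult holomorphic2_on_inverse)

lemmas holomorphic2_intros =
  holomorphic2_on_const holomorphic2_on_fst holomorphic2_on_snd holomorphic2_on_add
  holomorphic2_on_mult holomorphic2_on_minus holomorphic2_on_diff holomorphic2_on_power
  holomorphic2_on_sum

lemma holomorphic2_on_subset: "f holomorphic2_on U \<Longrightarrow> V \<subseteq> U \<Longrightarrow> f holomorphic2_on V"
  unfolding holomorphic2_on_def by blast

lemma holomorphic2_on_cong:
  assumes "open U" "\<And>p. p \<in> U \<Longrightarrow> f p = g p" "f holomorphic2_on U"
  shows "g holomorphic2_on U"
  using assms unfolding holomorphic2_on_def by (metis has_derivative_transform_within_open)

lemma holomorphic2_on_imp_continuous_on:
  assumes "f holomorphic2_on U"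
  shows "continuous_on U f"
proof -
  obtain a1 a2 where "\<forall>p\<in>U. (f has_derivative (\<lambda>h. a1 p * fst h + a2 p * snd h)) (at p)"
    using holomorphic2_onE[OF assms(1)] by blast
  then show ?thesis
    by (intro continuous_at_imp_continuous_on ballI) (auto intro: has_derivative_continuous)
qed

lemma holomorphic2_on_compose:
  assumes f: "f holomorphic2_on V" and A: "A holomorphic2_on U" and B: "B holomorphic2_on U"
    and V: "\<And>p. p \<in> U \<Longrightarrow> (A p, B p) \<in> V"
  shows "(\<lambda>p. f (A p, B p)) holomorphic2_on U"
proof -
  obtain a1 a2 where A'[rule_format]: "\<forall>p\<in>U. (A has_derivative (\<lambda>h. a1 p * fst h + a2 p * snd h)) (at p)"
    using holomorphic2_onE[OF A] by blast
  obtain b1 b2 where B'[rule_format]: "\<forall>p\<in>U. (B has_derivative (\<lambda>h. b1 p * fst h + b2 p * snd h)) (at p)"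
    using holomorphic2_onE[OF B] by blast
  obtain c1 c2 where f'[rule_format]: "\<forall>p\<in>V. (f has_derivative (\<lambda>h. c1 p * fst h + c2 p * snd h)) (at p)"
    using holomorphic2_onE[OF f] by blast
  show ?thesis
  proof (rule holomorphic2_onI[where ?c1.0 = "\<lambda>p. c1 (A p, B p) * a1 p + c2 (A p, B p) * b1 p" and
                                    ?c2.0 = "\<lambda>p. c1 (A p, B p) * a2 p + c2 (A p, B p) * b2 p"])
    fix p assume p: "p \<in> U"
    show "((\<lambda>p. f (A p, B p)) has_derivative
      (\<lambda>h. (c1 (A p, B p) * a1 p + c2 (A p, B p) * b1 p) * fst h +
           (c1 (A p, B p) * a2 p + c2 (A p, B p) * b2 p) * snd h)) (at p)"
      using has_derivative_compose[OF has_derivative_Pair[OF A'[OF p] B'[OF p]] f'[OF V[OF p]]]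
      by (simp add: algebra_simps)
  qed
qed

lemma holomorphic3_on_compose:
  assumes f: "f holomorphic3_on V" and A: "A holomorphic2_on U" and B: "B holomorphic2_on U"
    and C: "C holomorphic2_on U" and V: "\<And>p. p \<in> U \<Longrightarrow> ((A p, B p), C p) \<in> V"
  shows "(\<lambda>p. f ((A p, B p), C p)) holomorphic2_on U"
proof -
  obtain a1 a2 where A'[rule_format]: "\<forall>p\<in>U. (A has_derivative (\<lambda>h. a1 p * fst h + a2 p * snd h)) (at p)"
    using holomorphic2_onE[OF A] by blast
  obtain b1 b2 where B'[rule_format]: "\<forall>p\<in>U. (B has_derivative (\<lambda>h. b1 p * fst h + b2 p * snd h)) (at p)"
    using holomorphic2_onE[OF B] by blast
  obtain c1 c2 where C'[rule_format]: "\<forall>p\<in>U. (C has_derivative (\<lambda>h. c1 p * fst h + c2 p * snd h)) (at p)"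
    using holomorphic2_onE[OF C] by blast
  obtain d1 d2 d3 where f'[rule_format]: "\<forall>p\<in>V.
      (f has_derivative (\<lambda>h. d1 p * fst (fst h) + d2 p * snd (fst h) + d3 p * snd h)) (at p)"
    using holomorphic3_onE[OF f] by blast
  let ?q = "\<lambda>p. ((A p, B p), C p)"
  show ?thesis
  proof (rule holomorphic2_onI[where
        ?c1.0 = "\<lambda>p. d1 (?q p) * a1 p + d2 (?q p) * b1 p + d3 (?q p) * c1 p" and
        ?c2.0 = "\<lambda>p. d1 (?q p) * a2 p + d2 (?q p) * b2 p + d3 (?q p) * c2 p"])
    fix p assume p: "p \<in> U"
    show "((\<lambda>p. f (?q p)) has_derivative
      (\<lambda>h. (d1 (?q p) * a1 p + d2 (?q p) * b1 p + d3 (?q p) * c1 p) * fst h +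
           (d1 (?q p) * a2 p + d2 (?q p) * b2 p + d3 (?q p) * c2 p) * snd h)) (at p)"
      using has_derivative_compose[OF
          has_derivative_Pair[OF has_derivative_Pair[OF A'[OF p] B'[OF p]] C'[OF p]] f'[OF V[OF p]]]
      by (simp add: algebra_simps)
  qed
qed

text \<open>Restriction to a holomorphic curve is the bridge to one-variable theory: Liouville's
  theorem and analytic continuation are applied to such restrictions.\<close>

lemma holomorphic2_on_compose_holomorphic_on:
  assumes f: "f holomorphic2_on V" and A: "A holomorphic_on S" and B: "B holomorphic_on S"
    and S: "open S" and V: "\<And>z. z \<in> S \<Longrightarrow> (A z, B z) \<in> V"
  shows "(\<lambda>z. f (A z, B z)) holomorphic_on S"
proof -
  obtain c1 c2 where
    f'[rule_format]: "\<forall>p\<in>V. (f has_derivative (\<lambda>h. c1 p * fst h + c2 p * snd h)) (at p)"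
    using holomorphic2_onE[OF f] by blast
  have "((\<lambda>z. f (A z, B z)) has_field_derivative
      c1 (A z, B z) * deriv A z + c2 (A z, B z) * deriv B z) (at z)" if z: "z \<in> S" for z
  proof -
    have "(A has_derivative (*) (deriv A z)) (at z)" "(B has_derivative (*) (deriv B z)) (at z)"
      using holomorphic_derivI[OF A S z] holomorphic_derivI[OF B S z]
      by (simp_all add: has_field_derivative_def)
    from has_derivative_compose[OF has_derivative_Pair[OF this] f'[OF V[OF z]]] show ?thesis
      unfolding has_field_derivative_def
      by (rule has_derivative_eq_rhs) (auto simp: algebra_simps)
  qed
  then show ?thesis
    using S holomorphic_on_open by blast
qed

section \<open>Identity theorem in two variables\<close>

lemma holomorphic2_on_zero_convex:
  assumes U: "open U" "convex U" and f: "f holomorphic2_on U"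
    and W: "open W" "W \<subseteq> U" "W \<noteq> {}" "\<And>p. p \<in> W \<Longrightarrow> f p = 0"
    and q: "q \<in> U"
  shows "f q = 0"
proof -
  obtain w where w: "w \<in> W" using W by blast
  \<comment> \<open>\<open>L\<close> parametrizes the complex line through \<open>w\<close> and
    \<open>q\<close>. Convexity of \<open>U\<close> makes the preimage \<open>S\<close> of
    \<open>U\<close> convex, hence connected, so the zeros near \<open>0\<close> propagate along
    \<open>S\<close> to \<open>1\<close>.\<close>
  define L where "L = (\<lambda>z::complex. (fst w + z * (fst q - fst w), snd w + z * (snd q - snd w)))"
  have L: "continuous_on UNIV L" unfolding L_def by (intro continuous_intros)
  have L0: "L 0 = w" and L1: "L 1 = q" by (simp_all add: L_def)
  define S where "S = L -` U"
  have "open S" unfolding S_def using L U(1) by (simp add: open_vimage)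
  have "convex S"
  proof (rule convexI)
    fix z z' :: complex and u v :: real
    assume *: "z \<in> S" "z' \<in> S" "0 \<le> u" "0 \<le> v" "u + v = 1"
    have "L (u *\<^sub>R z + v *\<^sub>R z') = u *\<^sub>R L z + v *\<^sub>R L z'"
    proof -
      have v: "v = 1 - u" using *(5) by simp
      show ?thesis
        unfolding v by (simp add: L_def scaleR_conv_of_real algebra_simps)
    qed
    then show "u *\<^sub>R z + v *\<^sub>R z' \<in> S"
      using * convexD[OF U(2)] unfolding S_def by simp
  qed
  have "(\<lambda>z. f (fst (L z), snd (L z))) holomorphic_on S"
    by (rule holomorphic2_on_compose_holomorphic_on[OF f]; (intro \<open>open S\<close>)?)
       (auto simp: L_def S_def intro!: holomorphic_intros)
  moreover have "open (L -` W)" "L -` W \<subseteq> S" "0 \<in> L -` W"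
    using L W w L0 by (auto simp: open_vimage S_def)
  ultimately have "f (fst (L 1), snd (L 1)) = 0"
    using analytic_continuation_open[of "L -` W" S "\<lambda>z. f (fst (L z), snd (L z))" "\<lambda>_. 0" 1]
      \<open>open S\<close> convex_connected[OF \<open>convex S\<close>] W(4) q L1 by (auto simp: S_def)
  then show ?thesis by (simp add: L1)
qed

text \<open>
  The set of zeros may be any set that is locally cut out by holomorphic functions, so that the
  principle applies to analytic subsets as well.
\<close>

lemma locally_analytic_eq_domain:
  assumes M: "open M" "connected M"
    and N: "\<And>p. p \<in> M \<Longrightarrow> \<exists>r G. 0 < r \<and> ball p r \<subseteq> M \<and> (\<forall>g\<in>G. g holomorphic2_on ball p r) \<and>
               N \<inter> ball p r = {z \<in> ball p r. \<forall>g\<in>G. g z = 0}"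
    and W: "open W" "W \<noteq> {}" "W \<subseteq> N \<inter> M"
  shows "M \<subseteq> N"
proof -
  define I where "I = interior (N \<inter> M)"
  have I: "open I" "I \<subseteq> N \<inter> M"
    unfolding I_def by (rule open_interior, rule interior_subset)
  have "closedin (top_of_set M) I"
  proof (rule closedin_limpt[THEN iffD2], safe)
    show "x \<in> M" if "x \<in> I" for x
      using that I(2) by blast
    fix p assume p: "p islimpt I" "p \<in> M"
    from N[OF p(2)] obtain r G where r: "0 < r" "ball p r \<subseteq> M" "\<forall>g\<in>G. g holomorphic2_on ball p r"
       and eq: "N \<inter> ball p r = {z \<in> ball p r. \<forall>g\<in>G. g z = 0}"
      by blast
    \<comment> \<open>Near a limit point of \<open>I\<close> the local equations of \<open>N\<close>
      vanish on the nonempty open set \<open>W'\<close>. A ball is convex, so they vanish on the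
      whole ball, which therefore lies in \<open>I\<close>.\<close>
    define W' where "W' = I \<inter> ball p r"
    have W': "open W'" "W' \<subseteq> ball p r" unfolding W'_def using I(1) by auto
    have "W' \<noteq> {}"
      using islimptE[of p I "ball p r"] p(1) r(1) unfolding W'_def
      by (metis IntI centre_in_ball empty_iff open_ball)
    have "g z = 0" if "g \<in> G" "z \<in> ball p r" for g z
    proof (rule holomorphic2_on_zero_convex[OF open_ball convex_ball r(3)[rule_format, OF that(1)] W' \<open>W' \<noteq> {}\<close>])
      show "g w = 0" if "w \<in> W'" for w
        using that eq \<open>g \<in> G\<close> I(2) unfolding W'_def by blast
    qed (rule that(2))
    then have "ball p r \<subseteq> N \<inter> M" using eq r(2) by blast
    then have "ball p r \<subseteq> I" unfolding I_def by (intro interior_maximal open_ball)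
    then show "p \<in> I" using r(1) by auto
  qed
  moreover have "openin (top_of_set M) I"
    using I by (intro open_subset) auto
  moreover have "I \<noteq> {}"
    using W interior_maximal[of W "N \<inter> M"] unfolding I_def by blast
  ultimately have "I = M" using M(2)[unfolded connected_clopen] by blast
  then show ?thesis using I(2) by blast
qed

lemma holomorphic2_on_zero:
  assumes U: "open U" "connected U" and f: "f holomorphic2_on U"
    and W: "open W" "W \<subseteq> U" "W \<noteq> {}" "\<And>p. p \<in> W \<Longrightarrow> f p = 0"
    and q: "q \<in> U"
  shows "f q = 0"
proof -
  have "U \<subseteq> {p. f p = 0}"
  proof (rule locally_analytic_eq_domain[OF U])
    fix p assume "p \<in> U"
    then obtain r where r: "0 < r" "ball p r \<subseteq> U" using U(1) openE by blast
    then show "\<exists>r G. 0 < r \<and> ball p r \<subseteq> U \<and> (\<forall>g\<in>G. g holomorphic2_on ball p r) \<and>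
        {p. f p = 0} \<inter> ball p r = {z \<in> ball p r. \<forall>g\<in>G. g z = 0}"
      using holomorphic2_on_subset[OF f]
      by (intro exI[of _ r] exI[of _ "{f}"]) auto
  qed (use W in auto)
  then show ?thesis using q by blast
qed

lemma holomorphic2_on_nonzero_open:
  assumes "open U" "f holomorphic2_on U"
  shows "open {p \<in> U. f p \<noteq> 0}"
proof -
  have "{p \<in> U. f p \<noteq> 0} = U \<inter> f -` (- {0})" by auto
  then show ?thesis
    using continuous_open_preimage[OF holomorphic2_on_imp_continuous_on[OF assms(2)] assms(1), of "- {0}"]
    by auto
qed

text \<open>This is the integrality of the ring of holomorphic functions on a domain:
  \<open>g\<close> vanishes on the open set where \<open>f\<close> does not. It replaces pointwise
  division where a factor with zeros has to be cancelled.\<close>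

lemma holomorphic2_on_mult_eq_0:
  assumes "open U" "connected U" and f: "f holomorphic2_on U" and g: "g holomorphic2_on U"
    and fg: "\<And>p. p \<in> U \<Longrightarrow> f p * g p = 0" and p: "p \<in> U" "f p \<noteq> 0" and q: "q \<in> U"
  shows "g q = 0"
proof (rule holomorphic2_on_zero[OF assms(1,2) g holomorphic2_on_nonzero_open[OF assms(1) f] _ _ _ q])
  show "{p \<in> U. f p \<noteq> 0} \<noteq> {}" using p by blast
  show "g r = 0" if "r \<in> {p \<in> U. f p \<noteq> 0}" for r using fg[of r] that by simp
qed auto

lemma punctured_plane_eq: "punctured_plane = - {0}"
  by (auto simp: punctured_plane_def zero_prod_def)

lemma punctured_plane_iff: "p \<in> punctured_plane \<longleftrightarrow> fst p \<noteq> 0 \<or> snd p \<noteq> 0"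
  by (cases p) (auto simp: punctured_plane_def)

lemma open_punctured_plane: "open punctured_plane"
  by (simp add: punctured_plane_eq open_Compl)

lemma connected_punctured_plane: "connected punctured_plane"
  unfolding punctured_plane_eq by (rule connected_punctured_universe) simp

subsection \<open>Sections of line bundles\<close>

lemma sectionsI:
  assumes "s holomorphic2_on punctured_plane"
    and "\<And>p. p \<in> punctured_plane \<Longrightarrow> s (b * fst p, b * snd p) = \<tau> * s p"
  shows "s \<in> sections b \<tau>"
  using assms by (auto simp: sections_def hopf_map_def case_prod_unfold)

lemma sections_holomorphic2: "s \<in> sections b \<tau> \<Longrightarrow> s holomorphic2_on punctured_plane"
  by (simp add: sections_def)

lemma sections_scale:
  "s \<in> sections b \<tau> \<Longrightarrow> p \<in> punctured_plane \<Longrightarrow> s (b * fst p, b * snd p) = \<tau> * s p"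
  by (auto simp: sections_def hopf_map_def case_prod_unfold)

lemma sections_mult:
  "s \<in> sections b \<tau> \<Longrightarrow> s' \<in> sections b \<tau>' \<Longrightarrow> (\<lambda>p. s p * s' p) \<in> sections b (\<tau> * \<tau>')"
  by (intro sectionsI holomorphic2_on_mult) (auto simp: sections_holomorphic2 sections_scale)

lemma sections_const: "(\<lambda>p. c) \<in> sections b 1"
  by (intro sectionsI) simp_all

lemma sections_zero: "(\<lambda>p. 0) \<in> sections b \<tau>"
  by (intro sectionsI) simp_all

lemma sections_cmult: "s \<in> sections b \<tau> \<Longrightarrow> (\<lambda>p. c * s p) \<in> sections b \<tau>"
  using sections_mult[OF sections_const] by simp

lemma sections_minus: "s \<in> sections b \<tau> \<Longrightarrow> (\<lambda>p. - s p) \<in> sections b \<tau>"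
  using sections_cmult[of s b \<tau> "-1"] by simp

lemma sections_add:
  "s \<in> sections b \<tau> \<Longrightarrow> s' \<in> sections b \<tau> \<Longrightarrow> (\<lambda>p. s p + s' p) \<in> sections b \<tau>"
  by (intro sectionsI holomorphic2_on_add) (auto simp: sections_holomorphic2 sections_scale algebra_simps)

lemma sections_diff:
  "s \<in> sections b \<tau> \<Longrightarrow> s' \<in> sections b \<tau> \<Longrightarrow> (\<lambda>p. s p - s' p) \<in> sections b \<tau>"
  using sections_add[OF _ sections_minus, of s b \<tau> s'] by simp

lemma sections_power: "s \<in> sections b \<tau> \<Longrightarrow> (\<lambda>p. s p ^ n) \<in> sections b (\<tau> ^ n)"
  by (induction n) (auto intro: sections_mult sections_const)

lemma sections_linear: "(\<lambda>p. u * fst p + v * snd p) \<in> sections b b"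
  by (intro sectionsI holomorphic2_intros) (auto simp: algebra_simps)

lemma sections_cong:
  assumes "s \<in> sections b \<tau>" "b \<noteq> 0" "\<And>p. p \<in> punctured_plane \<Longrightarrow> s' p = s p"
  shows "s' \<in> sections b \<tau>"
proof (rule sectionsI)
  show "s' holomorphic2_on punctured_plane"
    using holomorphic2_on_cong[OF open_punctured_plane _ sections_holomorphic2[OF assms(1)]] assms(3)
    by simp
  fix p assume p: "p \<in> punctured_plane"
  then have "(b * fst p, b * snd p) \<in> punctured_plane"
    using \<open>b \<noteq> 0\<close> by (auto simp: punctured_plane_iff)
  then show "s' (b * fst p, b * snd p) = \<tau> * s' p"
    using sections_scale[OF assms(1) p] p assms(3) by simp
qed

lemma sections_inverse:
  assumes "s \<in> sections b \<tau>" "\<And>p. p \<in> punctured_plane \<Longrightarrow> s p \<noteq> 0"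
  shows "(\<lambda>p. inverse (s p)) \<in> sections b (inverse \<tau>)"
  using assms by (intro sectionsI holomorphic2_on_inverse) (auto simp: sections_holomorphic2 sections_scale)

lemma linear_substitution_punctured:
  assumes "\<alpha> * \<delta> - \<beta> * \<gamma> \<noteq> 0" "p \<in> punctured_plane"
  shows "(\<alpha> * fst p + \<beta> * snd p, \<gamma> * fst p + \<delta> * snd p) \<in> punctured_plane"
proof (rule ccontr)
  assume "\<not> ?thesis"
  then have 0: "\<alpha> * fst p + \<beta> * snd p = 0" "\<gamma> * fst p + \<delta> * snd p = 0"
    by (auto simp: punctured_plane_iff)
  have "(\<alpha> * \<delta> - \<beta> * \<gamma>) * fst p = \<delta> * (\<alpha> * fst p + \<beta> * snd p) - \<beta> * (\<gamma> * fst p + \<delta> * snd p)"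
    "(\<alpha> * \<delta> - \<beta> * \<gamma>) * snd p = \<alpha> * (\<gamma> * fst p + \<delta> * snd p) - \<gamma> * (\<alpha> * fst p + \<beta> * snd p)"
    by (simp_all add: algebra_simps)
  then show False
    using assms unfolding 0 by (auto simp: punctured_plane_iff)
qed

text \<open>Linear substitutions commute with multiplication by \<open>b\<close>, so multipliers are
  preserved. This allows the coordinates to be swapped and the zero of a given linear form to be
  moved to a coordinate axis.\<close>

lemma sections_linear_substitution:
  assumes "s \<in> sections b \<tau>" "\<alpha> * \<delta> - \<beta> * \<gamma> \<noteq> 0"
  shows "(\<lambda>p. s (\<alpha> * fst p + \<beta> * snd p, \<gamma> * fst p + \<delta> * snd p)) \<in> sections b \<tau>"
proof (rule sectionsI)
  show "(\<lambda>p. s (\<alpha> * fst p + \<beta> * snd p, \<gamma> * fst p + \<delta> * snd p)) holomorphic2_on punctured_plane"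
    by (rule holomorphic2_on_compose[OF sections_holomorphic2[OF assms(1)]])
       (auto intro!: holomorphic2_intros linear_substitution_punctured[OF assms(2)])
  fix p assume "p \<in> punctured_plane"
  from sections_scale[OF assms(1) linear_substitution_punctured[OF assms(2) this]]
  show "s (\<alpha> * fst (b * fst p, b * snd p) + \<beta> * snd (b * fst p, b * snd p),
           \<gamma> * fst (b * fst p, b * snd p) + \<delta> * snd (b * fst p, b * snd p)) =
         \<tau> * s (\<alpha> * fst p + \<beta> * snd p, \<gamma> * fst p + \<delta> * snd p)"
    by (simp add: algebra_simps)
qed

section \<open>From polynomials on lines to homogeneous forms\<close>

lemma poly_eq_off_0:
  fixes p q :: "'a::{idom,ring_char_0} poly"
  assumes "\<And>x. x \<noteq> 0 \<Longrightarrow> poly p x = poly q x"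
  shows "p = q"
proof -
  have "poly ([:0, 1:] * p) = poly ([:0, 1:] * q)"
    using assms by fastforce
  then show ?thesis
    by (simp only: poly_eq_poly_eq_iff mult_cancel_left) simp
qed

text \<open>
  The finite difference \<open>F (2 x) y - 2 ^ n * F x y\<close> removes the leading term, so the coefficients are
  polynomial by induction on the degree.
\<close>

lemma coefficients_polynomial:
  fixes F :: "complex \<Rightarrow> 'a \<Rightarrow> complex" and c :: "'a \<Rightarrow> complex"
  assumes "\<And>x y. y \<in> Y \<Longrightarrow> F x y = (\<Sum>i\<le>n. a i y * x ^ i)"
    and "\<And>x. x \<noteq> 0 \<Longrightarrow> \<exists>p. \<forall>y\<in>Y. F x y = poly p (c y)"
    and "i \<le> n"
  shows "\<exists>p. \<forall>y\<in>Y. a i y = poly p (c y)"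
  using assms
proof (induction n arbitrary: F a i)
  case 0
  then show ?case
    using "0.prems"(1)[of _ 1] "0.prems"(2)[of 1] by auto
next
  case (Suc n)
  let ?a = "\<lambda>i y. (2 ^ i - 2 ^ Suc n) * a i y"
  let ?F = "\<lambda>x y. F (2 * x) y - 2 ^ Suc n * F x y"
  have F: "?F x y = (\<Sum>i\<le>n. ?a i y * x ^ i)" if "y \<in> Y" for x y
    using that by (simp add: Suc.prems(1) power_mult_distrib sum_distrib_left sum_subtractf algebra_simps)
  have "\<exists>p. \<forall>y\<in>Y. ?F x y = poly p (c y)" if x: "x \<noteq> 0" for x
  proof -
    obtain p q where "\<forall>y\<in>Y. F (2 * x) y = poly p (c y)" "\<forall>y\<in>Y. F x y = poly q (c y)"
      using Suc.prems(2)[OF x] Suc.prems(2)[of "2 * x"] x by (metis mult_eq_0_iff zero_neq_numeral)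
    then show ?thesis
      by (intro exI[of _ "p - smult (2 ^ Suc n) q"]) simp
  qed
  from Suc.IH[OF F this] have "\<forall>j\<le>n. \<exists>p. \<forall>y\<in>Y. ?a j y = poly p (c y)"
    by blast
  then obtain P where P: "\<And>j y. j \<le> n \<Longrightarrow> y \<in> Y \<Longrightarrow> ?a j y = poly (P j) (c y)"
    by metis
  define Q where "Q = (\<lambda>j. smult (1 / (2 ^ j - 2 ^ Suc n)) (P j))"
  have Q: "a j y = poly (Q j) (c y)" if "j \<le> n" "y \<in> Y" for j y
  proof -
    \<comment> \<open>The differencing multiplies \<open>a j\<close> by
      \<open>2 ^ j - 2 ^ Suc n\<close>, which has to be inverted; that it is nonzero is seen over
      the reals, where powers of 2 increase strictly.\<close>
    have "(2::real) ^ j < 2 ^ Suc n" using that by (intro power_strict_increasing) auto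
    then have "complex_of_real (2 ^ j - 2 ^ Suc n) \<noteq> 0" by (subst of_real_eq_0_iff) linarith
    then have "(2::complex) ^ j - 2 ^ Suc n \<noteq> 0" by simp
    then show ?thesis
      using P[OF that] by (simp add: Q_def field_simps)
  qed
  show ?case
  proof (cases "i \<le> n")
    case True
    then show ?thesis using Q by blast
  next
    case False
    then have i: "i = Suc n" using Suc.prems(3) by simp
    obtain q where q: "\<forall>y\<in>Y. F 1 y = poly q (c y)"
      using Suc.prems(2)[of 1] by auto
    \<comment> \<open>The top coefficient, which the difference has lost, is the value at
      \<open>x = 1\<close> minus the lower coefficients.\<close>
    have "a i y = poly (q - (\<Sum>j\<le>n. Q j)) (c y)" if "y \<in> Y" for y
      using Suc.prems(1)[OF that, of 1] q that Q by (simp add: i poly_sum algebra_simps)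
    then show ?thesis by blast
  qed
qed

text \<open>As a sum of squared moduli the number is positive. It is the value of
  \<open>cnj v * x - cnj u * y\<close> at the zero \<open>(v, - u)\<close> of
  \<open>u * x + v * y\<close>, and up to sign the determinant of these two forms.\<close>

lemma norm_form_nonzero:
  fixes u v :: complex
  assumes "(u, v) \<noteq> (0, 0)"
  shows "u * cnj u + v * cnj v \<noteq> 0"
proof -
  have "u * cnj u + v * cnj v = complex_of_real ((cmod u)\<^sup>2 + (cmod v)\<^sup>2)"
    by (simp only: of_real_add complex_norm_square)
  moreover have "(cmod u)\<^sup>2 + (cmod v)\<^sup>2 \<noteq> 0"
    using assms by (auto simp: add_nonneg_eq_0_iff)
  ultimately show ?thesis by (simp only: of_real_eq_0_iff not_False_eq_True)
qed

locale hopf =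
  fixes b :: complex
  assumes b: "0 < cmod b" "cmod b < 1"
begin

lemma b_nonzero: "b \<noteq> 0"
  using b by auto

lemma b_power_inject: "b ^ i = b ^ j \<longleftrightarrow> i = j"
proof
  assume "b ^ i = b ^ j"
  then have "cmod b ^ i = cmod b ^ j" by (metis norm_power)
  then show "i = j"
    using b power_strict_decreasing[of i j "cmod b"] power_strict_decreasing[of j i "cmod b"]
    by (cases i j rule: linorder_cases) auto
qed simp

lemma sections_scale_power:
  assumes "s \<in> sections b \<tau>" "p \<in> punctured_plane"
  shows "s (b ^ n * fst p, b ^ n * snd p) = \<tau> ^ n * s p"
proof (induction n)
  case (Suc n)
  have "(b ^ n * fst p, b ^ n * snd p) \<in> punctured_plane"
    using assms(2) b_nonzero by (auto simp: punctured_plane_iff)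
  from sections_scale[OF assms(1) this] show ?case
    by (simp only: Suc fst_conv snd_conv power_Suc mult.assoc)
qed simp

lemma sections_growth:
  assumes s: "s \<in> sections b \<tau>" and "\<tau> \<noteq> 0"
  obtains C d where "0 \<le> C" "\<And>p. 1 \<le> norm p \<Longrightarrow> cmod (s p) \<le> C * norm p ^ d"
proof -
  define K where "K = cball (0::complex \<times> complex) 1 - ball 0 (cmod b)"
  have K_iff: "p \<in> K \<longleftrightarrow> norm p \<le> 1 \<and> cmod b \<le> norm p" for p
    by (auto simp: K_def)
  have "K \<subseteq> punctured_plane" using b by (auto simp: K_iff punctured_plane_eq)
  then have "continuous_on K s"
    using sections_holomorphic2[OF s] holomorphic2_on_imp_continuous_on holomorphic2_on_subset by blast
  moreover have "compact K" unfolding K_def by (intro compact_diff) auto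
  ultimately have "bounded (s ` K)"
    using compact_continuous_image compact_imp_bounded by blast
  then obtain M where M: "0 < M" "\<And>p. p \<in> K \<Longrightarrow> cmod (s p) \<le> M"
    by (auto simp: bounded_pos)
  \<comment> \<open>\<open>d\<close> becomes the growth exponent: each application of the Hopf map
    multiplies \<open>s\<close> by \<open>\<tau>\<close>, and \<open>cmod \<tau>\<close> exceeds
    \<open>cmod b ^ d\<close>.\<close>
  obtain d where d: "cmod b ^ d < cmod \<tau>"
    using real_arch_pow_inv[of "cmod \<tau>" "cmod b"] assms(2) b by auto
  show ?thesis
  proof (rule that[where C = "M / cmod b ^ d" and d = d])
    fix p :: "complex \<times> complex" assume p: "1 \<le> norm p"
    then have pp: "p \<in> punctured_plane" by (auto simp: punctured_plane_eq)
    have p0: "0 < norm p" using p by linarith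
    have "\<exists>n. cmod b ^ n * norm p \<le> 1"
    proof -
      obtain n where "cmod b ^ n < 1 / norm p"
        using real_arch_pow_inv[of "1 / norm p" "cmod b"] p0 b by auto
      then have "cmod b ^ n * norm p \<le> 1" using p0 by (simp add: field_simps)
      then show ?thesis ..
    qed
    \<comment> \<open>The first such \<open>n\<close> moves \<open>p\<close> into the annulus
      \<open>K\<close>: minimality, or \<open>1 \<le> norm p\<close> when \<open>n = 0\<close>,
      keeps the norm of the image at least \<open>cmod b\<close>.\<close>
    define n where "n = (LEAST n. cmod b ^ n * norm p \<le> 1)"
    have n: "cmod b ^ n * norm p \<le> 1"
      unfolding n_def using \<open>\<exists>n. _\<close> by (rule LeastI_ex)
    have n': "cmod b \<le> cmod b ^ n * norm p"
    proof (cases n)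
      case 0
      then show ?thesis using p b by simp
    next
      case (Suc m)
      then have "\<not> cmod b ^ m * norm p \<le> 1"
        using not_less_Least[of m "\<lambda>n. cmod b ^ n * norm p \<le> 1"] unfolding n_def by simp
      then have "1 * cmod b \<le> (cmod b ^ m * norm p) * cmod b"
        by (intro mult_right_mono) auto
      then show ?thesis using Suc by (simp add: ac_simps)
    qed
    define q where "q = (b ^ n * fst p, b ^ n * snd p)"
    have "norm q = cmod b ^ n * norm p"
      by (cases p) (simp add: q_def norm_Pair norm_mult norm_power power_mult_distrib
          flip: distrib_left, simp add: real_sqrt_mult)
    then have "q \<in> K" using n n' by (simp add: K_iff)
    then have "cmod (\<tau> ^ n * s p) \<le> M"
      using M(2) sections_scale_power[OF s pp] by (metis q_def)
    then have "(cmod b ^ d) ^ n * cmod (s p) \<le> M"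
      using d b mult_right_mono[OF power_mono[of "cmod b ^ d" "cmod \<tau>" n], of "cmod (s p)"]
      by (simp add: norm_mult norm_power)
    then have "cmod (s p) \<le> M * (1 / cmod b ^ n) ^ d"
      using b by (simp add: field_simps flip: power_mult)
    also have "\<dots> \<le> M * (norm p / cmod b) ^ d"
      using n' b M(1) by (intro mult_left_mono power_mono) (auto simp: field_simps)
    finally show "cmod (s p) \<le> M / cmod b ^ d * norm p ^ d"
      by (simp add: power_divide)
  qed (use M(1) in auto)
qed

text \<open>A line with fixed \<open>y \<noteq> 0\<close> misses the origin, so the restriction is
  entire and Liouville applies. The growth exponent is the same for all \<open>y\<close>, which
  gives one degree bound for all the lines.\<close>

lemma sections_horizontal_polynomial:
  assumes s: "s \<in> sections b \<tau>" and "\<tau> \<noteq> 0"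
  shows "\<exists>d a. \<forall>x y. y \<noteq> 0 \<longrightarrow> s (x, y) = (\<Sum>i\<le>d. a i y * x ^ i)"
proof -
  obtain C d where C: "0 \<le> C" "\<And>p. 1 \<le> norm p \<Longrightarrow> cmod (s p) \<le> C * norm p ^ d"
    using sections_growth[OF assms] by blast
  have "s (x, y) = (\<Sum>i\<le>d. (deriv ^^ i) (\<lambda>x. s (x, y)) 0 / fact i * x ^ i)" if "y \<noteq> 0" for x y
  proof (rule Liouville_polynomial[where A = "max 1 (cmod y)" and B = "C * 2 ^ d"])
    show "(\<lambda>x. s (x, y)) holomorphic_on UNIV"
      by (rule holomorphic2_on_compose_holomorphic_on[OF sections_holomorphic2[OF s]])
         (auto intro!: holomorphic_intros simp: punctured_plane_iff that)
    fix x assume x: "max 1 (cmod y) \<le> cmod x"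
    have "norm (x, y) \<ge> cmod x" using norm_fst_le[of x y] by simp
    moreover have "norm (x, y) \<le> cmod x + cmod y" by (rule norm_Pair_le)
    ultimately have n: "1 \<le> norm (x, y)" "norm (x, y) \<le> 2 * cmod x" using x by auto
    have "cmod (s (x, y)) \<le> C * norm (x, y) ^ d" by (rule C(2)[OF n(1)])
    also have "\<dots> \<le> C * (2 * cmod x) ^ d" using n C(1) by (intro mult_left_mono power_mono) auto
    finally show "cmod (s (x, y)) \<le> C * 2 ^ d * cmod x ^ d" by (simp add: power_mult_distrib ac_simps)
  qed
  then show ?thesis
    by (intro exI[of _ d] exI[of _ "\<lambda>i y. (deriv ^^ i) (\<lambda>x. s (x, y)) 0 / fact i"]) blast
qed

text \<open>Along horizontal lines the coefficients in \<open>x\<close> are so far arbitrary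
  functions of \<open>y\<close>. Swapping the coordinates shows that \<open>s (x, y)\<close> is
  polynomial in \<open>y\<close> for each fixed \<open>x \<noteq> 0\<close>, and this makes the
  coefficients agree with polynomials for \<open>y \<noteq> 0\<close>.\<close>

lemma sections_polynomial:
  assumes s: "s \<in> sections b \<tau>" and "\<tau> \<noteq> 0"
  obtains d P where "\<And>p. p \<in> punctured_plane \<Longrightarrow> s p = (\<Sum>i\<le>d. poly (P i) (snd p) * fst p ^ i)"
proof -
  obtain d a where "\<forall>x y. y \<noteq> 0 \<longrightarrow> s (x, y) = (\<Sum>i\<le>d. a i y * x ^ i)"
    using sections_horizontal_polynomial[OF assms] by (elim exE)
  then have a: "s (x, y) = (\<Sum>i\<le>d. a i y * x ^ i)" if "y \<noteq> 0" for x y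
    using that by simp
  have "(\<lambda>p. s (snd p, fst p)) \<in> sections b \<tau>"
    using sections_linear_substitution[OF s, of 0 0 1 1] by simp
  from sections_horizontal_polynomial[OF this assms(2), unfolded fst_conv snd_conv] obtain d' a' where
    "\<forall>x y. y \<noteq> 0 \<longrightarrow> s (y, x) = (\<Sum>i\<le>d'. a' i y * x ^ i)"
    by (elim exE)
  then have a': "s (y, x) = (\<Sum>i\<le>d'. a' i y * x ^ i)" if "y \<noteq> 0" for x y
    using that by simp
  have vert: "\<exists>q. \<forall>y. s (x, y) = poly q y" if "x \<noteq> 0" for x
  proof (intro exI allI)
    show "s (x, y) = poly (\<Sum>i\<le>d'. monom (a' i x) i) y" for y
      using a'[OF that] by (simp add: poly_sum poly_monom)
  qed
  have "\<forall>i\<in>{..d}. \<exists>p. \<forall>y\<in>-{0}. a i y = poly p y"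
  proof
    fix i assume "i \<in> {..d}"
    show "\<exists>p. \<forall>y\<in>-{0}. a i y = poly p y"
    proof (rule coefficients_polynomial)
      show "s (x, y) = (\<Sum>i\<le>d. a i y * x ^ i)" if "y \<in> -{0}" for x y using that a by simp
      show "\<exists>p. \<forall>y\<in>-{0}. s (x, y) = poly p y" if "x \<noteq> 0" for x using vert[OF that] by blast
      show "i \<le> d" using \<open>i \<in> {..d}\<close> by simp
    qed
  qed
  then obtain P where "\<forall>i\<in>{..d}. \<forall>y\<in>-{0}. a i y = poly (P i) y"
    unfolding bchoice_iff by blast
  then have P: "\<And>i y. i \<le> d \<Longrightarrow> y \<noteq> 0 \<Longrightarrow> a i y = poly (P i) y"
    by simp
  have off: "s (x, y) = (\<Sum>i\<le>d. poly (P i) y * x ^ i)" if "y \<noteq> 0" for x y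
    unfolding a[OF that] using P that by (intro sum.cong) auto
  show ?thesis
  proof (rule that)
    fix p assume p: "p \<in> punctured_plane"
    show "s p = (\<Sum>i\<le>d. poly (P i) (snd p) * fst p ^ i)"
    proof (cases "snd p = 0")
      case False
      then show ?thesis using off[of "snd p" "fst p"] by simp
    next
      \<comment> \<open>The horizontal line through \<open>p\<close> meets the origin. On the
        vertical line both sides are polynomials in \<open>y\<close> that agree for
        \<open>y \<noteq> 0\<close>, so they agree at \<open>0\<close>.\<close>
      case True
      then have "fst p \<noteq> 0" using p by (simp add: punctured_plane_iff)
      then obtain q where q: "\<And>y. s (fst p, y) = poly q y" using vert by blast
      have "q = (\<Sum>i\<le>d. smult (fst p ^ i) (P i))"
      proof (rule poly_eq_off_0)
        show "poly q y = poly (\<Sum>i\<le>d. smult (fst p ^ i) (P i)) y" if "y \<noteq> 0" for y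
          using q[of y, symmetric] off[OF that, of "fst p"] by (simp add: poly_sum mult.commute)
      qed
      then show ?thesis using q[of "snd p"] by (simp add: poly_sum ac_simps)
    qed
  qed
qed

text \<open>The Hopf map multiplies the monomial of degree \<open>i\<close> in \<open>fst p\<close>
  and \<open>j\<close> in \<open>snd p\<close> by \<open>b ^ (i + j)\<close>, and monomials are
  independent; so each monomial that occurs determines \<open>\<tau>\<close>.\<close>

lemma sections_polynomial_coeff:
  assumes s: "s \<in> sections b \<tau>" and "\<tau> \<noteq> 0"
    and P: "\<And>p. p \<in> punctured_plane \<Longrightarrow> s p = (\<Sum>i\<le>d. poly (P i) (snd p) * fst p ^ i)"
    and i: "i \<le> d" and "coeff (P i) j \<noteq> 0"
  shows "\<tau> = b ^ (i + j)"
proof -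
  have "poly (smult (b ^ i) (pcompose (P i) [:0, b:])) y = poly (smult \<tau> (P i)) y" if "y \<noteq> 0" for y
  proof -
    have "(\<Sum>i\<le>d. (poly (P i) (b * y) * b ^ i) * x ^ i) = (\<Sum>i\<le>d. (\<tau> * poly (P i) y) * x ^ i)" for x
    proof -
      have "(\<Sum>i\<le>d. (poly (P i) (b * y) * b ^ i) * x ^ i) = s (b * x, b * y)"
        using that b_nonzero by (subst P) (auto simp: punctured_plane_iff power_mult_distrib ac_simps)
      also have "\<dots> = \<tau> * s (x, y)"
        using sections_scale[OF s, of "(x, y)"] that by (simp add: punctured_plane_iff)
      also have "\<dots> = (\<Sum>i\<le>d. (\<tau> * poly (P i) y) * x ^ i)"
        using that by (subst P) (auto simp: punctured_plane_iff sum_distrib_left ac_simps)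
      finally show ?thesis .
    qed
    then have "\<forall>i\<le>d. poly (P i) (b * y) * b ^ i = \<tau> * poly (P i) y"
      by (subst Transcendental.polyfun_eq_coeffs[symmetric]) blast
    then show ?thesis using i by (simp add: poly_pcompose ac_simps)
  qed
  then have "smult (b ^ i) (pcompose (P i) [:0, b:]) = smult \<tau> (P i)"
    by (rule poly_eq_off_0)
  then have "b ^ i * (b ^ j * coeff (P i) j) = \<tau> * coeff (P i) j"
    by (metis coeff_pcompose_linear coeff_smult)
  then show ?thesis using assms(5) by (simp add: power_add)
qed

lemma sections_nonzero_imp_power:
  assumes s: "s \<in> sections b \<tau>" and "\<tau> \<noteq> 0" and p: "p \<in> punctured_plane" "s p \<noteq> 0"
  obtains m where "\<tau> = b ^ m"
proof -
  obtain d P where P: "\<And>p. p \<in> punctured_plane \<Longrightarrow> s p = (\<Sum>i\<le>d. poly (P i) (snd p) * fst p ^ i)"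
    using sections_polynomial[OF assms(1,2)] by blast
  obtain i where i: "i \<le> d" "P i \<noteq> 0"
    using P[OF p(1)] p(2) by (metis (no_types, lifting) atMost_iff mult_zero_left poly_0 sum.neutral)
  then obtain j where "coeff (P i) j \<noteq> 0" using leading_coeff_neq_0 by blast
  then show ?thesis using that sections_polynomial_coeff[OF assms(1,2) P i(1)] by blast
qed

lemma sections_homogeneous:
  assumes s: "s \<in> sections b (b ^ m)"
  shows "\<exists>c. \<forall>p\<in>punctured_plane. s p = (\<Sum>i\<le>m. c i * fst p ^ i * snd p ^ (m - i))"
proof -
  have nz: "b ^ m \<noteq> 0" using b_nonzero by simp
  obtain d P where P: "\<And>p. p \<in> punctured_plane \<Longrightarrow> s p = (\<Sum>i\<le>d. poly (P i) (snd p) * fst p ^ i)"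
    using sections_polynomial[OF s nz] by blast
  have deg: "i + j = m" if "i \<le> d" "coeff (P i) j \<noteq> 0" for i j
    using sections_polynomial_coeff[OF s nz P that] b_power_inject by simp
  have P1: "P i = monom (coeff (P i) (m - i)) (m - i)" if "i \<le> d" "i \<le> m" for i
  proof (rule poly_eqI)
    show "coeff (P i) j = coeff (monom (coeff (P i) (m - i)) (m - i)) j" for j
      using deg[OF that(1), of j] that(2) by (cases "j = m - i"; cases "coeff (P i) j = 0") auto
  qed
  have P2: "P i = 0" if "i \<le> d" "\<not> i \<le> m" for i
  proof (rule poly_eqI)
    show "coeff (P i) j = coeff 0 j" for j
      using deg[OF that(1), of j] that(2) by auto
  qed
  \<comment> \<open>The bound \<open>d\<close> is unrelated to \<open>m\<close>: exponents above
    \<open>d\<close> get the coefficient \<open>0\<close>, and for \<open>m < i \<le> d\<close> the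
    polynomial \<open>P i\<close> is zero.\<close>
  define c where "c = (\<lambda>i. if i \<le> d then coeff (P i) (m - i) else 0)"
  have "s p = (\<Sum>i\<le>m. c i * fst p ^ i * snd p ^ (m - i))" if "p \<in> punctured_plane" for p
  proof -
    have "s p = (\<Sum>i\<le>d. poly (P i) (snd p) * fst p ^ i)" by (rule P[OF that])
    also have "\<dots> = (\<Sum>i\<in>{..d} \<inter> {..m}. poly (P i) (snd p) * fst p ^ i)"
      by (rule sum.mono_neutral_right) (auto simp: P2)
    also have "\<dots> = (\<Sum>i\<in>{..d} \<inter> {..m}. c i * fst p ^ i * snd p ^ (m - i))"
    proof (rule sum.cong)
      fix i assume "i \<in> {..d} \<inter> {..m}"
      then have "poly (P i) (snd p) = c i * snd p ^ (m - i)"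
        by (subst P1) (auto simp: c_def poly_monom)
      then show "poly (P i) (snd p) * fst p ^ i = c i * fst p ^ i * snd p ^ (m - i)" by simp
    qed simp
    also have "\<dots> = (\<Sum>i\<le>m. c i * fst p ^ i * snd p ^ (m - i))"
      by (rule sum.mono_neutral_left) (auto simp: c_def)
    finally show ?thesis .
  qed
  then show ?thesis by blast
qed

lemma sections_one_constant:
  assumes "s \<in> sections b 1"
  shows "\<exists>c. \<forall>p\<in>punctured_plane. s p = c"
proof -
  obtain c where "\<forall>p\<in>punctured_plane. s p = (\<Sum>i\<le>0. c i * fst p ^ i * snd p ^ (0 - i))"
    using sections_homogeneous[of s 0] assms by (auto simp del: sum.atMost_Suc)
  then have "s p = c 0" if "p \<in> punctured_plane" for p
    using that by simp
  then show ?thesis by blast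
qed

lemma sections_b_linear:
  assumes "s \<in> sections b b"
  shows "\<exists>u v. \<forall>p\<in>punctured_plane. s p = u * fst p + v * snd p"
proof -
  obtain c where "\<forall>p\<in>punctured_plane. s p = (\<Sum>i\<le>1. c i * fst p ^ i * snd p ^ (1 - i))"
    using sections_homogeneous[of s 1] assms by (auto simp del: sum.atMost_Suc)
  then have "s p = c 1 * fst p + c 0 * snd p" if "p \<in> punctured_plane" for p
    using that by simp
  then show ?thesis by blast
qed

lemma sections_b2_quadratic:
  assumes "s \<in> sections b (b\<^sup>2)"
  shows "\<exists>\<alpha> \<beta> \<gamma>. \<forall>p\<in>punctured_plane.
    s p = \<alpha> * (fst p)\<^sup>2 + \<beta> * fst p * snd p + \<gamma> * (snd p)\<^sup>2"
proof -
  obtain c where "\<forall>p\<in>punctured_plane. s p = (\<Sum>i\<le>2. c i * fst p ^ i * snd p ^ (2 - i))"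
    using sections_homogeneous[of s 2] assms by (auto simp del: sum.atMost_Suc)
  then have "s p = c 2 * (fst p)\<^sup>2 + c 1 * fst p * snd p + c 0 * (snd p)\<^sup>2" if "p \<in> punctured_plane" for p
    using that by (simp add: numeral_2_eq_2)
  then show ?thesis by blast
qed

section \<open>Zeros of sections and division by linear forms\<close>

lemma sections_nowhere_zero:
  assumes s: "s \<in> sections b \<tau>" and "\<tau> \<noteq> 0" and nz: "\<And>p. p \<in> punctured_plane \<Longrightarrow> s p \<noteq> 0"
  shows "\<tau> = 1"
proof -
  have p: "(1, 0) \<in> punctured_plane" by (simp add: punctured_plane_iff)
  obtain m where m: "\<tau> = b ^ m"
    using sections_nonzero_imp_power[OF assms(1,2) p nz[OF p]] by blast
  \<comment> \<open>The inverse of \<open>s\<close> is a section of the dual bundle, so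
    \<open>\<tau>\<close> and \<open>inverse \<tau>\<close> are both nonnegative powers of
    \<open>b\<close>; this leaves only the exponent \<open>0\<close>.\<close>
  obtain n where n: "inverse \<tau> = b ^ n"
    using sections_nonzero_imp_power[OF sections_inverse[OF s nz] _ p] nz[OF p] assms(2) by auto
  have "b ^ (m + n) = b ^ 0"
    using m n assms(2) by (simp add: power_add field_simps)
  then have "m + n = 0" using b_power_inject by blast
  then show ?thesis using m by simp
qed

text \<open>At \<open>(0, 1)\<close> only the monomial \<open>snd p ^ Suc m\<close> survives, and it
  is the only one that \<open>fst p\<close> does not divide.\<close>

lemma sections_divisible_fst:
  assumes s: "s \<in> sections b (b ^ Suc m)" and "s (0, 1) = 0"
  obtains c where "c \<in> sections b (b ^ m)" "\<And>p. p \<in> punctured_plane \<Longrightarrow> s p = fst p * c p"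
proof -
  obtain a where a: "\<forall>p\<in>punctured_plane. s p = (\<Sum>i\<le>Suc m. a i * fst p ^ i * snd p ^ (Suc m - i))"
    using sections_homogeneous[OF s] by (elim exE)
  have "a 0 = 0"
  proof -
    have "0 = (\<Sum>i\<le>Suc m. a i * 0 ^ i)"
      using a[rule_format, of "(0, 1)"] assms(2) by (simp add: punctured_plane_iff del: sum.atMost_Suc)
    then show ?thesis by (simp add: sum.atMost_Suc_shift del: sum.atMost_Suc)
  qed
  define c where "c = (\<lambda>p. \<Sum>i\<le>m. a (Suc i) * fst p ^ i * snd p ^ (m - i) :: complex)"
  show ?thesis
  proof (rule that)
    show "c \<in> sections b (b ^ m)"
    proof (rule sectionsI)
      show "c holomorphic2_on punctured_plane"
        unfolding c_def by (intro holomorphic2_intros)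
      have "a (Suc i) * (b * fst p) ^ i * (b * snd p) ^ (m - i) =
          b ^ m * (a (Suc i) * fst p ^ i * snd p ^ (m - i))" if "i \<le> m" for p i
      proof -
        have "b ^ m = b ^ i * b ^ (m - i)" using that by (metis le_add_diff_inverse power_add)
        then show ?thesis by (simp only: power_mult_distrib ac_simps)
      qed
      then show "c (b * fst p, b * snd p) = b ^ m * c p" for p
        unfolding c_def sum_distrib_left fst_conv snd_conv by (intro sum.cong) auto
    qed
    fix p assume "p \<in> punctured_plane"
    then have "s p = (\<Sum>i\<le>Suc m. a i * fst p ^ i * snd p ^ (Suc m - i))"
      using a by blast
    also have "\<dots> = (\<Sum>i\<le>m. fst p * (a (Suc i) * fst p ^ i * snd p ^ (m - i)))"
      by (subst sum.atMost_Suc_shift) (simp add: \<open>a 0 = 0\<close> ac_simps)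
    also have "\<dots> = fst p * c p"
      by (simp add: c_def sum_distrib_left)
    finally show "s p = fst p * c p" .
  qed
qed

text \<open>
  In the coordinates \<open>z = u x + v y\<close>, \<open>w = cnj v x - cnj u y\<close> the zero \<open>(v, - u)\<close> of \<open>z\<close> lies on
  the \<open>w\<close>-axis.
\<close>

lemma sections_divisible_linear:
  assumes s: "s \<in> sections b (b ^ Suc m)" and "s (v, - u) = 0" and uv: "(u, v) \<noteq> (0, 0)"
  obtains c where "c \<in> sections b (b ^ m)"
    "\<And>p. p \<in> punctured_plane \<Longrightarrow> s p = (u * fst p + v * snd p) * c p"
proof -
  define N where "N = u * cnj u + v * cnj v"
  have N: "N \<noteq> 0" unfolding N_def by (rule norm_form_nonzero[OF uv])
  \<comment> \<open>The substitution maps \<open>(0, 1)\<close> to \<open>(v, - u)\<close>, so the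
    new section vanishes at \<open>(0, 1)\<close>.\<close>
  have "(\<lambda>p. s (cnj u * fst p + v * snd p, cnj v * fst p + (- u) * snd p)) \<in> sections b (b ^ Suc m)"
  proof (rule sections_linear_substitution[OF s])
    have "cnj u * (- u) - v * cnj v = - N" by (simp add: N_def)
    then show "cnj u * (- u) - v * cnj v \<noteq> 0" using N by simp
  qed
  from sections_divisible_fst[OF this] assms(2) obtain c where
    c: "c \<in> sections b (b ^ m)" "\<And>p. p \<in> punctured_plane \<Longrightarrow>
      s (cnj u * fst p + v * snd p, cnj v * fst p + (- u) * snd p) = fst p * c p"
    by auto
  \<comment> \<open>\<open>?q\<close> inverts the substitution above, and its first component is
    \<open>u * fst p + v * snd p\<close> divided by \<open>N\<close>.\<close>
  let ?q = "\<lambda>p. (u / N * fst p + v / N * snd p, cnj v / N * fst p + (- cnj u / N) * snd p)"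
  have det: "u / N * (- cnj u / N) - v / N * (cnj v / N) \<noteq> 0"
  proof -
    have "u / N * (- cnj u / N) - v / N * (cnj v / N) = - (u * cnj u + v * cnj v) / (N * N)"
      by (simp add: diff_divide_distrib)
    also have "\<dots> = - N / (N * N)" by (simp only: N_def)
    finally show ?thesis using N by simp
  qed
  show ?thesis
  proof (rule that)
    show "(\<lambda>p. 1 / N * c (?q p)) \<in> sections b (b ^ m)"
      by (intro sections_cmult sections_linear_substitution[OF c(1) det])
    fix p assume "p \<in> punctured_plane"
    from c(2)[OF linear_substitution_punctured[OF det this]]
    have *: "s (cnj u * fst (?q p) + v * snd (?q p), cnj v * fst (?q p) + (- u) * snd (?q p)) =
          fst (?q p) * c (?q p)" .
    have 1: "cnj u * fst (?q p) + v * snd (?q p) = fst p"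
      using N by (simp add: field_simps) (simp add: N_def algebra_simps)
    have 2: "cnj v * fst (?q p) + (- u) * snd (?q p) = snd p"
      using N by (simp add: field_simps) (simp add: N_def algebra_simps)
    have "fst (?q p) = (u * fst p + v * snd p) / N" by (simp add: add_divide_distrib)
    then show "s p = (u * fst p + v * snd p) * (1 / N * c (?q p))"
      using *[unfolded 1 2] by (simp only: prod.collapse mult_1_left times_divide_eq_left times_divide_eq_right)
  qed
qed

end

subsection \<open>Conjugation of Higgs fields\<close>

definition mat2 :: "complex \<Rightarrow> complex \<Rightarrow> complex \<Rightarrow> complex \<Rightarrow> complex ^ 2 ^ 2" where
  "mat2 \<alpha> \<beta> \<gamma> \<delta> = vector [vector [\<alpha>, \<beta>], vector [\<gamma>, \<delta>]]"

lemma mat2_nth [simp]: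
  "mat2 \<alpha> \<beta> \<gamma> \<delta> $ 1 $ 1 = \<alpha>" "mat2 \<alpha> \<beta> \<gamma> \<delta> $ 1 $ 2 = \<beta>"
  "mat2 \<alpha> \<beta> \<gamma> \<delta> $ 2 $ 1 = \<gamma>" "mat2 \<alpha> \<beta> \<gamma> \<delta> $ 2 $ 2 = \<delta>"
  by (simp_all add: mat2_def)

lemma mat2_collapse: "mat2 (A $ 1 $ 1) (A $ 1 $ 2) (A $ 2 $ 1) (A $ 2 $ 2) = A"
  by (simp add: vec_eq_iff forall_2)

lemma mat2_eq_iff:
  "mat2 \<alpha> \<beta> \<gamma> \<delta> = mat2 \<alpha>' \<beta>' \<gamma>' \<delta>' \<longleftrightarrow> \<alpha> = \<alpha>' \<and> \<beta> = \<beta>' \<and> \<gamma> = \<gamma>' \<and> \<delta> = \<delta>'"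
  by (auto simp: vec_eq_iff forall_2)

lemma mat2_mult:
  "mat2 \<alpha> \<beta> \<gamma> \<delta> ** mat2 \<alpha>' \<beta>' \<gamma>' \<delta>' =
   mat2 (\<alpha> * \<alpha>' + \<beta> * \<gamma>') (\<alpha> * \<beta>' + \<beta> * \<delta>') (\<gamma> * \<alpha>' + \<delta> * \<gamma>') (\<gamma> * \<beta>' + \<delta> * \<delta>')"
  by (simp add: vec_eq_iff forall_2 matrix_matrix_mult_def sum_2)

lemma det_mat2: "det (mat2 \<alpha> \<beta> \<gamma> \<delta>) = \<alpha> * \<delta> - \<beta> * \<gamma>"
  by (simp add: det_2)

lemma mat2_mult_vector:
  "mat2 \<alpha> \<beta> \<gamma> \<delta> *v \<sigma> = vector [\<alpha> * \<sigma> $ 1 + \<beta> * \<sigma> $ 2, \<gamma> * \<sigma> $ 1 + \<delta> * \<sigma> $ 2]"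
  by (simp add: vec_eq_iff forall_2 matrix_vector_mult_def sum_2)

lemma mat2_eq_0_iff: "mat2 \<alpha> \<beta> \<gamma> \<delta> = 0 \<longleftrightarrow> \<alpha> = 0 \<and> \<beta> = 0 \<and> \<gamma> = 0 \<and> \<delta> = 0"
  by (auto simp: vec_eq_iff forall_2)

lemma det_mat_diff_mat2: "det (mat v - mat2 p q w (- p)) = v\<^sup>2 - (p\<^sup>2 + q * w)"
  by (simp add: det_2 mat_def power2_eq_square algebra_simps)

lemma phi1_eq: "phi1 s t u p = mat2 (t * fst p) (s * fst p + u * snd p) (snd p) (- (t * fst p))"
  by (simp add: phi1_def mat2_def case_prod_unfold)

lemma phi2_eq: "phi2 \<beta> p = mat2 0 (\<beta> p) 1 0"
  by (simp add: phi2_def mat2_def)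

lemma phi3_eq: "phi3 k u v p = mat2 (u * fst p + v * snd p) ((cnj v * fst p - cnj u * snd p) ^ (1 + k))
    0 (- (u * fst p + v * snd p))"
  by (simp add: phi3_def mat2_def case_prod_unfold)

lemma multipliers_nth [simp]: "multipliers \<tau> $ 1 = 1" "multipliers \<tau> $ 2 = \<tau>"
  by (simp_all add: multipliers_def)

lemma end_sections_iff:
  assumes "\<tau> \<noteq> 0"
  shows "A \<in> end_sections b \<nu> \<tau> \<longleftrightarrow>
    (\<lambda>p. A p $ 1 $ 1) \<in> sections b \<nu> \<and> (\<lambda>p. A p $ 1 $ 2) \<in> sections b (\<nu> / \<tau>) \<and>
    (\<lambda>p. A p $ 2 $ 1) \<in> sections b (\<nu> * \<tau>) \<and> (\<lambda>p. A p $ 2 $ 2) \<in> sections b \<nu>"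
  using assms by (auto simp: end_sections_def forall_2)

lemma higgs_fields_iff:
  assumes "\<tau> \<noteq> 0" "b \<noteq> 0"
  shows "\<phi> \<in> higgs_fields b \<nu> \<tau> \<longleftrightarrow>
    (\<exists>p\<in>sections b \<nu>. \<exists>q\<in>sections b (\<nu> / \<tau>). \<exists>w\<in>sections b (\<nu> * \<tau>).
      \<forall>z\<in>punctured_plane. \<phi> z = mat2 (p z) (q z) (w z) (- p z))"
proof
  assume *: "\<phi> \<in> higgs_fields b \<nu> \<tau>"
  have \<phi>: "\<phi> z = mat2 (\<phi> z $ 1 $ 1) (\<phi> z $ 1 $ 2) (\<phi> z $ 2 $ 1) (- \<phi> z $ 1 $ 1)"
    if "z \<in> punctured_plane" for z
  proof -
    have "\<phi> z $ 2 $ 2 = - \<phi> z $ 1 $ 1"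
      using * that by (simp add: higgs_fields_def trace_def sum_2 eq_neg_iff_add_eq_0 add.commute)
    then show ?thesis using mat2_collapse[of "\<phi> z"] by simp
  qed
  have "\<phi> \<in> end_sections b \<nu> \<tau>" using * by (simp add: higgs_fields_def)
  then have S: "(\<lambda>p. \<phi> p $ 1 $ 1) \<in> sections b \<nu>" "(\<lambda>p. \<phi> p $ 1 $ 2) \<in> sections b (\<nu> / \<tau>)"
    "(\<lambda>p. \<phi> p $ 2 $ 1) \<in> sections b (\<nu> * \<tau>)"
    by (simp_all add: end_sections_iff[OF assms(1)])
  show "\<exists>p\<in>sections b \<nu>. \<exists>q\<in>sections b (\<nu> / \<tau>). \<exists>w\<in>sections b (\<nu> * \<tau>).
      \<forall>z\<in>punctured_plane. \<phi> z = mat2 (p z) (q z) (w z) (- p z)"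
    by (rule bexI[OF _ S(1)], rule bexI[OF _ S(2)], rule bexI[OF _ S(3)], rule ballI, rule \<phi>)
next
  assume "\<exists>p\<in>sections b \<nu>. \<exists>q\<in>sections b (\<nu> / \<tau>). \<exists>w\<in>sections b (\<nu> * \<tau>).
      \<forall>z\<in>punctured_plane. \<phi> z = mat2 (p z) (q z) (w z) (- p z)"
  then obtain p q w where *: "p \<in> sections b \<nu>" "q \<in> sections b (\<nu> / \<tau>)" "w \<in> sections b (\<nu> * \<tau>)"
    and \<phi>: "\<And>z. z \<in> punctured_plane \<Longrightarrow> \<phi> z = mat2 (p z) (q z) (w z) (- p z)"
    by blast
  have "\<phi> \<in> end_sections b \<nu> \<tau>"
    unfolding end_sections_iff[OF assms(1)]
    by (intro conjI sections_cong[OF *(1)] sections_cong[OF *(2)] sections_cong[OF *(3)]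
          sections_cong[OF sections_minus[OF *(1)]])
       (use assms(2) \<phi> in simp_all)
  then show "\<phi> \<in> higgs_fields b \<nu> \<tau>"
    using \<phi> by (simp add: higgs_fields_def trace_def sum_2)
qed

lemma matrix_inv_inverse:
  fixes A :: "complex ^ 'n ^ 'm"
  assumes "invertible A"
  shows "A ** matrix_inv A = mat 1" "matrix_inv A ** A = mat 1"
  using someI_ex[OF assms[unfolded invertible_def]] unfolding matrix_inv_def by blast+

text \<open>Multiplication by \<open>g\<close> on the right removes \<open>matrix_inv\<close>. What
  remains are identities between products of sections, to be compared entry by entry.\<close>

lemma conjugate_higgs_iff:
  assumes "\<tau> \<noteq> 0" "b \<noteq> 0"
  shows "conjugate_higgs b \<tau> \<phi> \<psi> \<longleftrightarrow>
    (\<exists>\<alpha>\<in>sections b 1. \<exists>\<beta>\<in>sections b (1 / \<tau>). \<exists>\<gamma>\<in>sections b \<tau>. \<exists>\<delta>\<in>sections b 1.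
      \<forall>z\<in>punctured_plane. \<alpha> z * \<delta> z - \<beta> z * \<gamma> z \<noteq> 0 \<and>
        \<psi> z ** mat2 (\<alpha> z) (\<beta> z) (\<gamma> z) (\<delta> z) = mat2 (\<alpha> z) (\<beta> z) (\<gamma> z) (\<delta> z) ** \<phi> z)"
    (is "_ \<longleftrightarrow> ?R")
proof -
  have conj: "B = g ** A ** matrix_inv g \<longleftrightarrow> B ** g = g ** A" if "invertible g" for A B g :: "complex^2^2"
    using that by (metis matrix_inv_inverse matrix_mul_assoc matrix_mul_rid)
  have "conjugate_higgs b \<tau> \<phi> \<psi> \<longleftrightarrow>
      (\<exists>g\<in>automorphisms b \<tau>. \<forall>z\<in>punctured_plane. \<psi> z ** g z = g z ** \<phi> z)"
    unfolding conjugate_higgs_def by (intro bex_cong ball_cong refl conj) (simp add: automorphisms_def)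
  also have "\<dots> \<longleftrightarrow> ?R"
  proof
    assume "\<exists>g\<in>automorphisms b \<tau>. \<forall>z\<in>punctured_plane. \<psi> z ** g z = g z ** \<phi> z"
    then obtain g where g: "g \<in> automorphisms b \<tau>" "\<forall>z\<in>punctured_plane. \<psi> z ** g z = g z ** \<phi> z" ..
    have "g z $ 1 $ 1 * g z $ 2 $ 2 - g z $ 1 $ 2 * g z $ 2 $ 1 \<noteq> 0" if "z \<in> punctured_plane" for z
      using g(1) that invertible_det_nz[of "g z"] by (simp add: automorphisms_def det_2)
    with g(2) have *: "\<forall>z\<in>punctured_plane. g z $ 1 $ 1 * g z $ 2 $ 2 - g z $ 1 $ 2 * g z $ 2 $ 1 \<noteq> 0 \<and>
        \<psi> z ** mat2 (g z $ 1 $ 1) (g z $ 1 $ 2) (g z $ 2 $ 1) (g z $ 2 $ 2) =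
        mat2 (g z $ 1 $ 1) (g z $ 1 $ 2) (g z $ 2 $ 1) (g z $ 2 $ 2) ** \<phi> z"
      by (simp add: mat2_collapse)
    have "g \<in> end_sections b 1 \<tau>" using g(1) by (simp add: automorphisms_def)
    then have S: "(\<lambda>p. g p $ 1 $ 1) \<in> sections b 1" "(\<lambda>p. g p $ 1 $ 2) \<in> sections b (1 / \<tau>)"
      "(\<lambda>p. g p $ 2 $ 1) \<in> sections b \<tau>" "(\<lambda>p. g p $ 2 $ 2) \<in> sections b 1"
      by (simp_all add: end_sections_iff[OF assms(1)])
    show ?R
      by (rule bexI[OF _ S(1)], rule bexI[OF _ S(2)], rule bexI[OF _ S(3)], rule bexI[OF _ S(4)], rule *)
  next
    assume ?R
    then obtain \<alpha> \<beta> \<gamma> \<delta> where *: "\<alpha> \<in> sections b 1" "\<beta> \<in> sections b (1 / \<tau>)" "\<gamma> \<in> sections b \<tau>"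
        "\<delta> \<in> sections b 1"
      and det: "\<forall>z\<in>punctured_plane. \<alpha> z * \<delta> z - \<beta> z * \<gamma> z \<noteq> 0"
      and eq: "\<forall>z\<in>punctured_plane. \<psi> z ** mat2 (\<alpha> z) (\<beta> z) (\<gamma> z) (\<delta> z) =
          mat2 (\<alpha> z) (\<beta> z) (\<gamma> z) (\<delta> z) ** \<phi> z"
      by blast
    have "(\<lambda>z. mat2 (\<alpha> z) (\<beta> z) (\<gamma> z) (\<delta> z)) \<in> automorphisms b \<tau>"
      using * assms(1) det by (simp add: automorphisms_def end_sections_iff invertible_det_nz det_mat2)
    with eq show "\<exists>g\<in>automorphisms b \<tau>. \<forall>z\<in>punctured_plane. \<psi> z ** g z = g z ** \<phi> z"
      by (intro bexI[of _ "\<lambda>z. mat2 (\<alpha> z) (\<beta> z) (\<gamma> z) (\<delta> z)"])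
  qed
  finally show ?thesis .
qed

context hopf
begin

lemma higgs_fields_mat2I:
  assumes "\<tau> \<noteq> 0" "p \<in> sections b \<nu>" "q \<in> sections b (\<nu> / \<tau>)" "w \<in> sections b (\<nu> * \<tau>)"
    "\<And>z. z \<in> punctured_plane \<Longrightarrow> \<phi> z = mat2 (p z) (q z) (w z) (- p z)"
  shows "\<phi> \<in> higgs_fields b \<nu> \<tau>"
  unfolding higgs_fields_iff[OF assms(1) b_nonzero]
  by (rule bexI[of _ p], rule bexI[of _ q], rule bexI[of _ w]) (use assms(2-5) in simp_all)

lemma line_degree_inverse_power: "line_degree b (inverse b ^ k) = - real k"
proof -
  have "ln (cmod b) < 0" using b by simp
  moreover have "ln (cmod (inverse b ^ k)) = - real k * ln (cmod b)"
    using b by (simp add: norm_power norm_inverse ln_realpow ln_inverse)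
  ultimately show ?thesis by (simp add: line_degree_def)
qed

lemma sections_linear': "(\<lambda>p. u * fst p - v * snd p) \<in> sections b b"
  using sections_linear[of u "-v" b] by simp

section \<open>The listed fields and the conjugacies between them\<close>

lemma phi1_higgs: "phi1 s t u \<in> higgs_fields b b 1"
proof (rule higgs_fields_mat2I)
  show "(\<lambda>p. t * fst p) \<in> sections b b" "(\<lambda>p. s * fst p + u * snd p) \<in> sections b (b / 1)"
    "(\<lambda>p. snd p) \<in> sections b (b * 1)"
    using sections_linear[of t 0] sections_linear[of s u] sections_linear[of 0 1] by simp_all
qed (simp_all add: phi1_eq)

lemma phi1_nowhere_vanishing:
  assumes "s\<^sup>2 - 4 * t\<^sup>2 * u \<noteq> 0"
  shows "nowhere_vanishing (phi1 s t u)"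
  using assms by (auto simp: nowhere_vanishing_def phi1_eq mat2_eq_0_iff punctured_plane_iff)

lemma phi2_higgs:
  assumes "\<beta> \<in> sections b (b\<^sup>2)"
  shows "phi2 \<beta> \<in> higgs_fields b b (inverse b)"
proof (rule higgs_fields_mat2I[of _ "\<lambda>p. 0" b \<beta> "\<lambda>p. 1"])
  have "b / inverse b = b\<^sup>2" by (simp add: power2_eq_square divide_inverse)
  then show "\<beta> \<in> sections b (b / inverse b)" using assms by simp
qed (use b_nonzero in \<open>simp_all add: phi2_eq sections_zero sections_const\<close>)

lemma phi2_nowhere_vanishing: "nowhere_vanishing (phi2 \<beta>)"
  by (simp add: nowhere_vanishing_def phi2_eq mat2_eq_0_iff)

lemma phi3_higgs: "phi3 k u v \<in> higgs_fields b b (inverse b ^ k)"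
proof (rule higgs_fields_mat2I[of _ "\<lambda>p. u * fst p + v * snd p" b
      "\<lambda>p. (cnj v * fst p - cnj u * snd p) ^ (1 + k)" "\<lambda>p. 0"])
  have "b / inverse b ^ k = b ^ (1 + k)" by (simp add: field_simps)
  then show "(\<lambda>p. (cnj v * fst p - cnj u * snd p) ^ (1 + k)) \<in> sections b (b / inverse b ^ k)"
    by (simp only: sections_power[OF sections_linear'])
qed (use b_nonzero in \<open>simp_all add: sections_linear sections_zero phi3_eq\<close>)

lemma conj_coordinates_punctured:
  assumes "(u, v) \<noteq> (0, 0)" "p \<in> punctured_plane"
  shows "u * fst p + v * snd p \<noteq> 0 \<or> cnj v * fst p - cnj u * snd p \<noteq> 0"
proof -
  have "u * (- cnj u) - v * cnj v = - (u * cnj u + v * cnj v)" by simp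
  then have "u * (- cnj u) - v * cnj v \<noteq> 0"
    using norm_form_nonzero[OF assms(1)] by (simp only: neg_equal_0_iff_equal not_False_eq_True)
  from linear_substitution_punctured[OF this assms(2)] show ?thesis
    by (simp add: punctured_plane_iff)
qed

lemma phi3_nowhere_vanishing:
  assumes "(u, v) \<noteq> (0, 0)"
  shows "nowhere_vanishing (phi3 k u v)"
  using conj_coordinates_punctured[OF assms]
  by (auto simp: nowhere_vanishing_def phi3_eq mat2_eq_0_iff simp del: power_Suc)

lemma conjugate_higgs_det:
  assumes "\<tau> \<noteq> 0" "conjugate_higgs b \<tau> \<phi> \<psi>" "p \<in> punctured_plane"
  shows "det (\<psi> p) = det (\<phi> p)"
proof -
  obtain \<alpha> \<beta> \<gamma> \<delta> where
    "\<forall>z\<in>punctured_plane. \<alpha> z * \<delta> z - \<beta> z * \<gamma> z \<noteq> 0 \<and>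
       \<psi> z ** mat2 (\<alpha> z) (\<beta> z) (\<gamma> z) (\<delta> z) = mat2 (\<alpha> z) (\<beta> z) (\<gamma> z) (\<delta> z) ** \<phi> z"
    using assms(2) unfolding conjugate_higgs_iff[OF assms(1) b_nonzero] by blast
  then have det: "\<alpha> p * \<delta> p - \<beta> p * \<gamma> p \<noteq> 0" and
    eq: "\<psi> p ** mat2 (\<alpha> p) (\<beta> p) (\<gamma> p) (\<delta> p) = mat2 (\<alpha> p) (\<beta> p) (\<gamma> p) (\<delta> p) ** \<phi> p"
    using assms(3) by blast+
  from det arg_cong[OF eq, of det] show ?thesis
    by (simp add: det_mul det_mat2)
qed

lemma conjugate_higgs_one_constant:
  "conjugate_higgs b 1 \<phi> \<psi> \<longleftrightarrow> (\<exists>\<alpha> \<beta> \<gamma> \<delta>. \<alpha> * \<delta> - \<beta> * \<gamma> \<noteq> 0 \<and>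
     (\<forall>z\<in>punctured_plane. \<psi> z ** mat2 \<alpha> \<beta> \<gamma> \<delta> = mat2 \<alpha> \<beta> \<gamma> \<delta> ** \<phi> z))"
    (is "_ \<longleftrightarrow> ?R")
proof
  have e: "(1, 0) \<in> punctured_plane" by (simp add: punctured_plane_iff)
  assume "conjugate_higgs b 1 \<phi> \<psi>"
  then obtain \<alpha> \<beta> \<gamma> \<delta> where
    s: "\<alpha> \<in> sections b 1" "\<beta> \<in> sections b 1" "\<gamma> \<in> sections b 1" "\<delta> \<in> sections b 1"
    and *: "\<forall>z\<in>punctured_plane. \<alpha> z * \<delta> z - \<beta> z * \<gamma> z \<noteq> 0 \<and>
        \<psi> z ** mat2 (\<alpha> z) (\<beta> z) (\<gamma> z) (\<delta> z) = mat2 (\<alpha> z) (\<beta> z) (\<gamma> z) (\<delta> z) ** \<phi> z"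
    unfolding conjugate_higgs_iff[OF one_neq_zero b_nonzero] div_by_1 by blast
  obtain \<alpha>' \<beta>' \<gamma>' \<delta>' where c: "\<forall>z\<in>punctured_plane. \<alpha> z = \<alpha>'" "\<forall>z\<in>punctured_plane. \<beta> z = \<beta>'"
     "\<forall>z\<in>punctured_plane. \<gamma> z = \<gamma>'" "\<forall>z\<in>punctured_plane. \<delta> z = \<delta>'"
    using s[THEN sections_one_constant] by blast
  have "\<forall>z\<in>punctured_plane. \<alpha>' * \<delta>' - \<beta>' * \<gamma>' \<noteq> 0 \<and>
      \<psi> z ** mat2 \<alpha>' \<beta>' \<gamma>' \<delta>' = mat2 \<alpha>' \<beta>' \<gamma>' \<delta>' ** \<phi> z"
    using * c by simp
  then show ?R using e by blast
next
  assume ?R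
  then obtain \<alpha> \<beta> \<gamma> \<delta> where *: "\<alpha> * \<delta> - \<beta> * \<gamma> \<noteq> 0"
    "\<forall>z\<in>punctured_plane. \<psi> z ** mat2 \<alpha> \<beta> \<gamma> \<delta> = mat2 \<alpha> \<beta> \<gamma> \<delta> ** \<phi> z"
    by blast
  show "conjugate_higgs b 1 \<phi> \<psi>"
    unfolding conjugate_higgs_iff[OF one_neq_zero b_nonzero]
    by (rule bexI[of _ "\<lambda>z. \<alpha>"], rule bexI[of _ "\<lambda>z. \<beta>"], rule bexI[of _ "\<lambda>z. \<gamma>"], rule bexI[of _ "\<lambda>z. \<delta>"])
       (use * in \<open>simp_all add: sections_const\<close>)
qed

lemma quadratic_form_eq:
  assumes "\<And>p. p \<in> punctured_plane \<Longrightarrow>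
    \<alpha> * (fst p)\<^sup>2 + \<beta> * fst p * snd p + \<gamma> * (snd p)\<^sup>2 =
    \<alpha>' * (fst p)\<^sup>2 + \<beta>' * fst p * snd p + \<gamma>' * (snd p)\<^sup>2"
  shows "\<alpha> = \<alpha>'" "\<beta> = \<beta>'" "\<gamma> = \<gamma>'"
proof -
  show "\<alpha> = \<alpha>'" "\<gamma> = \<gamma>'"
    using assms[of "(1, 0)"] assms[of "(0, 1)"] by (simp_all add: punctured_plane_iff)
  then show "\<beta> = \<beta>'"
    using assms[of "(1, 1)"] by (simp add: punctured_plane_iff)
qed

text \<open>Minus the determinant is the quadratic form with coefficients \<open>t\<^sup>2\<close>,
  \<open>s\<close> and \<open>u\<close>, which determines \<open>s\<close> and \<open>u\<close>, and
  \<open>t\<close> up to sign. The sign change is realized by a constant matrix whose determinant is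
  the discriminant.\<close>

lemma phi1_conjugate_iff:
  assumes "s\<^sup>2 - 4 * t\<^sup>2 * u \<noteq> 0"
  shows "conjugate_higgs b 1 (phi1 s t u) (phi1 s' t' u') \<longleftrightarrow> s' = s \<and> u' = u \<and> (t' = t \<or> t' = - t)"
proof
  assume c: "conjugate_higgs b 1 (phi1 s t u) (phi1 s' t' u')"
  have "t'\<^sup>2 * (fst p)\<^sup>2 + s' * fst p * snd p + u' * (snd p)\<^sup>2 =
      t\<^sup>2 * (fst p)\<^sup>2 + s * fst p * snd p + u * (snd p)\<^sup>2" if "p \<in> punctured_plane" for p
    using conjugate_higgs_det[OF one_neq_zero c that]
    by (simp add: phi1_eq det_mat2 algebra_simps power2_eq_square)
  from quadratic_form_eq[OF this] show "s' = s \<and> u' = u \<and> (t' = t \<or> t' = - t)"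
    by (simp add: power2_eq_iff)
next
  assume *: "s' = s \<and> u' = u \<and> (t' = t \<or> t' = - t)"
  show "conjugate_higgs b 1 (phi1 s t u) (phi1 s' t' u')"
    unfolding conjugate_higgs_one_constant
  proof (cases "t' = t")
    case True
    show "\<exists>\<alpha> \<beta> \<gamma> \<delta>. \<alpha> * \<delta> - \<beta> * \<gamma> \<noteq> 0 \<and>
     (\<forall>z\<in>punctured_plane. phi1 s' t' u' z ** mat2 \<alpha> \<beta> \<gamma> \<delta> = mat2 \<alpha> \<beta> \<gamma> \<delta> ** phi1 s t u z)"
      by (rule exI[of _ 1], rule exI[of _ 0], rule exI[of _ 0], rule exI[of _ 1])
         (use * True in \<open>simp add: phi1_eq mat2_mult\<close>)
  next
    case False
    show "\<exists>\<alpha> \<beta> \<gamma> \<delta>. \<alpha> * \<delta> - \<beta> * \<gamma> \<noteq> 0 \<and>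
     (\<forall>z\<in>punctured_plane. phi1 s' t' u' z ** mat2 \<alpha> \<beta> \<gamma> \<delta> = mat2 \<alpha> \<beta> \<gamma> \<delta> ** phi1 s t u z)"
      \<comment> \<open>The matrix is \<open>s\<close> plus \<open>2 * t\<close> times the
        coefficient of \<open>y\<close> in \<open>phi1 s t u\<close>. It commutes with that
        coefficient and conjugates the coefficient of \<open>x\<close> to the one with
        \<open>- t\<close>.\<close>
      by (rule exI[of _ s], rule exI[of _ "2 * t * u"], rule exI[of _ "2 * t"], rule exI[of _ s])
         (use * False assms in \<open>simp add: phi1_eq mat2_mult mat2_eq_iff power2_eq_square algebra_simps\<close>)
  qed
qed

lemma phi2_conjugate_iff:
  "conjugate_higgs b (inverse b) (phi2 \<beta>) (phi2 \<beta>') \<longleftrightarrow> (\<forall>p\<in>punctured_plane. \<beta>' p = \<beta> p)"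
proof
  assume c: "conjugate_higgs b (inverse b) (phi2 \<beta>) (phi2 \<beta>')"
  show "\<forall>p\<in>punctured_plane. \<beta>' p = \<beta> p"
    using conjugate_higgs_det[OF _ c] b_nonzero by (simp add: phi2_eq det_mat2)
next
  assume *: "\<forall>p\<in>punctured_plane. \<beta>' p = \<beta> p"
  show "conjugate_higgs b (inverse b) (phi2 \<beta>) (phi2 \<beta>')"
    unfolding conjugate_higgs_iff[OF nonzero_imp_inverse_nonzero[OF b_nonzero] b_nonzero]
    by (rule bexI[of _ "\<lambda>z. 1"], rule bexI[of _ "\<lambda>z. 0"], rule bexI[of _ "\<lambda>z. 0"], rule bexI[of _ "\<lambda>z. 1"])
       (use * in \<open>simp_all add: sections_const sections_zero phi2_eq mat2_mult mat2_eq_iff\<close>)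
qed

lemma sections_inverse_power_zero:
  assumes "s \<in> sections b (inverse b ^ Suc k)" "p \<in> punctured_plane"
  shows "s p = 0"
proof (rule ccontr)
  assume "s p \<noteq> 0"
  then obtain m where "inverse b ^ Suc k = b ^ m"
    using sections_nonzero_imp_power[OF assms(1) _ assms(2)] b_nonzero by auto
  then have "b ^ (m + Suc k) = b ^ 0"
    using b_nonzero by (simp add: power_add field_simps)
  then show False using b_power_inject by blast
qed

text \<open>The determinant gives \<open>u * x + v * y\<close> only up to sign. Once
  \<open>\<gamma>\<close> vanishes, the conjugating matrix preserves the first summand, and
  comparing the lower right entries fixes the sign. For positive \<open>k\<close> the degree kills
  \<open>\<gamma>\<close>; for \<open>k = 0\<close> it is a constant that has to be
  excluded.\<close>

lemma phi3_conjugate_imp_eq: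
  assumes uv: "(u, v) \<noteq> (0, 0)" and c: "conjugate_higgs b (inverse b ^ k) (phi3 k u v) (phi3 k u' v')"
  shows "u' = u \<and> v' = v"
proof -
  have \<tau>: "inverse b ^ k \<noteq> 0" using b_nonzero by simp
  obtain \<alpha> \<beta> \<gamma> \<delta> where
    s: "\<alpha> \<in> sections b 1" "\<beta> \<in> sections b (1 / inverse b ^ k)" "\<gamma> \<in> sections b (inverse b ^ k)" "\<delta> \<in> sections b 1"
    and det: "\<forall>z\<in>punctured_plane. \<alpha> z * \<delta> z - \<beta> z * \<gamma> z \<noteq> 0"
    and eq: "\<forall>z\<in>punctured_plane.
        phi3 k u' v' z ** mat2 (\<alpha> z) (\<beta> z) (\<gamma> z) (\<delta> z) = mat2 (\<alpha> z) (\<beta> z) (\<gamma> z) (\<delta> z) ** phi3 k u v z"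
    using c unfolding conjugate_higgs_iff[OF \<tau> b_nonzero] by blast
  let ?l = "\<lambda>z. u * fst z + v * snd z" and ?l' = "\<lambda>z. u' * fst z + v' * snd z"
  let ?w = "\<lambda>z. cnj v * fst z - cnj u * snd z"
  have eqs: "- ?l' z * \<gamma> z = \<gamma> z * ?l z" "- ?l' z * \<delta> z = \<gamma> z * ?w z ^ (1 + k) + \<delta> z * - ?l z"
    if "z \<in> punctured_plane" for z
    using eq[rule_format, OF that]
    by (simp_all only: phi3_eq mat2_mult mat2_eq_iff mult_zero_left mult_zero_right add_0_left add_0_right)
  have \<gamma>: "\<gamma> z = 0" if "z \<in> punctured_plane" for z
  proof (cases k)
    case 0
    obtain g where g: "\<forall>z\<in>punctured_plane. \<gamma> z = g"
      using sections_one_constant[of \<gamma>] s(3) 0 by auto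
    obtain d where d: "\<forall>z\<in>punctured_plane. \<delta> z = d"
      using sections_one_constant[OF s(4)] by blast
    \<comment> \<open>At this zero of \<open>?l\<close> the form \<open>?w\<close> equals
      \<open>N\<close>, and the two equations read \<open>L * g = 0\<close> and
      \<open>g * N = - L * d\<close>; multiplying the second by \<open>g\<close> leaves
      \<open>g * (g * N) = 0\<close>.\<close>
    have p: "(v, - u) \<in> punctured_plane" using uv by (auto simp: punctured_plane_iff)
    define L where "L = ?l' (v, - u)"
    define N where "N = u * cnj u + v * cnj v"
    have "L * g = 0"
      using eqs(1)[OF p] g p by (auto simp: L_def algebra_simps)
    moreover have "g * N = - L * d"
      using eqs(2)[OF p] g d p by (simp add: 0 L_def N_def algebra_simps)
    ultimately have "g * (g * N) = 0"
      by auto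
    then show ?thesis using norm_form_nonzero[OF uv] g that by (simp add: N_def)
  next
    case (Suc n)
    then show ?thesis using sections_inverse_power_zero[of \<gamma> n] s(3) that by simp
  qed
  have "?l' z = ?l z" if "z \<in> punctured_plane" for z
  proof -
    have "\<delta> z * ?l' z = \<delta> z * ?l z"
      using eqs(2)[OF that] by (simp only: \<gamma>[OF that] mult_zero_left add_0_left mult_minus_left
          mult_minus_right neg_equal_iff_equal mult.commute)
    moreover have "\<delta> z \<noteq> 0"
      using det[rule_format, OF that] \<gamma>[OF that] by auto
    ultimately show ?thesis by (simp only: mult_cancel_left) simp
  qed
  from this[of "(1, 0)"] this[of "(0, 1)"] show ?thesis
    by (simp add: punctured_plane_iff)
qed

lemma conjugate_higgs_refl:
  assumes "\<tau> \<noteq> 0"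
  shows "conjugate_higgs b \<tau> \<phi> \<phi>"
proof -
  have *: "mat2 1 0 0 1 = mat 1" by (simp add: vec_eq_iff forall_2 mat_def)
  show ?thesis
    unfolding conjugate_higgs_iff[OF assms b_nonzero]
    by (rule bexI[of _ "\<lambda>z. 1"], rule bexI[of _ "\<lambda>z. 0"], rule bexI[of _ "\<lambda>z. 0"], rule bexI[of _ "\<lambda>z. 1"])
       (simp_all add: sections_const sections_zero *)
qed

lemma phi3_conjugate_iff:
  assumes "(u, v) \<noteq> (0, 0)"
  shows "conjugate_higgs b (inverse b ^ k) (phi3 k u v) (phi3 k u' v') \<longleftrightarrow> u' = u \<and> v' = v"
proof
  have \<tau>: "inverse b ^ k \<noteq> 0" using b_nonzero by simp
  assume "u' = u \<and> v' = v"
  then show "conjugate_higgs b (inverse b ^ k) (phi3 k u v) (phi3 k u' v')"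
    using conjugate_higgs_refl[OF \<tau>, of "phi3 k u v"] by simp
qed (rule phi3_conjugate_imp_eq[OF assms])

text \<open>Minus the determinant of \<open>phi3\<close> is the square of a linear form, so its
  discriminant is zero, and conjugation preserves the determinant.\<close>

lemma phi1_not_conjugate_phi3:
  assumes "s\<^sup>2 - 4 * t\<^sup>2 * u \<noteq> 0"
  shows "\<not> conjugate_higgs b 1 (phi1 s t u) (phi3 0 u' v')"
proof
  assume c: "conjugate_higgs b 1 (phi1 s t u) (phi3 0 u' v')"
  have "u'\<^sup>2 * (fst p)\<^sup>2 + (2 * u' * v') * fst p * snd p + v'\<^sup>2 * (snd p)\<^sup>2 =
      t\<^sup>2 * (fst p)\<^sup>2 + s * fst p * snd p + u * (snd p)\<^sup>2" if "p \<in> punctured_plane" for p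
    using conjugate_higgs_det[OF one_neq_zero c that]
    by (simp add: phi1_eq phi3_eq det_mat2 algebra_simps power2_eq_square)
  from quadratic_form_eq[OF this, symmetric] have "s\<^sup>2 - 4 * t\<^sup>2 * u = 0"
    by (simp add: power_mult_distrib)
  with assms show False by blast
qed

text \<open>Determinants do not separate the two families when \<open>\<beta>\<close> is a square.
  But the multiplier \<open>inverse b\<close> admits only the zero section, so automorphisms are
  upper triangular, and these cannot turn the lower left entry \<open>1\<close> into
  \<open>0\<close>.\<close>

lemma phi2_not_conjugate_phi3:
  "\<not> conjugate_higgs b (inverse b) (phi2 \<beta>) (phi3 1 u v)"
proof
  have \<tau>: "inverse b \<noteq> 0" using b_nonzero by simp
  assume "conjugate_higgs b (inverse b) (phi2 \<beta>) (phi3 1 u v)"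
  then obtain \<alpha> \<beta>' \<gamma> \<delta> where s: "\<gamma> \<in> sections b (inverse b)"
    and det: "\<forall>z\<in>punctured_plane. \<alpha> z * \<delta> z - \<beta>' z * \<gamma> z \<noteq> 0"
    and eq: "\<forall>z\<in>punctured_plane.
        phi3 1 u v z ** mat2 (\<alpha> z) (\<beta>' z) (\<gamma> z) (\<delta> z) = mat2 (\<alpha> z) (\<beta>' z) (\<gamma> z) (\<delta> z) ** phi2 \<beta> z"
    unfolding conjugate_higgs_iff[OF \<tau> b_nonzero] by blast
  have z: "(1, 0) \<in> punctured_plane" by (simp add: punctured_plane_iff)
  have "\<gamma> (1, 0) = 0" using sections_inverse_power_zero[of \<gamma> 0] s z by simp
  then show False
    using eq[rule_format, OF z] det[rule_format, OF z] by (simp add: phi2_eq phi3_eq mat2_mult mat2_eq_iff)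
qed

end

subsection \<open>Classification of the Higgs fields\<close>

lemma parallel_multiple:
  fixes e1 e2 a1 a2 :: complex
  assumes "(e1, e2) \<noteq> (0, 0)" "a1 * e2 = a2 * e1"
  obtains t where "a1 = t * e1" "a2 = t * e2"
proof (cases "e1 = 0")
  case True
  then have "e2 \<noteq> 0" "a1 = 0" using assms by auto
  then show ?thesis using True by (intro that[of "a2 / e2"]) auto
next
  case False
  then show ?thesis using assms(2) by (intro that[of "a1 / e1"]) (auto simp: field_simps)
qed

text \<open>The expression is the determinant with columns \<open>M e\<close> and \<open>e\<close>
  for the matrix \<open>M\<close> with rows \<open>(p, q)\<close> and \<open>(w, - p)\<close>, so
  its nontrivial zeros are the eigenvectors of \<open>M\<close>. The same expression encodes
  eigenvectors below.\<close>

lemma binary_quadratic_zero: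
  fixes p q w :: complex
  obtains e1 e2 where "(e1, e2) \<noteq> (0, 0)" "q * e2\<^sup>2 + 2 * p * e1 * e2 - w * e1\<^sup>2 = 0"
proof (cases "q = 0")
  case True
  then show ?thesis by (intro that[of 0 1]) auto
next
  case False
  define r where "r = csqrt (p\<^sup>2 + q * w)"
  have "r\<^sup>2 = p\<^sup>2 + q * w" by (simp add: r_def)
  then have "q * ((r - p) / q)\<^sup>2 + 2 * p * ((r - p) / q) - w = 0"
    using False by (simp add: field_simps power2_eq_square)
  then show ?thesis by (intro that[of 1 "(r - p) / q"]) auto
qed

context hopf
begin

lemma conjugate_higgs_nowhere_vanishing:
  assumes "\<tau> \<noteq> 0" "conjugate_higgs b \<tau> \<phi> \<psi>" "nowhere_vanishing \<phi>"
  shows "nowhere_vanishing \<psi>"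
proof -
  obtain g where g: "g \<in> automorphisms b \<tau>" "\<forall>p\<in>punctured_plane. \<psi> p = g p ** \<phi> p ** matrix_inv (g p)"
    using assms(2) unfolding conjugate_higgs_def by blast
  have "\<phi> p = 0" if "p \<in> punctured_plane" "\<psi> p = 0" for p
  proof -
    have inv: "invertible (g p)" using g(1) that(1) by (simp add: automorphisms_def)
    have "matrix_inv (g p) ** \<psi> p ** g p =
        (matrix_inv (g p) ** g p) ** \<phi> p ** (matrix_inv (g p) ** g p)"
      using g(2) that(1) by (simp add: matrix_mul_assoc)
    also have "\<dots> = \<phi> p"
      by (simp add: matrix_inv_inverse[OF inv])
    finally show ?thesis
      using that(2) by (simp add: vec_eq_iff matrix_matrix_mult_def)
  qed
  then show ?thesis using assms(3) by (auto simp: nowhere_vanishing_def)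
qed

lemma conjugate_higgs_one_mat2I:
  assumes "\<alpha> * \<delta> - \<beta> * \<gamma> \<noteq> 0"
    and "\<And>z. z \<in> punctured_plane \<Longrightarrow> \<psi> z ** mat2 \<alpha> \<beta> \<gamma> \<delta> = mat2 \<alpha> \<beta> \<gamma> \<delta> ** \<phi> z"
  shows "conjugate_higgs b 1 \<phi> \<psi>"
  unfolding conjugate_higgs_one_constant
  by (rule exI[of _ \<alpha>], rule exI[of _ \<beta>], rule exI[of _ \<gamma>], rule exI[of _ \<delta>])
     (use assms in simp)

lemma conjugate_higgs_one_trans:
  assumes "conjugate_higgs b 1 \<phi> \<psi>" "conjugate_higgs b 1 \<psi> \<theta>"
  shows "conjugate_higgs b 1 \<phi> \<theta>"
proof -
  obtain \<alpha> \<beta> \<gamma> \<delta> where 1: "\<alpha> * \<delta> - \<beta> * \<gamma> \<noteq> 0"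
    "\<forall>z\<in>punctured_plane. \<psi> z ** mat2 \<alpha> \<beta> \<gamma> \<delta> = mat2 \<alpha> \<beta> \<gamma> \<delta> ** \<phi> z"
    using assms(1) unfolding conjugate_higgs_one_constant by blast
  obtain \<alpha>' \<beta>' \<gamma>' \<delta>' where 2: "\<alpha>' * \<delta>' - \<beta>' * \<gamma>' \<noteq> 0"
    "\<forall>z\<in>punctured_plane. \<theta> z ** mat2 \<alpha>' \<beta>' \<gamma>' \<delta>' = mat2 \<alpha>' \<beta>' \<gamma>' \<delta>' ** \<psi> z"
    using assms(2) unfolding conjugate_higgs_one_constant by blast
  have *: "\<theta> z ** (mat2 \<alpha>' \<beta>' \<gamma>' \<delta>' ** mat2 \<alpha> \<beta> \<gamma> \<delta>) = (mat2 \<alpha>' \<beta>' \<gamma>' \<delta>' ** mat2 \<alpha> \<beta> \<gamma> \<delta>) ** \<phi> z"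
    if "z \<in> punctured_plane" for z
  proof -
    have "\<theta> z ** (mat2 \<alpha>' \<beta>' \<gamma>' \<delta>' ** mat2 \<alpha> \<beta> \<gamma> \<delta>) = mat2 \<alpha>' \<beta>' \<gamma>' \<delta>' ** \<psi> z ** mat2 \<alpha> \<beta> \<gamma> \<delta>"
      using 2(2) that by (simp add: matrix_mul_assoc)
    also have "\<dots> = mat2 \<alpha>' \<beta>' \<gamma>' \<delta>' ** (mat2 \<alpha> \<beta> \<gamma> \<delta> ** \<phi> z)"
      using 1(2) that by (simp flip: matrix_mul_assoc)
    finally show ?thesis by (simp only: matrix_mul_assoc)
  qed
  have "det (mat2 \<alpha>' \<beta>' \<gamma>' \<delta>' ** mat2 \<alpha> \<beta> \<gamma> \<delta>) \<noteq> 0"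
    using 1(1) 2(1) by (simp add: det_mul det_mat2)
  then show ?thesis
    using * unfolding mat2_mult det_mat2 by (rule conjugate_higgs_one_mat2I)
qed

text \<open>
  Conjugation by an upper triangular automorphism rescales the off-diagonal entry and changes it by
  multiples of the diagonal one, so only its value at the zero of the diagonal entry matters.
\<close>

lemma triangular_conjugate_phi3:
  assumes p: "p \<in> sections b b" and q: "q \<in> sections b (b ^ Suc k)"
    and \<phi>: "\<And>z. z \<in> punctured_plane \<Longrightarrow> \<phi> z = mat2 (p z) (q z) 0 (- p z)"
    and nz: "nowhere_vanishing \<phi>"
  obtains u v where "(u, v) \<noteq> (0, 0)" "conjugate_higgs b (inverse b ^ k) \<phi> (phi3 k u v)"
proof -
  obtain u v where uv: "\<forall>z\<in>punctured_plane. p z = u * fst z + v * snd z"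
    using sections_b_linear[OF p] by blast
  have pq: "p z \<noteq> 0 \<or> q z \<noteq> 0" if "z \<in> punctured_plane" for z
    using nz that by (auto simp: nowhere_vanishing_def \<phi> mat2_eq_0_iff)
  \<comment> \<open>If the diagonal vanished identically, \<open>q\<close> would have no zeros and
    its bundle would be trivial, but its multiplier is \<open>b ^ Suc k\<close>.\<close>
  have uv0: "(u, v) \<noteq> (0, 0)"
  proof
    assume "(u, v) = (0, 0)"
    then have "q z \<noteq> 0" if "z \<in> punctured_plane" for z
      using uv pq that by simp
    from sections_nowhere_zero[OF q _ this] have "b ^ Suc k = b ^ 0"
      using b_nonzero by simp
    then show False using b_power_inject by blast
  qed
  let ?w = "\<lambda>z. cnj v * fst z - cnj u * snd z"
  define N where "N = u * cnj u + v * cnj v"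
  have N: "N \<noteq> 0" unfolding N_def by (rule norm_form_nonzero[OF uv0])
  have z0: "(v, - u) \<in> punctured_plane" using uv0 by (auto simp: punctured_plane_iff)
  have q0: "q (v, - u) \<noteq> 0" using pq[OF z0] uv z0 by simp
  \<comment> \<open>At \<open>(v, - u)\<close> the normal form has the off-diagonal value
    \<open>N ^ Suc k\<close>; scaling \<open>q\<close> by \<open>a\<close> matches it there, which
    makes the difference divisible by the diagonal entry.\<close>
  define a where "a = N ^ Suc k / q (v, - u)"
  have a: "a \<noteq> 0" using N q0 by (simp add: a_def)
  have "(\<lambda>z. ?w z ^ Suc k - a * q z) \<in> sections b (b ^ Suc k)"
    by (intro sections_diff sections_cmult sections_power sections_linear' q)
  moreover have "?w (v, - u) ^ Suc k - a * q (v, - u) = 0"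
  proof -
    have 1: "?w (v, - u) = N" by (simp add: N_def algebra_simps)
    have 2: "a * q (v, - u) = N ^ Suc k" using q0 by (simp add: a_def)
    show ?thesis by (simp only: 1 2 diff_self)
  qed
  ultimately obtain c where c: "c \<in> sections b (b ^ k)"
    "\<And>z. z \<in> punctured_plane \<Longrightarrow> ?w z ^ Suc k - a * q z = (u * fst z + v * snd z) * c z"
    using sections_divisible_linear[of _ k v u] uv0 by blast
  have "conjugate_higgs b (inverse b ^ k) \<phi> (phi3 k u v)"
  proof -
    \<comment> \<open>The factor \<open>1 / 2\<close> appears because the diagonal entries
      \<open>p\<close> and \<open>- p\<close> differ by \<open>2 * p\<close>, so an upper right
      entry of the conjugating matrix acts on \<open>q\<close> through twice its product with
      \<open>p\<close>.\<close>
    have s: "(\<lambda>z. a) \<in> sections b 1" "(\<lambda>z. - (1 / 2) * c z) \<in> sections b (1 / inverse b ^ k)"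
      "(\<lambda>z. 0) \<in> sections b (inverse b ^ k)" "(\<lambda>z. 1) \<in> sections b 1"
      using sections_cmult[OF c(1), of "- (1 / 2)"]
      by (auto simp: sections_const sections_zero field_simps)
    have eq: "\<forall>z\<in>punctured_plane. a * 1 - - (1 / 2) * c z * 0 \<noteq> 0 \<and>
      phi3 k u v z ** mat2 a (- (1 / 2) * c z) 0 1 = mat2 a (- (1 / 2) * c z) 0 1 ** \<phi> z"
    proof
      fix z assume z: "z \<in> punctured_plane"
      have "?w z ^ Suc k = (u * fst z + v * snd z) * c z + a * q z"
        using c(2)[OF z] by (simp only: diff_eq_eq)
      then show "a * 1 - - (1 / 2) * c z * 0 \<noteq> 0 \<and>
          phi3 k u v z ** mat2 a (- (1 / 2) * c z) 0 1 = mat2 a (- (1 / 2) * c z) 0 1 ** \<phi> z"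
        using uv z a by (simp add: phi3_eq \<phi> mat2_mult mat2_eq_iff algebra_simps del: power_Suc)
    qed
    have \<tau>: "inverse b ^ k \<noteq> 0" using b_nonzero by simp
    show ?thesis
      unfolding conjugate_higgs_iff[OF \<tau> b_nonzero]
      by (rule bexI[OF _ s(1)], rule bexI[OF _ s(2)], rule bexI[OF _ s(3)], rule bexI[OF _ s(4)], rule eq)
  qed
  then show ?thesis using that uv0 by blast
qed

text \<open>Assumption \<open>C\<close> says that \<open>e\<close> is an eigenvector of every
  \<open>\<phi> z\<close>. In a constant basis beginning with \<open>e\<close> the field is upper
  triangular, and the triangular normal form with \<open>k = 0\<close> applies.\<close>

lemma common_eigenvector_conjugate_phi3:
  assumes p: "p \<in> sections b b" and q: "q \<in> sections b b" and w: "w \<in> sections b b"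
    and \<phi>: "\<And>z. z \<in> punctured_plane \<Longrightarrow> \<phi> z = mat2 (p z) (q z) (w z) (- p z)"
    and nz: "nowhere_vanishing \<phi>" and e: "(e1, e2) \<noteq> (0, 0)"
    and C: "\<And>z. z \<in> punctured_plane \<Longrightarrow> q z * e2\<^sup>2 + 2 * p z * e1 * e2 - w z * e1\<^sup>2 = 0"
  obtains u v where "(u, v) \<noteq> (0, 0)" "conjugate_higgs b 1 \<phi> (phi3 0 u v)"
proof -
  \<comment> \<open>With the determinant of the basis \<open>e\<close>, \<open>f\<close> normalized
    to \<open>1\<close>, its inverse is \<open>mat2 f2 (- f1) (- e2) e1\<close>; \<open>P\<close>
    and \<open>Q\<close> below are the first row of the field in this basis.\<close>
  obtain f1 f2 where f: "e1 * f2 - e2 * f1 = 1"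
  proof (cases "e1 = 0")
    case True
    then show ?thesis using e that[of 0 "- 1 / e2"] by auto
  next
    case False
    then show ?thesis using that[of "1 / e1" 0] by auto
  qed
  define P where "P = (\<lambda>z. (e1 * f2 + e2 * f1) * p z + (e2 * f2 * q z - e1 * f1 * w z))"
  define Q where "Q = (\<lambda>z. f2\<^sup>2 * q z + (2 * f1 * f2 * p z - f1\<^sup>2 * w z))"
  define \<psi> where "\<psi> = (\<lambda>z. mat2 (P z) (Q z) 0 (- P z))"
  have P: "P \<in> sections b b" and Q: "Q \<in> sections b (b ^ Suc 0)"
    unfolding P_def Q_def using p q w by (auto intro!: sections_add sections_diff sections_cmult)
  have c: "conjugate_higgs b 1 \<phi> \<psi>"
  proof (rule conjugate_higgs_one_mat2I)
    show "f2 * e1 - (- f1) * (- e2) \<noteq> 0" using f by (simp add: algebra_simps)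
    fix z assume z: "z \<in> punctured_plane"
    have "P z * f2 + Q z * - e2 = f2 * p z + - f1 * w z"
      "P z * - f1 + Q z * e1 = f2 * q z + - f1 * - p z"
      "0 * f2 + - P z * - e2 = - e2 * p z + e1 * w z"
      "0 * - f1 + - P z * e1 = - e2 * q z + e1 * - p z"
      using C[OF z] f unfolding P_def Q_def by algebra+
    then show "\<psi> z ** mat2 f2 (- f1) (- e2) e1 = mat2 f2 (- f1) (- e2) e1 ** \<phi> z"
      by (simp only: \<psi>_def \<phi>[OF z] mat2_mult)
  qed
  have "nowhere_vanishing \<psi>"
    by (rule conjugate_higgs_nowhere_vanishing[OF one_neq_zero c nz])
  from triangular_conjugate_phi3[OF P Q _ this] obtain u v where
    "(u, v) \<noteq> (0, 0)" "conjugate_higgs b 1 \<psi> (phi3 0 u v)"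
    by (auto simp: \<psi>_def)
  then show ?thesis using that conjugate_higgs_one_trans[OF c] by blast
qed

text \<open>
  Write \<open>\<phi> = x A + y B\<close> and let \<open>e\<close> be an eigenvector of \<open>A\<close> that is not an eigenvector of \<open>B\<close>.
  The matrix of \<open>\<phi>\<close> in the basis \<open>e, B e\<close> has the required form.
\<close>

lemma no_common_eigenvector_conjugate_phi1:
  assumes p: "p \<in> sections b b" and q: "q \<in> sections b b" and w: "w \<in> sections b b"
    and \<phi>: "\<And>z. z \<in> punctured_plane \<Longrightarrow> \<phi> z = mat2 (p z) (q z) (w z) (- p z)"
    and no: "\<And>e1 e2. (e1, e2) \<noteq> (0, 0) \<Longrightarrow>
      \<exists>z\<in>punctured_plane. q z * e2\<^sup>2 + 2 * p z * e1 * e2 - w z * e1\<^sup>2 \<noteq> 0"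
  obtains s t u where "conjugate_higgs b 1 \<phi> (phi1 s t u)"
proof -
  obtain p1 p2 where p': "\<forall>z\<in>punctured_plane. p z = p1 * fst z + p2 * snd z"
    using sections_b_linear[OF p] by blast
  obtain q1 q2 where q': "\<forall>z\<in>punctured_plane. q z = q1 * fst z + q2 * snd z"
    using sections_b_linear[OF q] by blast
  obtain w1 w2 where w': "\<forall>z\<in>punctured_plane. w z = w1 * fst z + w2 * snd z"
    using sections_b_linear[OF w] by blast
  obtain e1 e2 where e: "(e1, e2) \<noteq> (0, 0)" "q1 * e2\<^sup>2 + 2 * p1 * e1 * e2 - w1 * e1\<^sup>2 = 0"
    by (rule binary_quadratic_zero)
  obtain z where z: "z \<in> punctured_plane" "q z * e2\<^sup>2 + 2 * p z * e1 * e2 - w z * e1\<^sup>2 \<noteq> 0"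
    using no[OF e(1)] by blast
  have "q z * e2\<^sup>2 + 2 * p z * e1 * e2 - w z * e1\<^sup>2 =
      (q1 * e2\<^sup>2 + 2 * p1 * e1 * e2 - w1 * e1\<^sup>2) * fst z + (q2 * e2\<^sup>2 + 2 * p2 * e1 * e2 - w2 * e1\<^sup>2) * snd z"
    using z(1) p' q' w' by (simp add: algebra_simps)
  then have B: "q2 * e2\<^sup>2 + 2 * p2 * e1 * e2 - w2 * e1\<^sup>2 \<noteq> 0"
    using z(2) e(2) by auto
  \<comment> \<open>\<open>f\<close> is \<open>B e\<close>; it is independent of \<open>e\<close>
    because \<open>e\<close> is not an eigenvector of \<open>B\<close>.\<close>
  define f1 where "f1 = p2 * e1 + q2 * e2"
  define f2 where "f2 = w2 * e1 - p2 * e2"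
  have "(p1 * e1 + q1 * e2) * e2 = (w1 * e1 - p1 * e2) * e1"
    using e(2) by (simp add: algebra_simps power2_eq_square)
  from parallel_multiple[OF e(1) this] obtain t where
    t: "p1 * e1 + q1 * e2 = t * e1" "w1 * e1 - p1 * e2 = t * e2" by blast
  \<comment> \<open>The trace-free matrix \<open>A\<close> has the eigenvalue \<open>t\<close> at
    \<open>e\<close>, so it acts as \<open>- t\<close> modulo \<open>e\<close>, and
    \<open>A f + t f\<close> is a multiple of \<open>e\<close>, with factor
    \<open>s\<close>.\<close>
  have "(f2 * q1 + f1 * p1 + t * f1) * e2 = (t * f2 - f2 * p1 + f1 * w1) * e1"
    using t by algebra
  from parallel_multiple[OF e(1) this] obtain s where
    s: "f2 * q1 + f1 * p1 + t * f1 = s * e1" "t * f2 - f2 * p1 + f1 * w1 = s * e2" by blast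
  \<comment> \<open>By Cayley-Hamilton the square of the trace-free matrix \<open>B\<close> is the
    scalar \<open>u\<close>, hence \<open>B f = u e\<close>.\<close>
  define u where "u = p2\<^sup>2 + q2 * w2"
  have "conjugate_higgs b 1 \<phi> (phi1 s t u)"
  proof (rule conjugate_higgs_one_mat2I)
    have "f2 * e1 - (- f1) * (- e2) = - (q2 * e2\<^sup>2 + 2 * p2 * e1 * e2 - w2 * e1\<^sup>2)"
      by (simp add: f1_def f2_def algebra_simps power2_eq_square)
    then show "f2 * e1 - (- f1) * (- e2) \<noteq> 0" using B by auto
    fix z assume z: "z \<in> punctured_plane"
    have "t * fst z * f2 + (s * fst z + u * snd z) * - e2 = f2 * p z + - f1 * w z"
      "t * fst z * - f1 + (s * fst z + u * snd z) * e1 = f2 * q z + - f1 * - p z"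
      "snd z * f2 + - (t * fst z) * - e2 = - e2 * p z + e1 * w z"
      "snd z * - f1 + - (t * fst z) * e1 = - e2 * q z + e1 * - p z"
      using p'[rule_format, OF z] q'[rule_format, OF z] w'[rule_format, OF z] s t f1_def f2_def u_def
      by algebra+
    then show "phi1 s t u z ** mat2 f2 (- f1) (- e2) e1 = mat2 f2 (- f1) (- e2) e1 ** \<phi> z"
      by (simp only: phi1_eq \<phi>[OF z] mat2_mult)
  qed
  then show ?thesis using that by blast
qed

text \<open>With \<open>r = s / (2 * t)\<close> both coefficient matrices have the eigenvector
  \<open>(- r, 1)\<close>, so a vanishing discriminant leads back to the triangular case.\<close>

lemma phi1_degenerate_conjugate_phi3:
  assumes "s\<^sup>2 - 4 * t\<^sup>2 * u = 0" "nowhere_vanishing (phi1 s t u)"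
  obtains u' v' where "(u', v') \<noteq> (0, 0)" "conjugate_higgs b 1 (phi1 s t u) (phi3 0 u' v')"
proof -
  have "(1, 0) \<in> punctured_plane" by (simp add: punctured_plane_iff)
  then have "phi1 s t u (1, 0) \<noteq> 0" using assms(2) by (simp add: nowhere_vanishing_def)
  \<comment> \<open>If \<open>t\<close> were zero, the discriminant condition would force
    \<open>s = 0\<close>, and the field would vanish at \<open>(1, 0)\<close>.\<close>
  then have t: "t \<noteq> 0" using assms(1) by (auto simp: phi1_eq mat2_eq_0_iff)
  define r where "r = s / (2 * t)"
  have s: "s = 2 * t * r" using t by (simp add: r_def)
  have u: "u = r\<^sup>2" using assms(1) t by (simp add: s power_mult_distrib)
  have lin: "(\<lambda>p. t * fst p) \<in> sections b b" "(\<lambda>p. s * fst p + u * snd p) \<in> sections b b"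
    "(\<lambda>p. snd p) \<in> sections b b"
    using sections_linear[of t 0] sections_linear[of s u] sections_linear[of 0 1] by simp_all
  have r: "(- r, 1 :: complex) \<noteq> (0, 0)" by simp
  have C: "(s * fst z + u * snd z) * 1\<^sup>2 + 2 * (t * fst z) * - r * 1 - snd z * (- r)\<^sup>2 = 0" for z :: "complex \<times> complex"
    by (simp add: s u algebra_simps)
  obtain u' v' where "(u', v') \<noteq> (0, 0)" "conjugate_higgs b 1 (phi1 s t u) (phi3 0 u' v')"
    by (rule common_eigenvector_conjugate_phi3[OF lin phi1_eq assms(2) r C])
  then show ?thesis using that by blast
qed

lemma higgs_classification_trivial:
  assumes \<phi>: "\<phi> \<in> higgs_fields b b 1" and nz: "nowhere_vanishing \<phi>"
  shows "(\<exists>s t u. s\<^sup>2 - 4 * t\<^sup>2 * u \<noteq> 0 \<and> conjugate_higgs b 1 \<phi> (phi1 s t u)) \<or>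
    (\<exists>u v. (u, v) \<noteq> (0, 0) \<and> conjugate_higgs b 1 \<phi> (phi3 0 u v))"
proof -
  obtain p q w where pqw: "p \<in> sections b b" "q \<in> sections b b" "w \<in> sections b b"
    and eq: "\<forall>z\<in>punctured_plane. \<phi> z = mat2 (p z) (q z) (w z) (- p z)"
    using \<phi> unfolding higgs_fields_iff[OF one_neq_zero b_nonzero] div_by_1 mult_1_right by blast
  note eq' = eq[rule_format]
  show ?thesis
  proof (cases "\<exists>e1 e2. (e1, e2) \<noteq> (0, 0) \<and>
      (\<forall>z\<in>punctured_plane. q z * e2\<^sup>2 + 2 * p z * e1 * e2 - w z * e1\<^sup>2 = 0)")
    case True
    then obtain e1 e2 where e: "(e1, e2) \<noteq> (0, 0)"
      "\<forall>z\<in>punctured_plane. q z * e2\<^sup>2 + 2 * p z * e1 * e2 - w z * e1\<^sup>2 = 0" by blast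
    obtain u v where "(u, v) \<noteq> (0, 0)" "conjugate_higgs b 1 \<phi> (phi3 0 u v)"
      by (rule common_eigenvector_conjugate_phi3[OF pqw eq' nz e(1) e(2)[rule_format]])
    then show ?thesis by blast
  next
    case False
    then have no: "\<exists>z\<in>punctured_plane. q z * e2\<^sup>2 + 2 * p z * e1 * e2 - w z * e1\<^sup>2 \<noteq> 0"
      if "(e1, e2) \<noteq> (0, 0)" for e1 e2
      using that by blast
    obtain s t u where c: "conjugate_higgs b 1 \<phi> (phi1 s t u)"
      by (rule no_common_eigenvector_conjugate_phi1[OF pqw eq' no])
    show ?thesis
    proof (cases "s\<^sup>2 - 4 * t\<^sup>2 * u = 0")
      case True
      obtain u' v' where "(u', v') \<noteq> (0, 0)" "conjugate_higgs b 1 (phi1 s t u) (phi3 0 u' v')"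
        by (rule phi1_degenerate_conjugate_phi3[OF True
              conjugate_higgs_nowhere_vanishing[OF one_neq_zero c nz]])
      then show ?thesis using conjugate_higgs_one_trans[OF c] by blast
    next
      case False
      then show ?thesis using c by blast
    qed
  qed
qed

text \<open>The entry \<open>- p z\<close> of the conjugating matrix clears the diagonal, and
  \<open>c\<close> rescales the lower entry to \<open>1\<close>. The remaining entry
  \<open>\<beta>\<close> is then minus the determinant of \<open>\<phi>\<close>.\<close>

lemma constant_lower_entry_conjugate_phi2:
  assumes p: "p \<in> sections b b" and q: "q \<in> sections b (b\<^sup>2)" and c: "c \<noteq> 0"
    and \<phi>: "\<And>z. z \<in> punctured_plane \<Longrightarrow> \<phi> z = mat2 (p z) (q z) c (- p z)"
  obtains \<beta> where "\<beta> \<in> sections b (b\<^sup>2)" "conjugate_higgs b (inverse b) \<phi> (phi2 \<beta>)"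
proof (rule that)
  define \<beta> where "\<beta> = (\<lambda>z. c * q z + (p z)\<^sup>2)"
  show "\<beta> \<in> sections b (b\<^sup>2)"
    unfolding \<beta>_def by (intro sections_add sections_cmult sections_power p q)
  have s: "(\<lambda>z. c) \<in> sections b 1" "(\<lambda>z. - p z) \<in> sections b (1 / inverse b)"
      "(\<lambda>z. 0) \<in> sections b (inverse b)" "(\<lambda>z. 1) \<in> sections b 1"
    using sections_minus[OF p] by (auto simp: sections_const sections_zero field_simps)
  have eq: "\<forall>z\<in>punctured_plane. c * 1 - - p z * 0 \<noteq> 0 \<and>
      phi2 \<beta> z ** mat2 c (- p z) 0 1 = mat2 c (- p z) 0 1 ** \<phi> z"
    using c by (simp add: phi2_eq \<phi> mat2_mult mat2_eq_iff \<beta>_def power2_eq_square)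
  have \<tau>: "inverse b \<noteq> 0" using b_nonzero by simp
  show "conjugate_higgs b (inverse b) \<phi> (phi2 \<beta>)"
    unfolding conjugate_higgs_iff[OF \<tau> b_nonzero]
    by (rule bexI[OF _ s(1)], rule bexI[OF _ s(2)], rule bexI[OF _ s(3)], rule bexI[OF _ s(4)], rule eq)
qed

lemma nonpositive_degree_iff:
  assumes "\<tau> \<noteq> 0"
  shows "line_degree b \<tau> \<le> 0 \<longleftrightarrow> 1 \<le> cmod \<tau>"
proof -
  have "ln (cmod b) < 0" using b by simp
  then show ?thesis using assms by (simp add: line_degree_def divide_le_0_iff)
qed

lemma higgs_classification:
  assumes "\<tau> \<noteq> 0" "line_degree b \<tau> \<le> 0" and \<phi>: "\<phi> \<in> higgs_fields b b \<tau>" and nz: "nowhere_vanishing \<phi>"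
  shows "(\<tau> = 1 \<and> (\<exists>s t u. s\<^sup>2 - 4 * t\<^sup>2 * u \<noteq> 0 \<and> conjugate_higgs b \<tau> \<phi> (phi1 s t u))) \<or>
    (\<tau> = inverse b \<and> (\<exists>\<beta>\<in>sections b (b\<^sup>2). conjugate_higgs b \<tau> \<phi> (phi2 \<beta>))) \<or>
    (\<exists>k u v. \<tau> = inverse b ^ k \<and> (u, v) \<noteq> (0, 0) \<and> conjugate_higgs b \<tau> \<phi> (phi3 k u v))"
proof (cases "\<tau> = 1")
  case True
  from higgs_classification_trivial[OF \<phi>[unfolded True] nz] show ?thesis
  proof
    assume "\<exists>s t u. s\<^sup>2 - 4 * t\<^sup>2 * u \<noteq> 0 \<and> conjugate_higgs b 1 \<phi> (phi1 s t u)"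
    then show ?thesis unfolding True by (intro disjI1 conjI refl)
  next
    assume "\<exists>u v. (u, v) \<noteq> (0, 0) \<and> conjugate_higgs b 1 \<phi> (phi3 0 u v)"
    then obtain u v where "(u, v) \<noteq> (0, 0)" "conjugate_higgs b 1 \<phi> (phi3 0 u v)" by blast
    then have "\<tau> = inverse b ^ 0 \<and> (u, v) \<noteq> (0, 0) \<and> conjugate_higgs b \<tau> \<phi> (phi3 0 u v)"
      by (simp only: True power_0) simp
    then show ?thesis by (intro disjI2 exI)
  qed
next
  case False
  have \<tau>: "1 \<le> cmod \<tau>" using assms(1,2) nonpositive_degree_iff by blast
  obtain p q w where p: "p \<in> sections b b" and q: "q \<in> sections b (b / \<tau>)" and w: "w \<in> sections b (b * \<tau>)"
    and eq: "\<forall>z\<in>punctured_plane. \<phi> z = mat2 (p z) (q z) (w z) (- p z)"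
    using \<phi> unfolding higgs_fields_iff[OF assms(1) b_nonzero] by blast
  show ?thesis
  proof (cases "\<forall>z\<in>punctured_plane. w z = 0")
    case w0: True
    have "\<exists>z\<in>punctured_plane. q z \<noteq> 0"
    proof (rule ccontr)
      assume "\<not> ?thesis"
      then have "p z \<noteq> 0" if "z \<in> punctured_plane" for z
        using nz eq w0 that by (auto simp: nowhere_vanishing_def mat2_eq_0_iff)
      from sections_nowhere_zero[OF p b_nonzero this] show False using b by simp
    qed
    then obtain z where z: "z \<in> punctured_plane" "q z \<noteq> 0" by blast
    have nz': "b / \<tau> \<noteq> 0" using b_nonzero assms(1) by simp
    obtain n where n: "b / \<tau> = b ^ n"
      by (rule sections_nonzero_imp_power[OF q nz' z])
    have "n \<noteq> 0"
    proof
      assume "n = 0"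
      then have "cmod \<tau> = cmod b" using n assms(1) by (simp add: field_simps)
      then show False using b \<tau> by simp
    qed
    then obtain k where k: "n = Suc k" using not0_implies_Suc by blast
    have \<tau>k: "\<tau> = inverse b ^ k"
      using n b_nonzero assms(1) unfolding k by (simp add: field_simps)
    have tri: "\<phi> z = mat2 (p z) (q z) 0 (- p z)" if "z \<in> punctured_plane" for z
      using eq w0 that by simp
    obtain u v where "(u, v) \<noteq> (0, 0)" "conjugate_higgs b (inverse b ^ k) \<phi> (phi3 k u v)"
      by (rule triangular_conjugate_phi3[OF p q[unfolded n k] tri nz])
    then show ?thesis unfolding \<tau>k by blast
  next
    case False
    then obtain z where z: "z \<in> punctured_plane" "w z \<noteq> 0" by blast
    have nz': "b * \<tau> \<noteq> 0" using b_nonzero assms(1) by simp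
    obtain m where m: "b * \<tau> = b ^ m"
      by (rule sections_nonzero_imp_power[OF w nz' z])
    \<comment> \<open>A positive \<open>m\<close> would give \<open>\<tau> = b ^ (m - 1)\<close>,
      which has modulus less than \<open>1\<close> unless \<open>\<tau> = 1\<close>; both are
      excluded here.\<close>
    have "m = 0"
    proof (rule ccontr)
      assume "m \<noteq> 0"
      then obtain l where l: "m = Suc l" using not0_implies_Suc by blast
      then have "\<tau> = b ^ l" using m b_nonzero by simp
      then have "cmod b ^ l \<ge> 1" using \<tau> by (simp add: norm_power)
      moreover have "l \<noteq> 0" using \<open>\<tau> = b ^ l\<close> \<open>\<tau> \<noteq> 1\<close> by (metis power_0)
      ultimately show False using b power_less_one_iff[of "cmod b" l] by simp
    qed
    then have \<tau>b: "\<tau> = inverse b" using m b_nonzero by (simp add: field_simps)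
    have "b * \<tau> = 1" "b / \<tau> = b\<^sup>2"
      using b_nonzero by (simp_all add: \<tau>b power2_eq_square divide_inverse)
    then have "w \<in> sections b 1" "q \<in> sections b (b\<^sup>2)"
      using w q by simp_all
    from sections_one_constant[OF this(1)] obtain c where c: "\<forall>z\<in>punctured_plane. w z = c" by blast
    have low: "\<phi> z = mat2 (p z) (q z) c (- p z)" if "z \<in> punctured_plane" for z
      using eq c that by simp
    have "c \<noteq> 0" using False c by auto
    obtain \<beta> where "\<beta> \<in> sections b (b\<^sup>2)" "conjugate_higgs b (inverse b) \<phi> (phi2 \<beta>)"
      by (rule constant_lower_entry_conjugate_phi2[OF p \<open>q \<in> sections b (b\<^sup>2)\<close> \<open>c \<noteq> 0\<close> low])
    then show ?thesis unfolding \<tau>b by blast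
  qed
qed

end

subsection \<open>Invariant sub-line bundles\<close>

text \<open>Near \<open>p\<close> some component \<open>\<sigma> z $ i\<close> is nonzero, and the
  only candidate for the factor is \<open>e z $ i / \<sigma> z $ i\<close>. It works in the other
  component too: \<open>a\<close> annihilates the cross terms and can be cancelled on the connected
  set \<open>U\<close>, even at its zeros.\<close>

lemma torsion_free_quotient_nowhere_zero:
  assumes hol: "\<And>i. (\<lambda>p. \<sigma> p $ i) holomorphic2_on punctured_plane"
    and nz: "\<And>p. p \<in> punctured_plane \<Longrightarrow> \<sigma> p \<noteq> 0"
  shows "torsion_free_quotient \<sigma>"
  unfolding torsion_free_quotient_def
proof (intro allI impI, elim conjE)
  fix p U a c e
  assume U: "open U" "connected U" "p \<in> U" "U \<subseteq> punctured_plane"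
    and a: "a holomorphic2_on U" and c: "c holomorphic2_on U" and e: "\<forall>i. (\<lambda>z. e z $ i) holomorphic2_on U"
    and "\<exists>z\<in>U. a z \<noteq> 0" and eq: "\<forall>z\<in>U. a z *s e z = c z *s \<sigma> z"
  then obtain z0 where z0: "z0 \<in> U" "a z0 \<noteq> 0" by blast
  have eq_i: "a z * e z $ i = c z * \<sigma> z $ i" if "z \<in> U" for z i
    using eq that by (metis vector_smult_component)
  have \<sigma>U: "(\<lambda>z. \<sigma> z $ i) holomorphic2_on U" for i
    by (rule holomorphic2_on_subset[OF hol U(4)])
  obtain i where i: "\<sigma> p $ i \<noteq> 0"
    using nz[of p] U(3,4) by (auto simp: vec_eq_iff)
  have cross: "e z $ j * \<sigma> z $ i - e z $ i * \<sigma> z $ j = 0" if "z \<in> U" for z j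
  proof (rule holomorphic2_on_mult_eq_0[OF U(1,2) a _ _ z0 that])
    show "(\<lambda>z. e z $ j * \<sigma> z $ i - e z $ i * \<sigma> z $ j) holomorphic2_on U"
      using e \<sigma>U by (intro holomorphic2_intros) auto
    fix z assume z: "z \<in> U"
    have "a z * (e z $ j * \<sigma> z $ i - e z $ i * \<sigma> z $ j) =
        (a z * e z $ j) * \<sigma> z $ i - (a z * e z $ i) * \<sigma> z $ j"
      by (simp add: algebra_simps)
    then show "a z * (e z $ j * \<sigma> z $ i - e z $ i * \<sigma> z $ j) = 0"
      by (simp add: eq_i[OF z])
  qed
  define V where "V = {z \<in> U. \<sigma> z $ i \<noteq> 0}"
  define d where "d = (\<lambda>z. e z $ i / \<sigma> z $ i)"
  have V: "V \<subseteq> U" by (auto simp: V_def)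
  have "open V"
    unfolding V_def by (rule holomorphic2_on_nonzero_open[OF U(1) \<sigma>U])
  moreover have "p \<in> V" using U(3) i by (simp add: V_def)
  moreover have "d holomorphic2_on V"
    unfolding d_def using holomorphic2_on_subset[OF _ V] e \<sigma>U
    by (intro holomorphic2_on_divide) (auto simp: V_def)
  moreover have "e z = d z *s \<sigma> z" if "z \<in> V" for z
    using cross[of z] that by (auto simp: vec_eq_iff V_def d_def field_simps)
  ultimately show "\<exists>V d. open V \<and> p \<in> V \<and> V \<subseteq> U \<and> d holomorphic2_on V \<and> (\<forall>z\<in>V. e z = d z *s \<sigma> z)"
    using V by blast
qed

text \<open>Since \<open>h\<close> times \<open>\<sigma>'\<close> is \<open>\<sigma>\<close>, the
  germ of \<open>\<sigma>'\<close> is torsion in the quotient. Torsion-freeness writes it as a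
  multiple of \<open>\<sigma>\<close>, which would vanish at a zero of \<open>h\<close>.\<close>

lemma torsion_free_quotient_cofactor:
  assumes tf: "torsion_free_quotient \<sigma>"
    and h: "h holomorphic2_on punctured_plane" "q \<in> punctured_plane" "h q \<noteq> 0"
    and \<sigma>': "\<And>i. (\<lambda>p. \<sigma>' p $ i) holomorphic2_on punctured_plane"
    and \<sigma>: "\<And>p. p \<in> punctured_plane \<Longrightarrow> \<sigma> p = h p *s \<sigma>' p"
    and p: "p \<in> punctured_plane" "\<sigma>' p \<noteq> 0"
  shows "h p \<noteq> 0"
proof
  assume 0: "h p = 0"
  have "\<exists>V d. open V \<and> p \<in> V \<and> V \<subseteq> punctured_plane \<and> d holomorphic2_on V \<and>
      (\<forall>z\<in>V. \<sigma>' z = d z *s \<sigma> z)"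
    using tf[unfolded torsion_free_quotient_def, rule_format, of punctured_plane p h "\<lambda>z. 1" \<sigma>']
      open_punctured_plane connected_punctured_plane h \<sigma>' \<sigma> p by auto
  then obtain d where "\<sigma>' p = d p *s \<sigma> p" by blast
  with \<sigma>[OF p(1)] 0 p(2) show False by simp
qed

context hopf
begin

lemma sub_line_bundleI:
  assumes "\<mu> \<noteq> 0" "s1 \<in> sections b (1 / \<mu>)" "s2 \<in> sections b (\<tau> / \<mu>)"
    and nz: "\<And>p. p \<in> punctured_plane \<Longrightarrow> s1 p \<noteq> 0 \<or> s2 p \<noteq> 0"
    and \<sigma>: "\<And>p. p \<in> punctured_plane \<Longrightarrow> \<sigma> p = vector [s1 p, s2 p]"
  shows "sub_line_bundle b \<tau> \<mu> \<sigma>"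
proof -
  have s: "\<forall>i. (\<lambda>p. \<sigma> p $ i) \<in> sections b (multipliers \<tau> $ i / \<mu>)"
    using sections_cong[OF assms(2) b_nonzero, of "\<lambda>p. \<sigma> p $ 1"]
      sections_cong[OF assms(3) b_nonzero, of "\<lambda>p. \<sigma> p $ 2"]
    by (simp add: forall_2 \<sigma>)
  have \<sigma>0: "\<sigma> p \<noteq> 0" if "p \<in> punctured_plane" for p
    using nz[OF that] by (auto simp: \<sigma>[OF that] vec_eq_iff forall_2)
  have "torsion_free_quotient \<sigma>"
    using s \<sigma>0 sections_holomorphic2 by (intro torsion_free_quotient_nowhere_zero) blast+
  moreover have "(1, 0) \<in> punctured_plane" by (simp add: punctured_plane_iff)
  ultimately show ?thesis
    unfolding sub_line_bundle_def using s \<sigma>0 assms(1) by blast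
qed

text \<open>A common factor \<open>h\<close> has no zeros because the quotient is torsion-free, so
  its bundle is trivial and \<open>h\<close> is constant. Thus a given nowhere zero direction has
  only one saturated generator up to constants, and its multiplier is forced.\<close>

lemma sub_line_bundle_cofactor:
  assumes sub: "sub_line_bundle b \<tau> \<mu> \<sigma>" and h: "h \<in> sections b \<nu>" "\<nu> \<noteq> 0"
    and s: "s1 holomorphic2_on punctured_plane" "s2 holomorphic2_on punctured_plane"
    and nz: "\<And>p. p \<in> punctured_plane \<Longrightarrow> s1 p \<noteq> 0 \<or> s2 p \<noteq> 0"
    and \<sigma>: "\<And>p. p \<in> punctured_plane \<Longrightarrow> \<sigma> p = h p *s vector [s1 p, s2 p]"
  shows "\<nu> = 1" "same_image \<sigma> (\<lambda>p. vector [s1 p, s2 p])"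
proof -
  obtain q where q: "q \<in> punctured_plane" "\<sigma> q \<noteq> 0"
    using sub unfolding sub_line_bundle_def by blast
  have hq: "h q \<noteq> 0"
  proof
    assume "h q = 0"
    then show False using q \<sigma>[OF q(1)] by simp
  qed
  have v: "(\<lambda>p. (vector [s1 p, s2 p] :: complex^2) $ i) holomorphic2_on punctured_plane" for i :: 2
    using exhaust_2[of i] s by auto
  have h0: "h p \<noteq> 0" if p: "p \<in> punctured_plane" for p
  proof (rule torsion_free_quotient_cofactor[OF _ sections_holomorphic2[OF h(1)] q(1) hq v \<sigma> p])
    show "torsion_free_quotient \<sigma>" using sub by (simp add: sub_line_bundle_def)
    show "(vector [s1 p, s2 p] :: complex^2) \<noteq> 0"
      using nz[OF p] by (auto simp: vec_eq_iff forall_2)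
  qed
  show \<nu>: "\<nu> = 1" by (rule sections_nowhere_zero[OF h h0])
  obtain c where c: "\<forall>p\<in>punctured_plane. h p = c"
    using sections_one_constant h(1) unfolding \<nu> by blast
  have "c \<noteq> 0" using c h0[OF q(1)] q(1) by auto
  then show "same_image \<sigma> (\<lambda>p. vector [s1 p, s2 p])"
    unfolding same_image_def using c \<sigma> by auto
qed

lemma sub_line_bundle_components:
  assumes "sub_line_bundle b \<tau> \<mu> \<sigma>"
  shows "\<mu> \<noteq> 0" "(\<lambda>p. \<sigma> p $ 1) \<in> sections b (1 / \<mu>)" "(\<lambda>p. \<sigma> p $ 2) \<in> sections b (\<tau> / \<mu>)"
  using assms by (auto simp: sub_line_bundle_def forall_2)

lemma vec2_eq_iff: "(x :: complex^2) = y \<longleftrightarrow> x $ 1 = y $ 1 \<and> x $ 2 = y $ 2"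
  by (simp add: vec_eq_iff forall_2)

text \<open>The two rows of the eigenvector equation give
  \<open>(a p)\<^sup>2 = (t p)\<^sup>2\<close> once the second component is cancelled. Connectedness
  makes one sign hold everywhere, and \<open>\<sigma> p\<close> is its second component times
  \<open>vector [a p, 1]\<close>.\<close>

lemma phi2_invariant_imp:
  assumes t: "t \<in> sections b b" and \<beta>: "\<And>p. p \<in> punctured_plane \<Longrightarrow> \<beta> p = (t p)\<^sup>2"
    and inv: "invariant_sub_line_bundle b b (inverse b) (phi2 \<beta>) \<mu> \<sigma>"
  shows "\<mu> = inverse b \<and>
    (same_image \<sigma> (\<lambda>p. vector [t p, 1]) \<or> same_image \<sigma> (\<lambda>p. vector [- t p, 1]))"
proof -
  have sub: "sub_line_bundle b (inverse b) \<mu> \<sigma>"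
    using inv by (simp add: invariant_sub_line_bundle_def)
  note s = sub_line_bundle_components[OF sub]
  note hol = sections_holomorphic2[OF s(2)] sections_holomorphic2[OF s(3)]
  obtain a where a: "a \<in> sections b b"
    "\<forall>p\<in>punctured_plane. phi2 \<beta> p *v \<sigma> p = a p *s \<sigma> p"
    using inv unfolding invariant_sub_line_bundle_def by blast
  have e: "(t p)\<^sup>2 * \<sigma> p $ 2 = a p * \<sigma> p $ 1" "\<sigma> p $ 1 = a p * \<sigma> p $ 2" if "p \<in> punctured_plane" for p
    using a(2)[rule_format, OF that]
    by (simp_all add: phi2_eq mat2_mult_vector vec2_eq_iff \<beta>[OF that])
  obtain q where q: "q \<in> punctured_plane" "\<sigma> q \<noteq> 0"
    using sub unfolding sub_line_bundle_def by blast
  then have q2: "\<sigma> q $ 2 \<noteq> 0"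
    using e(2)[OF q(1)] by (auto simp: vec2_eq_iff)
  have prod: "(a p - t p) * (a p + t p) = 0" if p: "p \<in> punctured_plane" for p
  proof (rule holomorphic2_on_mult_eq_0[OF open_punctured_plane connected_punctured_plane hol(2) _ _ q(1) q2 p])
    show "(\<lambda>p. (a p - t p) * (a p + t p)) holomorphic2_on punctured_plane"
      using a(1) t by (intro holomorphic2_intros sections_holomorphic2)
    fix p assume "p \<in> punctured_plane"
    from e[OF this] show "\<sigma> p $ 2 * ((a p - t p) * (a p + t p)) = 0" by algebra
  qed
  have main: "\<mu> = inverse b \<and> same_image \<sigma> (\<lambda>p. vector [r p, 1])"
    if r: "r \<in> sections b b" and ar: "\<forall>p\<in>punctured_plane. a p = r p" for r
  proof -
    have eq: "\<sigma> p = \<sigma> p $ 2 *s vector [r p, 1]" if "p \<in> punctured_plane" for p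
      using e(2)[OF that] ar that by (simp add: vec2_eq_iff mult.commute)
    have nz: "inverse b / \<mu> \<noteq> 0" "r p \<noteq> 0 \<or> 1 \<noteq> (0 :: complex)" for p
      using b_nonzero s(1) by simp_all
    note * = sub_line_bundle_cofactor[OF sub s(3) nz(1) sections_holomorphic2[OF r]
        holomorphic2_on_const nz(2) eq]
    have "inverse b / \<mu> = 1" "same_image \<sigma> (\<lambda>p. vector [r p, 1])" by (rule *; assumption)+
    then show ?thesis using s(1) b_nonzero by (simp add: field_simps)
  qed
  show ?thesis
  proof (cases "\<forall>p\<in>punctured_plane. a p - t p = 0")
    case True
    then show ?thesis using main[OF t] by simp
  next
    case False
    then obtain z where z: "z \<in> punctured_plane" "a z - t z \<noteq> 0" by blast
    have hol: "(\<lambda>p. a p - t p) holomorphic2_on punctured_plane" "(\<lambda>p. a p + t p) holomorphic2_on punctured_plane"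
      by (intro holomorphic2_on_diff holomorphic2_on_add sections_holomorphic2[OF a(1)]
            sections_holomorphic2[OF t])+
    have "a p + t p = 0" if p: "p \<in> punctured_plane" for p
      by (rule holomorphic2_on_mult_eq_0[where f = "\<lambda>p. a p - t p", OF open_punctured_plane
            connected_punctured_plane hol prod z p])
    then have "\<forall>p\<in>punctured_plane. a p = - t p" by (simp add: add_eq_0_iff2)
    then show ?thesis using main[OF sections_minus[OF t]] by simp
  qed
qed

lemma phi2_invariantI:
  assumes r: "r \<in> sections b b" and \<beta>: "\<And>p. p \<in> punctured_plane \<Longrightarrow> \<beta> p = (r p)\<^sup>2"
    and \<sigma>: "same_image \<sigma> (\<lambda>p. vector [r p, 1])"
  shows "invariant_sub_line_bundle b b (inverse b) (phi2 \<beta>) (inverse b) \<sigma>"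
proof -
  obtain c where c: "c \<noteq> 0" "\<forall>p\<in>punctured_plane. \<sigma> p = c *s vector [r p, 1]"
    using \<sigma> unfolding same_image_def by blast
  have "sub_line_bundle b (inverse b) (inverse b) \<sigma>"
  proof (rule sub_line_bundleI)
    show "(\<lambda>p. c * r p) \<in> sections b (1 / inverse b)"
      using sections_cmult[OF r, of c] by (simp add: divide_inverse)
    show "(\<lambda>p. c) \<in> sections b (inverse b / inverse b)"
      using b_nonzero by (simp add: sections_const)
  qed (use c b_nonzero in \<open>auto simp: vec2_eq_iff\<close>)
  moreover have "\<forall>p\<in>punctured_plane. phi2 \<beta> p *v \<sigma> p = r p *s \<sigma> p"
    using c(2) \<beta> by (simp add: phi2_eq mat2_mult_vector vec2_eq_iff power2_eq_square)
  ultimately show ?thesis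
    unfolding invariant_sub_line_bundle_def using r by blast
qed

text \<open>If the second component is not identically zero, the second row forces the eigenvalue
  \<open>- l p\<close>, and the first row becomes
  \<open>2 * l p * \<sigma> p $ 1 + w p * \<sigma> p $ 2 = 0\<close>. As \<open>l\<close> and
  \<open>w\<close> have no common zero, \<open>l\<close> divides the second component, and the
  quotient gives the common factor to be removed.\<close>

lemma phi3_invariant_imp:
  assumes uv: "(u, v) \<noteq> (0, 0)"
    and inv: "invariant_sub_line_bundle b b (inverse b ^ k) (phi3 k u v) \<mu> \<sigma>"
  shows "\<mu> = 1 \<and> same_image \<sigma> (\<lambda>p. vector [1, 0]) \<or>
    \<mu> = inverse b ^ (1 + k) \<and>
    same_image \<sigma> (\<lambda>p. vector [(cnj v * fst p - cnj u * snd p) ^ (1 + k), - 2 * (u * fst p + v * snd p)])"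
proof -
  define l where "l = (\<lambda>p. u * fst p + v * snd p)"
  define w where "w = (\<lambda>p. (cnj v * fst p - cnj u * snd p) ^ (1 + k))"
  have phi3: "phi3 k u v p = mat2 (l p) (w p) 0 (- l p)" for p
    by (simp only: phi3_eq l_def w_def)
  have lw: "l p \<noteq> 0 \<or> w p \<noteq> 0" if "p \<in> punctured_plane" for p
    using conj_coordinates_punctured[OF uv that] by (auto simp: l_def w_def)
  have \<tau>: "inverse b ^ k \<noteq> 0" using b_nonzero by simp
  have sub: "sub_line_bundle b (inverse b ^ k) \<mu> \<sigma>"
    using inv by (simp add: invariant_sub_line_bundle_def)
  note s = sub_line_bundle_components[OF sub]
  note hol = sections_holomorphic2[OF s(2)] sections_holomorphic2[OF s(3)]
  have holl: "l holomorphic2_on punctured_plane" and holw: "w holomorphic2_on punctured_plane"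
    unfolding l_def w_def by (intro holomorphic2_intros)+
  obtain a where a: "a \<in> sections b b"
    "\<forall>p\<in>punctured_plane. phi3 k u v p *v \<sigma> p = a p *s \<sigma> p"
    using inv unfolding invariant_sub_line_bundle_def by blast
  have e: "l p * \<sigma> p $ 1 + w p * \<sigma> p $ 2 = a p * \<sigma> p $ 1" "- l p * \<sigma> p $ 2 = a p * \<sigma> p $ 2"
    if "p \<in> punctured_plane" for p
    using a(2)[rule_format, OF that]
    by (simp_all add: phi3 mat2_mult_vector vec2_eq_iff)
  show ?thesis
  proof (cases "\<forall>p\<in>punctured_plane. \<sigma> p $ 2 = 0")
    case True
    have eq: "\<sigma> p = \<sigma> p $ 1 *s vector [1, 0]" if "p \<in> punctured_plane" for p
      using True that by (simp add: vec2_eq_iff)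
    have nz: "1 / \<mu> \<noteq> 0" "1 \<noteq> (0 :: complex) \<or> 0 \<noteq> (0 :: complex)" using s(1) by simp_all
    note * = sub_line_bundle_cofactor[OF sub s(2) nz(1) holomorphic2_on_const holomorphic2_on_const nz(2) eq]
    have "1 / \<mu> = 1" "same_image \<sigma> (\<lambda>p. vector [1, 0])" by (rule *; assumption)+
    then show ?thesis using s(1) by (simp add: field_simps)
  next
    case False
    then obtain q where q: "q \<in> punctured_plane" "\<sigma> q $ 2 \<noteq> 0" by blast
    have "a p + l p = 0" if p: "p \<in> punctured_plane" for p
    proof (rule holomorphic2_on_mult_eq_0[OF open_punctured_plane connected_punctured_plane hol(2) _ _ q p])
      show "(\<lambda>p. a p + l p) holomorphic2_on punctured_plane"
        by (intro holomorphic2_on_add sections_holomorphic2[OF a(1)] holl)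
      fix p assume "p \<in> punctured_plane"
      from e(2)[OF this] show "\<sigma> p $ 2 * (a p + l p) = 0" by algebra
    qed
    then have al: "a p = - l p" if "p \<in> punctured_plane" for p
      using that by (simp add: eq_neg_iff_add_eq_0)
    have e': "2 * l p * \<sigma> p $ 1 + w p * \<sigma> p $ 2 = 0" if "p \<in> punctured_plane" for p
      using e(1)[OF that] al[OF that] by algebra
    have p0: "(v, - u) \<in> punctured_plane" using uv by (auto simp: punctured_plane_iff)
    have "l (v, - u) = 0" by (simp add: l_def)
    then have \<sigma>0: "\<sigma> (v, - u) $ 2 = 0"
      using e'[OF p0] lw[OF p0] by simp
    have nz: "inverse b ^ k / \<mu> \<noteq> 0" using \<tau> s(1) by simp
    obtain n where n: "inverse b ^ k / \<mu> = b ^ n"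
      by (rule sections_nonzero_imp_power[OF s(3) nz q])
    \<comment> \<open>Division by a linear form needs positive degree; in degree \<open>0\<close>
      the component would be constant, and its zero at \<open>(v, - u)\<close> contradicts the
      choice of \<open>q\<close>.\<close>
    have "n \<noteq> 0"
    proof
      assume "n = 0"
      then obtain c where "\<forall>p\<in>punctured_plane. \<sigma> p $ 2 = c"
        using sections_one_constant[of "\<lambda>p. \<sigma> p $ 2"] s(3) n by auto
      then show False using \<sigma>0 q p0 by auto
    qed
    then obtain m where m: "n = Suc m" using not0_implies_Suc by blast
    obtain c where c: "c \<in> sections b (b ^ m)" "\<And>p. p \<in> punctured_plane \<Longrightarrow> \<sigma> p $ 2 = l p * c p"
      using sections_divisible_linear[OF s(3)[unfolded n m] \<sigma>0 uv] unfolding l_def by blast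
    \<comment> \<open>\<open>h\<close> is normalized so that the second component is
      \<open>h p * (- 2 * l p)\<close>; cancelling \<open>l\<close> in \<open>e'\<close> then gives
      \<open>h p * w p\<close> for the first.\<close>
    define h where "h = (\<lambda>p. - (1 / 2) * c p)"
    have h: "h \<in> sections b (b ^ m)" unfolding h_def by (rule sections_cmult[OF c(1)])
    have \<sigma>2: "\<sigma> p $ 2 = h p * (- 2 * l p)" if "p \<in> punctured_plane" for p
      using c(2)[OF that] by (simp add: h_def)
    have lq: "l q \<noteq> 0" using \<sigma>2[OF q(1)] q(2) by auto
    have \<sigma>1: "\<sigma> p $ 1 - h p * w p = 0" if p: "p \<in> punctured_plane" for p
    proof (rule holomorphic2_on_mult_eq_0[OF open_punctured_plane connected_punctured_plane holl _ _ q(1) lq p])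
      show "(\<lambda>p. \<sigma> p $ 1 - h p * w p) holomorphic2_on punctured_plane"
        by (intro holomorphic2_on_diff holomorphic2_on_mult hol(1) sections_holomorphic2[OF h] holw)
      fix p assume p: "p \<in> punctured_plane"
      have "2 * (l p * (\<sigma> p $ 1 - h p * w p)) = 0"
        using e'[OF p] \<sigma>2[OF p] by algebra
      then show "l p * (\<sigma> p $ 1 - h p * w p) = 0" by simp
    qed
    have eq: "\<sigma> p = h p *s vector [w p, - 2 * l p]" if "p \<in> punctured_plane" for p
      using \<sigma>1[OF that] \<sigma>2[OF that] by (simp add: vec2_eq_iff)
    have bm: "b ^ m \<noteq> 0" using b_nonzero by simp
    have nz: "w p \<noteq> 0 \<or> - 2 * l p \<noteq> 0" if "p \<in> punctured_plane" for p
      using lw[OF that] by auto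
    note * = sub_line_bundle_cofactor[OF sub h bm holw holomorphic2_on_cmult[OF holl, of "-2"] nz eq]
    have "b ^ m = 1" and same: "same_image \<sigma> (\<lambda>p. vector [w p, - 2 * l p])" by (rule *; assumption)+
    then have "inverse b ^ k / \<mu> = b" using n m by simp
    then have "\<mu> = inverse b ^ (1 + k)" using s(1) b_nonzero by (simp add: field_simps)
    with same show ?thesis unfolding l_def w_def by blast
  qed
qed

lemma phi3_invariant_first_summand:
  assumes "same_image \<sigma> (\<lambda>p. vector [1, 0])"
  shows "invariant_sub_line_bundle b b (inverse b ^ k) (phi3 k u v) 1 \<sigma>"
proof -
  obtain c where c: "c \<noteq> 0" "\<forall>p\<in>punctured_plane. \<sigma> p = c *s vector [1, 0]"
    using assms unfolding same_image_def by blast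
  have sub: "sub_line_bundle b (inverse b ^ k) 1 \<sigma>"
    by (rule sub_line_bundleI[of _ "\<lambda>p. c" "\<lambda>p. 0"])
       (use c in \<open>auto simp: sections_const sections_zero vec2_eq_iff\<close>)
  have eq: "\<forall>p\<in>punctured_plane. phi3 k u v p *v \<sigma> p = (u * fst p + v * snd p) *s \<sigma> p"
    using c(2) by (simp add: phi3_eq mat2_mult_vector vec2_eq_iff algebra_simps)
  show ?thesis
    unfolding invariant_sub_line_bundle_def
    by (rule conjI, rule sub, rule bexI[of _ "\<lambda>p. u * fst p + v * snd p"], rule eq, rule sections_linear)
qed

text \<open>The matrix with rows \<open>(l, w)\<close> and \<open>(0, - l)\<close> sends
  \<open>(w, - 2 * l)\<close> to \<open>- l\<close> times itself, and this vector has no zeros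
  because \<open>l\<close> and \<open>w\<close> do not vanish together.\<close>

lemma phi3_invariant_second:
  assumes uv: "(u, v) \<noteq> (0, 0)"
    and "same_image \<sigma> (\<lambda>p. vector [(cnj v * fst p - cnj u * snd p) ^ (1 + k), - 2 * (u * fst p + v * snd p)])"
  shows "invariant_sub_line_bundle b b (inverse b ^ k) (phi3 k u v) (inverse b ^ (1 + k)) \<sigma>"
proof -
  define l where "l = (\<lambda>p. u * fst p + v * snd p)"
  define w where "w = (\<lambda>p. (cnj v * fst p - cnj u * snd p) ^ (1 + k))"
  have phi3: "phi3 k u v p = mat2 (l p) (w p) 0 (- l p)" for p
    by (simp only: phi3_eq l_def w_def)
  have lw: "l p \<noteq> 0 \<or> w p \<noteq> 0" if "p \<in> punctured_plane" for p
    using conj_coordinates_punctured[OF uv that] by (auto simp: l_def w_def)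
  have l: "l \<in> sections b b" and w: "w \<in> sections b (b ^ (1 + k))"
    unfolding l_def w_def by (rule sections_linear, rule sections_power[OF sections_linear'])
  obtain c where c: "c \<noteq> 0" "\<forall>p\<in>punctured_plane. \<sigma> p = c *s vector [w p, - 2 * l p]"
    using assms(2) unfolding same_image_def l_def w_def by blast
  have sub: "sub_line_bundle b (inverse b ^ k) (inverse b ^ (1 + k)) \<sigma>"
  proof (rule sub_line_bundleI)
    have "1 / inverse b ^ (1 + k) = b ^ (1 + k)" by (simp add: field_simps)
    then show "(\<lambda>p. c * w p) \<in> sections b (1 / inverse b ^ (1 + k))"
      by (simp only: sections_cmult[OF w])
    have "inverse b ^ k / inverse b ^ (1 + k) = b" using b_nonzero by (simp add: field_simps)
    then show "(\<lambda>p. c * (- 2 * l p)) \<in> sections b (inverse b ^ k / inverse b ^ (1 + k))"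
      by (simp only: sections_cmult[OF sections_cmult[OF l]])
    show "c * w p \<noteq> 0 \<or> c * (- 2 * l p) \<noteq> 0" if "p \<in> punctured_plane" for p
      using lw[OF that] c(1) by auto
  qed (use c b_nonzero in \<open>auto simp: vec2_eq_iff\<close>)
  have eq: "\<forall>p\<in>punctured_plane. phi3 k u v p *v \<sigma> p = - l p *s \<sigma> p"
    using c(2) by (simp add: phi3 mat2_mult_vector vec2_eq_iff algebra_simps)
  show ?thesis
    unfolding invariant_sub_line_bundle_def
    by (rule conjI, rule sub, rule bexI[of _ "\<lambda>p. - l p"], rule eq, rule sections_minus[OF l])
qed

end

subsection \<open>Irreducibility of the spectral curve\<close>

definition qform :: "complex \<Rightarrow> complex \<Rightarrow> complex \<Rightarrow> complex \<times> complex \<Rightarrow> complex" where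
  "qform \<alpha> \<beta> \<gamma> p = \<alpha> * (fst p)\<^sup>2 + \<beta> * fst p * snd p + \<gamma> * (snd p)\<^sup>2"

text \<open>The determinant of the two factors is a square root of the discriminant, so a nonzero
  discriminant makes them independent.\<close>

lemma qform_factorization:
  assumes "\<beta>\<^sup>2 - 4 * \<alpha> * \<gamma> \<noteq> 0"
  obtains a1 b1 a2 b2 where "a1 * b2 - a2 * b1 \<noteq> 0"
    "\<forall>p. qform \<alpha> \<beta> \<gamma> p = (a1 * fst p + b1 * snd p) * (a2 * fst p + b2 * snd p)"
proof (cases "\<alpha> = 0")
  case True
  then have "\<beta> \<noteq> 0" using assms by simp
  then show ?thesis
    using True by (intro that[of 0 \<gamma> \<beta> 1]) (simp_all add: qform_def algebra_simps power2_eq_square)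
next
  case False
  define d where "d = csqrt (\<beta>\<^sup>2 - 4 * \<alpha> * \<gamma>)"
  have d2: "d\<^sup>2 = \<beta>\<^sup>2 - 4 * \<alpha> * \<gamma>" by (simp add: d_def)
  have d: "d \<noteq> 0" using assms by (auto simp: d_def)
  \<comment> \<open>By Vieta \<open>\<alpha> * \<sigma>\<close> and \<open>\<rho>\<close> have sum
    \<open>\<beta>\<close> and product \<open>\<alpha> * \<gamma>\<close>; their difference is
    \<open>d\<close>.\<close>
  define \<rho> where "\<rho> = (\<beta> - d) / 2"
  define \<sigma> where "\<sigma> = (\<beta> + d) / (2 * \<alpha>)"
  have "(\<beta> - d) * (\<beta> + d) = 4 * \<alpha> * \<gamma>"
    using d2 by (simp add: algebra_simps power2_eq_square)
  then have prod: "\<rho> * \<sigma> = \<gamma>"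
    using False by (simp add: \<rho>_def \<sigma>_def field_simps)
  have sum: "\<alpha> * \<sigma> + \<rho> = \<beta>" "\<alpha> * \<sigma> - \<rho> = d"
    using False by (simp_all add: \<rho>_def \<sigma>_def field_simps)
  show ?thesis
  proof (rule that[of \<alpha> \<sigma> 1 \<rho>])
    show "\<alpha> * \<sigma> - 1 * \<rho> \<noteq> 0" using d sum(2) by simp
    show "\<forall>p. qform \<alpha> \<beta> \<gamma> p = (\<alpha> * fst p + \<rho> * snd p) * (1 * fst p + \<sigma> * snd p)"
      unfolding qform_def prod[symmetric] sum(1)[symmetric]
      by (simp add: algebra_simps power2_eq_square)
  qed
qed

text \<open>
  A nondegenerate quadratic cone minus its vertex is the image of the punctured plane under
  \<open>(\<xi>, \<eta>) \<mapsto> (\<xi>\<^sup>2, \<eta>\<^sup>2, \<xi> \<eta>)\<close>, in coordinates in which the form is a product.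
\<close>

lemma qform_parametrization:
  assumes "\<beta>\<^sup>2 - 4 * \<alpha> * \<gamma> \<noteq> 0"
  obtains m11 m12 m21 m22 where "m11 * m22 - m12 * m21 \<noteq> 0"
    "\<forall>x y. qform \<alpha> \<beta> \<gamma> (m11 * x + m12 * y, m21 * x + m22 * y) = x * y"
    "\<forall>p. \<exists>x y. p = (m11 * x + m12 * y, m21 * x + m22 * y)"
proof -
  obtain a1 b1 a2 b2 where D: "a1 * b2 - a2 * b1 \<noteq> 0"
    and fac: "\<forall>p. qform \<alpha> \<beta> \<gamma> p = (a1 * fst p + b1 * snd p) * (a2 * fst p + b2 * snd p)"
    by (rule qform_factorization[OF assms])
  define D where "D = a1 * b2 - a2 * b1"
  have D0: "D \<noteq> 0" using D by (simp add: D_def)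
  have inv: "a1 * (b2 / D * x + - b1 / D * y) + b1 * (- a2 / D * x + a1 / D * y) = x"
    "a2 * (b2 / D * x + - b1 / D * y) + b2 * (- a2 / D * x + a1 / D * y) = y"
    "b2 / D * (a1 * x + b1 * y) + - b1 / D * (a2 * x + b2 * y) = x"
    "- a2 / D * (a1 * x + b1 * y) + a1 / D * (a2 * x + b2 * y) = y" for x y
    using D0 by (simp_all add: field_simps) (simp_all add: D_def algebra_simps)
  show ?thesis
  proof (rule that[of "b2 / D" "a1 / D" "- b1 / D" "- a2 / D"])
    have "b2 / D * (a1 / D) - - b1 / D * (- a2 / D) = D / (D * D)"
      by (simp add: D_def diff_divide_distrib mult.commute)
    then show "b2 / D * (a1 / D) - - b1 / D * (- a2 / D) \<noteq> 0" using D0 by simp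
    show "\<forall>x y. qform \<alpha> \<beta> \<gamma> (b2 / D * x + - b1 / D * y, - a2 / D * x + a1 / D * y) = x * y"
      unfolding fac[rule_format] fst_conv snd_conv inv by blast
    show "\<forall>p. \<exists>x y. p = (b2 / D * x + - b1 / D * y, - a2 / D * x + a1 / D * y)"
    proof
      show "\<exists>x y. p = (b2 / D * x + - b1 / D * y, - a2 / D * x + a1 / D * y)" for p
        by (rule exI[of _ "a1 * fst p + b1 * snd p"], rule exI[of _ "a2 * fst p + b2 * snd p"])
           (simp only: inv prod.collapse)
    qed
  qed
qed

lemma holomorphic3_on_quadric: "(\<lambda>((x, y), v). v\<^sup>2 - qform \<alpha> \<beta> \<gamma> (x, y)) holomorphic3_on U"
proof (rule holomorphic3_onI[where ?c1.0 = "\<lambda>p. - (2 * \<alpha> * fst (fst p) + \<beta> * snd (fst p))" and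
      ?c2.0 = "\<lambda>p. - (\<beta> * fst (fst p) + 2 * \<gamma> * snd (fst p))" and ?c3.0 = "\<lambda>p. 2 * snd p"])
  fix p
  have "((\<lambda>p. (snd p)\<^sup>2 - (\<alpha> * (fst (fst p))\<^sup>2 + \<beta> * fst (fst p) * snd (fst p) + \<gamma> * (snd (fst p))\<^sup>2))
    has_derivative
      (\<lambda>h. - (2 * \<alpha> * fst (fst p) + \<beta> * snd (fst p)) * fst (fst h) +
           - (\<beta> * fst (fst p) + 2 * \<gamma> * snd (fst p)) * snd (fst h) + 2 * snd p * snd h)) (at p)"
    by (auto intro!: derivative_eq_intros simp: algebra_simps)
  then show "((\<lambda>((x, y), v). v\<^sup>2 - qform \<alpha> \<beta> \<gamma> (x, y)) has_derivative
      (\<lambda>h. - (2 * \<alpha> * fst (fst p) + \<beta> * snd (fst p)) * fst (fst h) +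
           - (\<beta> * fst (fst p) + 2 * \<gamma> * snd (fst p)) * snd (fst h) + 2 * snd p * snd h)) (at p)"
    by (simp add: case_prod_unfold qform_def)
qed

lemma open_total_domain: "open (punctured_plane \<times> (UNIV :: complex set))"
  by (intro open_Times open_punctured_plane open_UNIV)

text \<open>The preimages of the two analytic pieces are analytic, and one of them has interior points.\<close>

lemma parametrized_analytic_irreducible:
  assumes hol: "A holomorphic2_on punctured_plane" "B holomorphic2_on punctured_plane"
      "C holomorphic2_on punctured_plane"
    and AB: "\<And>p. p \<in> punctured_plane \<Longrightarrow> (A p, B p) \<in> punctured_plane"
    and an1: "analytic_subset (punctured_plane \<times> UNIV) A1"
    and an2: "analytic_subset (punctured_plane \<times> UNIV) A2"
    and cover: "\<And>p. p \<in> punctured_plane \<Longrightarrow> ((A p, B p), C p) \<in> A1 \<union> A2"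
  shows "(\<forall>p\<in>punctured_plane. ((A p, B p), C p) \<in> A1) \<or> (\<forall>p\<in>punctured_plane. ((A p, B p), C p) \<in> A2)"
proof -
  define \<Phi> where "\<Phi> = (\<lambda>p. ((A p, B p), C p))"
  have cont: "continuous_on punctured_plane \<Phi>"
    unfolding \<Phi>_def using hol by (intro continuous_on_Pair holomorphic2_on_imp_continuous_on)
  \<comment> \<open>On a ball that \<open>\<Phi>\<close> maps into \<open>U\<close>, the local
    equations of \<open>S\<close> compose with \<open>\<Phi>\<close> to local equations of the
    preimage, the form in which the identity principle is stated.\<close>
  have loc: "\<exists>r G. 0 < r \<and> ball p r \<subseteq> punctured_plane \<and> (\<forall>g\<in>G. g holomorphic2_on ball p r) \<and>
      \<Phi> -` S \<inter> ball p r = {z \<in> ball p r. \<forall>g\<in>G. g z = 0}"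
    if an: "analytic_subset (punctured_plane \<times> UNIV) S" and p: "p \<in> punctured_plane" for S p
  proof -
    have "\<Phi> p \<in> punctured_plane \<times> UNIV" using AB[OF p] by (simp add: \<Phi>_def)
    then have "\<exists>U G. open U \<and> \<Phi> p \<in> U \<and> U \<subseteq> punctured_plane \<times> UNIV \<and> finite G \<and>
        (\<forall>g\<in>G. g holomorphic3_on U) \<and> S \<inter> U = {z \<in> U. \<forall>g\<in>G. g z = 0}"
      by (rule bspec[OF conjunct2[OF an[unfolded analytic_subset_def]]])
    then obtain U G where U: "open U" "\<Phi> p \<in> U"
      and G: "\<forall>g\<in>G. g holomorphic3_on U" "S \<inter> U = {z \<in> U. \<forall>g\<in>G. g z = 0}"
      by (elim exE conjE)
    have O: "open (punctured_plane \<inter> \<Phi> -` U)"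
      by (rule continuous_open_preimage[OF cont open_punctured_plane U(1)])
    have "p \<in> punctured_plane \<inter> \<Phi> -` U" using p U(2) by simp
    with O obtain r where r: "0 < r" "ball p r \<subseteq> punctured_plane \<inter> \<Phi> -` U"
      by (rule openE)
    have "(\<lambda>z. g (\<Phi> z)) holomorphic2_on ball p r" if "g \<in> G" for g
      unfolding \<Phi>_def
    proof (rule holomorphic3_on_compose)
      show "g holomorphic3_on U" using G(1) that by blast
      show "((A z, B z), C z) \<in> U" if "z \<in> ball p r" for z
        using that r(2) by (auto simp: \<Phi>_def)
    qed (use hol holomorphic2_on_subset r(2) in blast)+
    then have 1: "\<forall>g\<in>(\<lambda>g z. g (\<Phi> z)) ` G. g holomorphic2_on ball p r" by blast
    have 2: "\<Phi> -` S \<inter> ball p r = {z \<in> ball p r. \<forall>g\<in>(\<lambda>g z. g (\<Phi> z)) ` G. g z = 0}"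
    proof -
      have *: "z \<in> \<Phi> -` S \<longleftrightarrow> (\<forall>g\<in>G. g (\<Phi> z) = 0)" if "z \<in> ball p r" for z
      proof -
        have "\<Phi> z \<in> U" using subsetD[OF r(2) that] by simp
        moreover have "\<Phi> z \<in> S \<inter> U \<longleftrightarrow> \<Phi> z \<in> U \<and> (\<forall>g\<in>G. g (\<Phi> z) = 0)"
          unfolding G(2) by (rule mem_Collect_eq)
        ultimately show ?thesis by simp
      qed
      show ?thesis
      proof (rule set_eqI)
        show "z \<in> \<Phi> -` S \<inter> ball p r \<longleftrightarrow>
            z \<in> {z \<in> ball p r. \<forall>g\<in>(\<lambda>g z. g (\<Phi> z)) ` G. g z = 0}" for z
          by (cases "z \<in> ball p r") (simp_all add: * del: mem_ball vimage_eq)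
      qed
    qed
    have 3: "ball p r \<subseteq> punctured_plane" using r(2) by blast
    show ?thesis
      by (rule exI[of _ r], rule exI[of _ "(\<lambda>g z. g (\<Phi> z)) ` G"],
          rule conjI[OF r(1) conjI[OF 3 conjI[OF 1 2]]])
  qed
  show ?thesis
  proof (cases "\<forall>p\<in>punctured_plane. \<Phi> p \<in> A1")
    case True
    then show ?thesis by (simp add: \<Phi>_def)
  next
    case False
    then obtain q where q: "q \<in> punctured_plane" "\<Phi> q \<notin> A1" by blast
    obtain r G where r: "0 < r" "ball q r \<subseteq> punctured_plane" "\<forall>g\<in>G. g holomorphic2_on ball q r"
      and eq: "\<Phi> -` A1 \<inter> ball q r = {z \<in> ball q r. \<forall>g\<in>G. g z = 0}"
      using loc[OF an1 q(1)] by (elim exE conjE)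
    have "q \<in> ball q r" using r(1) by simp
    moreover have "q \<notin> \<Phi> -` A1 \<inter> ball q r" using q(2) by simp
    ultimately obtain g where g: "g \<in> G" "g q \<noteq> 0" unfolding eq by blast
    \<comment> \<open>The local equation \<open>g\<close> of the preimage of \<open>A1\<close> is
      nonzero at \<open>q\<close>; the open set where it stays nonzero avoids that preimage and
      hence lies in the preimage of \<open>A2\<close>.\<close>
    define O' where "O' = {z \<in> ball q r. g z \<noteq> 0}"
    have "punctured_plane \<subseteq> \<Phi> -` A2"
    proof (rule locally_analytic_eq_domain[OF open_punctured_plane connected_punctured_plane])
      show "open O'"
        unfolding O'_def using r(3) g(1) by (intro holomorphic2_on_nonzero_open) auto
      show "O' \<noteq> {}" using \<open>q \<in> ball q r\<close> g(2) unfolding O'_def by blast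
      show "O' \<subseteq> \<Phi> -` A2 \<inter> punctured_plane"
      proof
        fix z assume "z \<in> O'"
        then have z: "z \<in> ball q r" "g z \<noteq> 0" unfolding O'_def by blast+
        have zp: "z \<in> punctured_plane" by (rule subsetD[OF r(2) z(1)])
        have "z \<notin> \<Phi> -` A1 \<inter> ball q r" unfolding eq using g(1) z by blast
        then have "\<Phi> z \<notin> A1" using z(1) by blast
        then show "z \<in> \<Phi> -` A2 \<inter> punctured_plane" using cover[OF zp] zp by (simp add: \<Phi>_def)
      qed
    qed (rule loc[OF an2])
    then show ?thesis unfolding \<Phi>_def by blast
  qed
qed

context hopf
begin

section \<open>The quotient total space and the spectral curve\<close>

lemma total_rel_iff:
  "(x, y) \<in> total_rel b \<nu> \<longleftrightarrow>
    fst x \<in> punctured_plane \<and> (\<exists>n. y = (hopf_map (b powi n) (fst x), \<nu> powi n * snd x))"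
  by (simp add: total_rel_def case_prod_unfold prod_eq_iff)

lemma hopf_map_power_punctured: "p \<in> punctured_plane \<Longrightarrow> hopf_map (b powi n) p \<in> punctured_plane"
  using b_nonzero by (auto simp: hopf_map_def case_prod_unfold punctured_plane_iff)

lemma equiv_total_rel:
  assumes "\<nu> \<noteq> 0"
  shows "equiv (punctured_plane \<times> UNIV) (total_rel b \<nu>)"
proof (rule equivI)
  show "total_rel b \<nu> \<subseteq> (punctured_plane \<times> UNIV) \<times> punctured_plane \<times> UNIV"
  proof (rule subrelI)
    fix x y assume "(x, y) \<in> total_rel b \<nu>"
    then obtain n where x: "fst x \<in> punctured_plane" and y: "y = (hopf_map (b powi n) (fst x), \<nu> powi n * snd x)"
      unfolding total_rel_iff by blast
    show "(x, y) \<in> (punctured_plane \<times> UNIV) \<times> punctured_plane \<times> UNIV"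
      using x hopf_map_power_punctured[OF x] by (simp add: y mem_Times_iff)
  qed
  show "refl_on (punctured_plane \<times> UNIV) (total_rel b \<nu>)"
  proof (rule refl_onI)
    fix x assume "x \<in> punctured_plane \<times> (UNIV :: complex set)"
    moreover have "x = (hopf_map (b powi 0) (fst x), \<nu> powi 0 * snd x)"
      by (simp add: hopf_map_def case_prod_unfold)
    ultimately show "(x, x) \<in> total_rel b \<nu>"
      unfolding total_rel_iff mem_Times_iff by blast
  qed
  show "sym (total_rel b \<nu>)"
  proof (rule symI)
    fix x y assume "(x, y) \<in> total_rel b \<nu>"
    then obtain n where x: "fst x \<in> punctured_plane" and y: "y = (hopf_map (b powi n) (fst x), \<nu> powi n * snd x)"
      unfolding total_rel_iff by blast
    have "x = (hopf_map (b powi - n) (fst y), \<nu> powi - n * snd y)"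
      using b_nonzero assms
      by (simp add: y hopf_map_def case_prod_unfold prod_eq_iff power_int_minus field_simps)
    moreover have "fst y \<in> punctured_plane" using hopf_map_power_punctured[OF x] by (simp add: y)
    ultimately show "(y, x) \<in> total_rel b \<nu>" unfolding total_rel_iff by blast
  qed
  show "trans (total_rel b \<nu>)"
  proof (rule transI)
    fix x y z assume xy: "(x, y) \<in> total_rel b \<nu>" and yz: "(y, z) \<in> total_rel b \<nu>"
    obtain n where x: "fst x \<in> punctured_plane" and y: "y = (hopf_map (b powi n) (fst x), \<nu> powi n * snd x)"
      using xy unfolding total_rel_iff by blast
    obtain m where z: "z = (hopf_map (b powi m) (fst y), \<nu> powi m * snd y)"
      using yz unfolding total_rel_iff by blast
    have "z = (hopf_map (b powi (m + n)) (fst x), \<nu> powi (m + n) * snd x)"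
      using b_nonzero assms
      by (simp add: z y hopf_map_def case_prod_unfold prod_eq_iff power_int_add)
    then show "(x, z) \<in> total_rel b \<nu>" unfolding total_rel_iff using x by blast
  qed
qed

text \<open>The generator multiplies \<open>v\<close> by \<open>b\<close> and the quadratic form by
  \<open>b\<^sup>2\<close>, so the equation holds on a whole class as soon as it holds at one
  representative.\<close>

lemma Union_spectral_curve:
  assumes \<phi>: "\<And>p v. p \<in> punctured_plane \<Longrightarrow> det (mat v - \<phi> p) = v\<^sup>2 - qform \<alpha> \<beta> \<gamma> p"
  shows "\<Union> (spectral_curve b b \<phi>) = {(p, v). p \<in> punctured_plane \<and> v\<^sup>2 = qform \<alpha> \<beta> \<gamma> p}"
proof -
  note eq = equiv_total_rel[OF b_nonzero]
  have scale: "qform \<alpha> \<beta> \<gamma> (hopf_map c p) = c\<^sup>2 * qform \<alpha> \<beta> \<gamma> p" for c p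
    by (simp add: qform_def hopf_map_def case_prod_unfold power_mult_distrib algebra_simps power2_eq_square)
  have sub: "C \<subseteq> punctured_plane \<times> UNIV" if "C \<in> total_space b b" for C
    using in_quotient_imp_subset[OF eq] that by (simp add: total_space_def)
  have cls: "total_rel b b `` {(p, v)} \<in> spectral_curve b b \<phi>"
    if p: "p \<in> punctured_plane" and v: "v\<^sup>2 = qform \<alpha> \<beta> \<gamma> p" for p v
  proof -
    have C: "total_rel b b `` {(p, v)} \<in> total_space b b"
      unfolding total_space_def using p by (intro quotientI) simp
    moreover have "det (mat v' - \<phi> p') = 0" if "(p', v') \<in> total_rel b b `` {(p, v)}" for p' v'
    proof -
      have "p' \<in> punctured_plane" using sub[OF C] that by blast
      moreover have "v'\<^sup>2 = qform \<alpha> \<beta> \<gamma> p'"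
        using that v by (auto simp: total_rel_def scale power_mult_distrib)
      ultimately show ?thesis using \<phi> by simp
    qed
    ultimately show ?thesis by (auto simp: spectral_curve_def)
  qed
  show ?thesis
  proof (intro set_eqI iffI)
    fix x assume "x \<in> \<Union> (spectral_curve b b \<phi>)"
    then obtain C where C: "C \<in> total_space b b" "x \<in> C" "\<forall>(p, v)\<in>C. det (mat v - \<phi> p) = 0"
      by (auto simp: spectral_curve_def)
    then show "x \<in> {(p, v). p \<in> punctured_plane \<and> v\<^sup>2 = qform \<alpha> \<beta> \<gamma> p}"
      using sub[OF C(1)] \<phi> by (cases x) fastforce
  next
    fix x assume "x \<in> {(p, v). p \<in> punctured_plane \<and> v\<^sup>2 = qform \<alpha> \<beta> \<gamma> p}"
    then obtain p v where x: "x = (p, v)" "p \<in> punctured_plane" "v\<^sup>2 = qform \<alpha> \<beta> \<gamma> p" by auto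
    have "x \<in> total_rel b b `` {(p, v)}"
      using x(2) equiv_class_self[OF eq] unfolding x(1) by blast
    then show "x \<in> \<Union> (spectral_curve b b \<phi>)" using cls[OF x(2,3)] by blast
  qed
qed

lemma spectral_curve_irreducible:
  assumes \<phi>: "\<And>p v. p \<in> punctured_plane \<Longrightarrow> det (mat v - \<phi> p) = v\<^sup>2 - qform \<alpha> \<beta> \<gamma> p"
    and disc: "\<beta>\<^sup>2 - 4 * \<alpha> * \<gamma> \<noteq> 0"
  shows "irreducible_in_total_space b b (spectral_curve b b \<phi>)"
proof -
  let ?Z = "spectral_curve b b \<phi>"
  let ?V = "{(p, v). p \<in> punctured_plane \<and> v\<^sup>2 = qform \<alpha> \<beta> \<gamma> p}"
  have UZ: "\<Union> ?Z = ?V" by (rule Union_spectral_curve) (rule \<phi>)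
  note eq = equiv_total_rel[OF b_nonzero]
  have Zsub: "?Z \<subseteq> total_space b b" by (auto simp: spectral_curve_def)
  obtain m11 m12 m21 m22 where m: "m11 * m22 - m12 * m21 \<noteq> 0"
    and Q: "\<forall>x y. qform \<alpha> \<beta> \<gamma> (m11 * x + m12 * y, m21 * x + m22 * y) = x * y"
    and surj: "\<forall>p. \<exists>x y. p = (m11 * x + m12 * y, m21 * x + m22 * y)"
    by (rule qform_parametrization[OF disc])
  define A where "A = (\<lambda>z :: complex \<times> complex. m11 * (fst z)\<^sup>2 + m12 * (snd z)\<^sup>2)"
  define B where "B = (\<lambda>z :: complex \<times> complex. m21 * (fst z)\<^sup>2 + m22 * (snd z)\<^sup>2)"
  define C where "C = (\<lambda>z :: complex \<times> complex. fst z * snd z)"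
  have hol: "A holomorphic2_on punctured_plane" "B holomorphic2_on punctured_plane"
      "C holomorphic2_on punctured_plane"
    unfolding A_def B_def C_def by (intro holomorphic2_intros)+
  have AB: "(A z, B z) \<in> punctured_plane" if "z \<in> punctured_plane" for z
    using linear_substitution_punctured[OF m, of "((fst z)\<^sup>2, (snd z)\<^sup>2)"] that
    by (simp add: A_def B_def punctured_plane_iff)
  have ABC: "((A z, B z), C z) \<in> ?V" if "z \<in> punctured_plane" for z
    using AB[OF that] Q[rule_format, of "(fst z)\<^sup>2" "(snd z)\<^sup>2"]
    by (simp add: A_def B_def C_def power_mult_distrib)
  have onto: "\<exists>z\<in>punctured_plane. x = ((A z, B z), C z)" if "x \<in> ?V" for x
  proof -
    define p where "p = fst x"
    define v where "v = snd x"
    have x: "x = (p, v)" "p \<in> punctured_plane" "v\<^sup>2 = qform \<alpha> \<beta> \<gamma> p"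
      using that by (simp_all add: p_def v_def case_prod_unfold)
    obtain c d where p: "p = (m11 * c + m12 * d, m21 * c + m22 * d)" using surj by blast
    have v2: "v\<^sup>2 = c * d" using x(3) Q unfolding p by simp
    define \<xi> where "\<xi> = csqrt c"
    \<comment> \<open>The square roots of \<open>c\<close> and \<open>d\<close> have product
      \<open>v\<close> or \<open>- v\<close>; the sign of the second one is chosen so that the
      product is \<open>v\<close>.\<close>
    define \<eta> where "\<eta> = (if csqrt c * csqrt d = v then csqrt d else - csqrt d)"
    have sq: "\<xi>\<^sup>2 = c" "\<eta>\<^sup>2 = d" by (auto simp: \<xi>_def \<eta>_def)
    have "(csqrt c * csqrt d)\<^sup>2 = v\<^sup>2" using v2 by (simp add: power_mult_distrib)
    then have "\<xi> * \<eta> = v" by (auto simp: \<xi>_def \<eta>_def power2_eq_iff)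
    moreover have "(\<xi>, \<eta>) \<in> punctured_plane"
      using x(2) sq by (auto simp: p punctured_plane_iff)
    ultimately show ?thesis
      using sq by (intro bexI[of _ "(\<xi>, \<eta>)"]) (auto simp: A_def B_def C_def x p)
  qed
  have an: "analytic_in_total_space b b ?Z"
    unfolding analytic_in_total_space_def UZ analytic_subset_def
  proof (intro conjI ballI Zsub)
    fix p assume p: "p \<in> punctured_plane \<times> (UNIV :: complex set)"
    let ?g = "\<lambda>((x, y), v). v\<^sup>2 - qform \<alpha> \<beta> \<gamma> (x, y)"
    have "?V \<inter> punctured_plane \<times> UNIV = {z \<in> punctured_plane \<times> UNIV. \<forall>g\<in>{?g}. g z = 0}"
      by auto
    then show "\<exists>U G. open U \<and> p \<in> U \<and> U \<subseteq> punctured_plane \<times> UNIV \<and> finite G \<and>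
        (\<forall>g\<in>G. g holomorphic3_on U) \<and> ?V \<inter> U = {z \<in> U. \<forall>g\<in>G. g z = 0}"
      using p open_total_domain holomorphic3_on_quadric
      by (intro exI[of _ "punctured_plane \<times> UNIV"] exI[of _ "{?g}"]) simp
  qed auto
  have one: "(1, 0) \<in> punctured_plane" by (simp add: punctured_plane_iff)
  have ne: "?Z \<noteq> {}" using ABC[OF one] unfolding UZ[symmetric] by blast
  \<comment> \<open>Classes are disjoint, so a set of classes of the curve whose union contains the
    parametrized cone already contains every class of the curve.\<close>
  have full: "Z' = ?Z" if Z': "Z' \<subseteq> ?Z" "\<forall>z\<in>punctured_plane. ((A z, B z), C z) \<in> \<Union>Z'" for Z'
  proof
    show "?Z \<subseteq> Z'"
    proof
      fix K assume K: "K \<in> ?Z"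
      then have KQ: "K \<in> (punctured_plane \<times> UNIV) // total_rel b b"
        using Zsub by (auto simp: total_space_def)
      obtain x where x: "x \<in> K" using in_quotient_imp_non_empty[OF eq KQ] by blast
      have "x \<in> ?V" unfolding UZ[symmetric] using x K by (rule UnionI[rotated])
      from onto[OF this] obtain z where "z \<in> punctured_plane" "x = ((A z, B z), C z)" by blast
      with Z'(2) have "x \<in> \<Union>Z'" by simp
      then obtain K' where K': "K' \<in> Z'" "x \<in> K'" by (rule UnionE)
      have "K' \<in> (punctured_plane \<times> UNIV) // total_rel b b"
        using K'(1) Z'(1) Zsub by (auto simp: total_space_def)
      from quotient_disj[OF eq KQ this] x K'(2) have "K = K'" by blast
      then show "K \<in> Z'" using K'(1) by simp
    qed
  qed (rule Z'(1))
  have split: "(\<forall>z\<in>punctured_plane. ((A z, B z), C z) \<in> \<Union>Z1) \<or> (\<forall>z\<in>punctured_plane. ((A z, B z), C z) \<in> \<Union>Z2)"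
    if "analytic_in_total_space b b Z1" "analytic_in_total_space b b Z2" "?Z = Z1 \<union> Z2" for Z1 Z2
  proof (rule parametrized_analytic_irreducible[OF hol AB])
    show "analytic_subset (punctured_plane \<times> UNIV) (\<Union>Z1)" "analytic_subset (punctured_plane \<times> UNIV) (\<Union>Z2)"
      using that by (simp_all add: analytic_in_total_space_def)
    show "((A z, B z), C z) \<in> \<Union>Z1 \<union> \<Union>Z2" if "z \<in> punctured_plane" for z
      using ABC[OF that] unfolding UZ[symmetric] \<open>?Z = Z1 \<union> Z2\<close> by (simp only: Union_Un_distrib)
  qed
  show ?thesis
    unfolding irreducible_in_total_space_def
  proof (intro conjI allI impI an ne)
    fix Z1 Z2
    assume Z: "analytic_in_total_space b b Z1 \<and> analytic_in_total_space b b Z2 \<and> ?Z = Z1 \<union> Z2"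
    then have "Z1 \<subseteq> ?Z" "Z2 \<subseteq> ?Z" by blast+
    with split[of Z1 Z2] Z full show "Z1 = ?Z \<or> Z2 = ?Z" by blast
  qed
qed

lemma phi1_spectral_irreducible:
  assumes "s\<^sup>2 - 4 * t\<^sup>2 * u \<noteq> 0"
  shows "irreducible_in_total_space b b (spectral_curve b b (phi1 s t u))"
proof (rule spectral_curve_irreducible)
  show "det (mat v - phi1 s t u p) = v\<^sup>2 - qform (t\<^sup>2) s u p" for p v
    by (simp only: phi1_eq det_mat_diff_mat2) (simp add: qform_def algebra_simps power2_eq_square)
qed (rule assms)

lemma qform_square:
  assumes "\<beta>\<^sup>2 - 4 * \<alpha> * \<gamma> = 0"
  shows "\<exists>u v. \<forall>p. qform \<alpha> \<beta> \<gamma> p = (u * fst p + v * snd p)\<^sup>2"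
proof (cases "\<alpha> = 0")
  case True
  then have "\<beta> = 0" using assms by simp
  then have "qform \<alpha> \<beta> \<gamma> p = (0 * fst p + csqrt \<gamma> * snd p)\<^sup>2" for p
    using True by (simp add: qform_def power_mult_distrib)
  then show ?thesis by blast
next
  case False
  define a where "a = csqrt \<alpha>"
  have a: "a\<^sup>2 = \<alpha>" "a \<noteq> 0" using False by (auto simp: a_def)
  define c where "c = \<beta> / (2 * a)"
  have \<beta>: "\<beta> = 2 * a * c" using a(2) by (simp add: c_def)
  have "4 * a\<^sup>2 * c\<^sup>2 = 4 * a\<^sup>2 * \<gamma>"
    using assms by (simp add: \<beta> power_mult_distrib flip: a(1))
  then have "\<gamma> = c\<^sup>2" using a(2) by simp
  then have "qform \<alpha> \<beta> \<gamma> p = (a * fst p + c * snd p)\<^sup>2" for p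
    by (simp add: qform_def \<beta> power2_eq_square algebra_simps flip: a(1))
  then show ?thesis by blast
qed

text \<open>Were the discriminant zero, \<open>\<beta>\<close> would be the square of a linear form,
  which is a section of the bundle with multiplier \<open>b\<close>.\<close>

lemma phi2_spectral_irreducible:
  assumes \<beta>: "\<beta> \<in> sections b (b\<^sup>2)"
    and nonsquare: "\<not> (\<exists>t\<in>sections b b. \<forall>p\<in>punctured_plane. \<beta> p = (t p)\<^sup>2)"
  shows "irreducible_in_total_space b b (spectral_curve b b (phi2 \<beta>))"
proof -
  obtain c1 c2 c3 where c: "\<forall>p\<in>punctured_plane. \<beta> p = qform c1 c2 c3 p"
    using sections_b2_quadratic[OF \<beta>] unfolding qform_def by (elim exE)
  show ?thesis
  proof (rule spectral_curve_irreducible)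
    show "det (mat v - phi2 \<beta> p) = v\<^sup>2 - qform c1 c2 c3 p" if "p \<in> punctured_plane" for p v
      using det_mat_diff_mat2[of v 0 "\<beta> p" 1] c that by (simp add: phi2_eq)
    show "c2\<^sup>2 - 4 * c1 * c3 \<noteq> 0"
    proof
      assume "c2\<^sup>2 - 4 * c1 * c3 = 0"
      then obtain u v where "\<forall>p. qform c1 c2 c3 p = (u * fst p + v * snd p)\<^sup>2"
        using qform_square by blast
      then have "\<forall>p\<in>punctured_plane. \<beta> p = (u * fst p + v * snd p)\<^sup>2"
        using c by (metis (no_types))
      then have "\<exists>t\<in>sections b b. \<forall>p\<in>punctured_plane. \<beta> p = (t p)\<^sup>2"
        by (intro bexI[of _ "\<lambda>p. u * fst p + v * snd p"] sections_linear)
      then show False using nonsquare by blast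
    qed
  qed
qed

end

theorem proposition5p5:
  fixes b :: complex
  assumes b: "0 < cmod b" "cmod b < 1"
  shows
    "(\<forall>s t u. s\<^sup>2 - 4 * t\<^sup>2 * u \<noteq> 0 \<longrightarrow>
        line_degree b 1 \<le> 0 \<and> phi1 s t u \<in> higgs_fields b b 1 \<and> nowhere_vanishing (phi1 s t u)) \<and>
     (\<forall>\<beta>\<in>sections b (b ^ 2).
        line_degree b (inverse b) \<le> 0 \<and> phi2 \<beta> \<in> higgs_fields b b (inverse b) \<and>
        nowhere_vanishing (phi2 \<beta>)) \<and>
     (\<forall>k u v. (u, v) \<noteq> (0, 0) \<longrightarrow>
        line_degree b (inverse b ^ k) \<le> 0 \<and> phi3 k u v \<in> higgs_fields b b (inverse b ^ k) \<and>
        nowhere_vanishing (phi3 k u v)) \<and>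
     (\<forall>\<tau> \<phi>. \<tau> \<noteq> 0 \<and> line_degree b \<tau> \<le> 0 \<and> \<phi> \<in> higgs_fields b b \<tau> \<and> nowhere_vanishing \<phi> \<longrightarrow>
        (\<tau> = 1 \<and> (\<exists>s t u. s\<^sup>2 - 4 * t\<^sup>2 * u \<noteq> 0 \<and> conjugate_higgs b \<tau> \<phi> (phi1 s t u))) \<or>
        (\<tau> = inverse b \<and> (\<exists>\<beta>\<in>sections b (b ^ 2). conjugate_higgs b \<tau> \<phi> (phi2 \<beta>))) \<or>
        (\<exists>k u v. \<tau> = inverse b ^ k \<and> (u, v) \<noteq> (0, 0) \<and> conjugate_higgs b \<tau> \<phi> (phi3 k u v))) \<and>
     (\<forall>s t u s' t' u'. s\<^sup>2 - 4 * t\<^sup>2 * u \<noteq> 0 \<and> s'\<^sup>2 - 4 * t'\<^sup>2 * u' \<noteq> 0 \<longrightarrow>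
        (conjugate_higgs b 1 (phi1 s t u) (phi1 s' t' u') \<longleftrightarrow>
           s' = s \<and> u' = u \<and> (t' = t \<or> t' = - t))) \<and>
     (\<forall>\<beta>\<in>sections b (b ^ 2). \<forall>\<beta>'\<in>sections b (b ^ 2).
        conjugate_higgs b (inverse b) (phi2 \<beta>) (phi2 \<beta>') \<longleftrightarrow>
          (\<forall>p\<in>punctured_plane. \<beta>' p = \<beta> p)) \<and>
     (\<forall>k u v u' v'. (u, v) \<noteq> (0, 0) \<and> (u', v') \<noteq> (0, 0) \<longrightarrow>
        (conjugate_higgs b (inverse b ^ k) (phi3 k u v) (phi3 k u' v') \<longleftrightarrow> u' = u \<and> v' = v)) \<and>
     (\<forall>s t u u' v'. s\<^sup>2 - 4 * t\<^sup>2 * u \<noteq> 0 \<and> (u', v') \<noteq> (0, 0) \<longrightarrow>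
        \<not> conjugate_higgs b 1 (phi1 s t u) (phi3 0 u' v')) \<and>
     (\<forall>\<beta>\<in>sections b (b ^ 2). \<forall>u v. (u, v) \<noteq> (0, 0) \<longrightarrow>
        \<not> conjugate_higgs b (inverse b) (phi2 \<beta>) (phi3 1 u v)) \<and>
     (\<forall>s t u. s\<^sup>2 - 4 * t\<^sup>2 * u \<noteq> 0 \<longrightarrow>
        irreducible_in_total_space b b (spectral_curve b b (phi1 s t u))) \<and>
     (\<forall>\<beta>\<in>sections b (b ^ 2). \<not> (\<exists>t\<in>sections b b. \<forall>p\<in>punctured_plane. \<beta> p = (t p)\<^sup>2) \<longrightarrow>
        irreducible_in_total_space b b (spectral_curve b b (phi2 \<beta>))) \<and>
     (\<forall>\<beta>\<in>sections b (b ^ 2). \<forall>t\<in>sections b b. (\<forall>p\<in>punctured_plane. \<beta> p = (t p)\<^sup>2) \<longrightarrow>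
        (\<forall>\<mu> \<sigma>. invariant_sub_line_bundle b b (inverse b) (phi2 \<beta>) \<mu> \<sigma> \<longleftrightarrow>
           \<mu> = inverse b \<and>
           (same_image \<sigma> (\<lambda>p. vector [t p, 1]) \<or> same_image \<sigma> (\<lambda>p. vector [- t p, 1])))) \<and>
     (\<forall>k u v. (u, v) \<noteq> (0, 0) \<longrightarrow>
        (\<forall>\<mu> \<sigma>. invariant_sub_line_bundle b b (inverse b ^ k) (phi3 k u v) \<mu> \<sigma> \<longleftrightarrow>
           \<mu> = 1 \<and> same_image \<sigma> (\<lambda>p. vector [1, 0]) \<or>
           \<mu> = inverse b ^ (1 + k) \<and>
           same_image \<sigma> (\<lambda>(x, y). vector [(cnj v * x - cnj u * y) ^ (1 + k),
                                           - 2 * u * x - 2 * v * y])))"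
proof -
  interpret hopf b by unfold_locales (rule b)+
  have inv2: "invariant_sub_line_bundle b b (inverse b) (phi2 \<beta>) \<mu> \<sigma> \<longleftrightarrow> \<mu> = inverse b \<and>
      (same_image \<sigma> (\<lambda>p. vector [t p, 1]) \<or> same_image \<sigma> (\<lambda>p. vector [- t p, 1]))"
    if t: "t \<in> sections b b" and \<beta>: "\<forall>p\<in>punctured_plane. \<beta> p = (t p)\<^sup>2" for \<beta> t \<mu> \<sigma>
  proof
    assume "invariant_sub_line_bundle b b (inverse b) (phi2 \<beta>) \<mu> \<sigma>"
    with t \<beta>[rule_format] show "\<mu> = inverse b \<and>
        (same_image \<sigma> (\<lambda>p. vector [t p, 1]) \<or> same_image \<sigma> (\<lambda>p. vector [- t p, 1]))"
      by (rule phi2_invariant_imp)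
  next
    assume *: "\<mu> = inverse b \<and>
        (same_image \<sigma> (\<lambda>p. vector [t p, 1]) \<or> same_image \<sigma> (\<lambda>p. vector [- t p, 1]))"
    have "\<beta> p = (- t p)\<^sup>2" if "p \<in> punctured_plane" for p
      using \<beta> that by simp
    with * \<beta>[rule_format] show "invariant_sub_line_bundle b b (inverse b) (phi2 \<beta>) \<mu> \<sigma>"
      by (elim conjE disjE; hypsubst, intro phi2_invariantI[OF t] phi2_invariantI[OF sections_minus[OF t]])
  qed
  have inv3: "invariant_sub_line_bundle b b (inverse b ^ k) (phi3 k u v) \<mu> \<sigma> \<longleftrightarrow>
      \<mu> = 1 \<and> same_image \<sigma> (\<lambda>p. vector [1, 0]) \<or>
      \<mu> = inverse b ^ (1 + k) \<and>
      same_image \<sigma> (\<lambda>(x, y). vector [(cnj v * x - cnj u * y) ^ (1 + k), - 2 * u * x - 2 * v * y])"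
    if "(u, v) \<noteq> (0, 0)" for k u v \<mu> \<sigma>
  proof -
    have "(\<lambda>(x, y). vector [(cnj v * x - cnj u * y) ^ (1 + k), - 2 * u * x - 2 * v * y]) =
        (\<lambda>p. vector [(cnj v * fst p - cnj u * snd p) ^ (1 + k), - 2 * (u * fst p + v * snd p)] :: complex ^ 2)"
      by (simp add: fun_eq_iff algebra_simps)
    note * = this
    show ?thesis
      unfolding *
    proof (rule iffI)
      assume "invariant_sub_line_bundle b b (inverse b ^ k) (phi3 k u v) \<mu> \<sigma>"
      with that show "\<mu> = 1 \<and> same_image \<sigma> (\<lambda>p. vector [1, 0]) \<or> \<mu> = inverse b ^ (1 + k) \<and>
          same_image \<sigma> (\<lambda>p. vector [(cnj v * fst p - cnj u * snd p) ^ (1 + k), - 2 * (u * fst p + v * snd p)])"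
        by (rule phi3_invariant_imp)
    qed (elim disjE conjE; hypsubst,
         (erule phi3_invariant_first_summand phi3_invariant_second[OF that]))
  qed
  have deg: "line_degree b 1 \<le> 0" "line_degree b (inverse b) \<le> 0" "line_degree b (inverse b ^ k) \<le> 0" for k
    using line_degree_inverse_power[of 0] line_degree_inverse_power[of 1] line_degree_inverse_power[of k]
    by simp_all
  show ?thesis
  proof (intro conjI allI ballI impI, goal_cases)
    case 1
    show ?case by (rule deg)
  next
    case 2
    show ?case by (rule phi1_higgs)
  next
    case 3
    then show ?case by (rule phi1_nowhere_vanishing)
  next
    case 4
    show ?case by (rule deg)
  next
    case 5
    then show ?case by (rule phi2_higgs)
  next
    case 6
    show ?case by (rule phi2_nowhere_vanishing)
  next
    case 7
    show ?case by (rule deg)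
  next
    case 8
    show ?case by (rule phi3_higgs)
  next
    case 9
    then show ?case by (rule phi3_nowhere_vanishing)
  next
    case 10
    then show ?case by (elim conjE) (rule higgs_classification)
  next
    case 11
    then show ?case by (elim conjE) (rule phi1_conjugate_iff)
  next
    case 12
    show ?case by (rule phi2_conjugate_iff)
  next
    case 13
    then show ?case by (elim conjE) (rule phi3_conjugate_iff)
  next
    case 14
    then show ?case by (elim conjE) (rule phi1_not_conjugate_phi3)
  next
    case 15
    show ?case by (rule phi2_not_conjugate_phi3)
  next
    case 16
    then show ?case by (rule phi1_spectral_irreducible)
  next
    case 17
    then show ?case by (rule phi2_spectral_irreducible)
  next
    case 18
    from 18(2,3) show ?case by (rule inv2)
  next
    case 19
    then show ?case by (rule inv3)
  qed
qed

end
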